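(* The operator $\mathcal A$ has no purely imaginary eigenvalues, i.e. $\sigma(\mathcal A)\cap i\mathbb R=\emptyset$, and the $C_0$-semigroup of contractions $(e^{t\mathcal A})_{t\ge0}$ is strongly stable on $\mathcal H$: for every $U_0\in\mathcal H$, $\lim_{t\to+\infty}\|e^{t\mathcal A}U_0\|_{\mathcal H}=0$.
   Context: Let $\rho_1,\rho_2,k_1,k_2,k_3,l,L$ be positive real numbers, $0<\beta<L$, $a_0>0$, and $a(x)=a_0$ for $x\in(0,\beta)$, $a(x)=0$ for $x\in(\beta,L)$. Let $\mathcal H=(H^1_0(0,L)\times L^2(0,L))^3$ with inner product, for $U=(v^1,\dots,v^6)$, $\tilde U=(\tilde v^1,\dots,\tilde v^6)$, $$(U,\tilde U)_{\mathcal H}=\int_0^L\Big(k_1(v^1_x+v^3+lv^5)\overline{(\tilde v^1_x+\tilde v^3+l\tilde v^5)}+\rho_1v^2\overline{\tilde v^2}+k_2v^3_x\overline{\tilde v^3_x}+\rho_2v^4\overline{\tilde v^4}+k_3(v^5_x-lv^1)\overline{(\tilde v^5_x-l\tilde v^1)}+\rho_1v^6\overline{\tilde v^6}\Big)dx.$$ Let $D(\mathcal A)=[(H^2(0,L)\cap H^1_0(0,L))\times H^1_0(0,L)]^3$ and $$\mathcal A(v^1,\dots,v^6)^\top=\Big(v^2,\ \tfrac{k_1}{\rho_1}(v^1_x+v^3+lv^5)_x+\tfrac{lk_3}{\rho_1}(v^5_x-lv^1),\ v^4,\ \tfrac{k_2}{\rho_2}v^3_{xx}-\tfrac{k_1}{\rho_2}(v^1_x+v^3+lv^5),\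 v^6,\ \tfrac{k_3}{\rho_1}(v^5_x-lv^1)_x-\tfrac{lk_1}{\rho_1}(v^1_x+v^3+lv^5)-\tfrac{a(x)}{\rho_1}v^6\Big)^\top.$$ $\mathcal A$ is m-dissipative and generates a $C_0$-semigroup of contractions $e^{t\mathcal A}$ on $\mathcal H$. *)

theory Defs
  imports "HOL-Analysis.Analysis"
begin

(* Functions on (0,L) are complex valued functions on the reals; only their
   values on [0,L] matter.  A state U of the phase space H is represented by
   U :: nat => real => complex with components U 1, ..., U 6 (other indices
   are irrelevant). *)

type_synonym state = "nat \<Rightarrow> real \<Rightarrow> complex"

record bresse_params =
  rho1 :: real
  rho2 :: real
  kk1 :: real
  kk2 :: real
  kk3 :: real
  ll :: real
  len :: real
  damp :: "real \<Rightarrow> real"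

definition L2 :: "real \<Rightarrow> (real \<Rightarrow> complex) \<Rightarrow> bool" where
  "L2 L f \<longleftrightarrow> f measurable_on {0..L} \<and> (\<lambda>x. (cmod (f x))\<^sup>2) integrable_on {0..L}"

definition has_wderiv :: "real \<Rightarrow> (real \<Rightarrow> complex) \<Rightarrow> (real \<Rightarrow> complex) \<Rightarrow> bool" where
  "has_wderiv L u g \<longleftrightarrow> L2 L g \<and> (\<forall>x\<in>{0..L}. u x = u 0 + integral {0..x} g)"

definition H1 :: "real \<Rightarrow> (real \<Rightarrow> complex) \<Rightarrow> bool" where
  "H1 L u \<longleftrightarrow> (\<exists>g. has_wderiv L u g)"

definition H10 :: "real \<Rightarrow> (real \<Rightarrow> complex) \<Rightarrow> bool" where
  "H10 L u \<longleftrightarrow> H1 L u \<and> u 0 = 0 \<and> u L = 0"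

definition H2 :: "real \<Rightarrow> (real \<Rightarrow> complex) \<Rightarrow> bool" where
  "H2 L u \<longleftrightarrow> (\<exists>g h. has_wderiv L u g \<and> has_wderiv L g h)"

(* first and second weak derivatives (determined a.e.) *)
definition wd :: "real \<Rightarrow> (real \<Rightarrow> complex) \<Rightarrow> real \<Rightarrow> complex" where
  "wd L u = (SOME g. has_wderiv L u g)"

definition wd2 :: "real \<Rightarrow> (real \<Rightarrow> complex) \<Rightarrow> real \<Rightarrow> complex" where
  "wd2 L u = (SOME h. \<exists>g. has_wderiv L u g \<and> has_wderiv L g h)"

definition sadd :: "state \<Rightarrow> state \<Rightarrow> state" where
  "sadd U V = (\<lambda>i x. U i x + V i x)"

definition sdiff :: "state \<Rightarrow> state \<Rightarrow> state" where
  "sdiff U V = (\<lambda>i x. U i x - V i x)"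

definition sscale :: "complex \<Rightarrow> state \<Rightarrow> state" where
  "sscale c U = (\<lambda>i x. c * U i x)"

definition inH :: "bresse_params \<Rightarrow> state \<Rightarrow> bool" where
  "inH P U \<longleftrightarrow> H10 (len P) (U 1) \<and> L2 (len P) (U 2) \<and> H10 (len P) (U 3) \<and>
                L2 (len P) (U 4) \<and> H10 (len P) (U 5) \<and> L2 (len P) (U 6)"

definition normH :: "bresse_params \<Rightarrow> state \<Rightarrow> real" where
  "normH P U = sqrt (integral {0..len P} (\<lambda>x.
      kk1 P * (cmod (wd (len P) (U 1) x + U 3 x + of_real (ll P) * U 5 x))\<^sup>2
    + rho1 P * (cmod (U 2 x))\<^sup>2
    + kk2 P * (cmod (wd (len P) (U 3) x))\<^sup>2
    + rho2 P * (cmod (U 4 x))\<^sup>2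
    + kk3 P * (cmod (wd (len P) (U 5) x - of_real (ll P) * U 1 x))\<^sup>2
    + rho1 P * (cmod (U 6 x))\<^sup>2))"

definition inDA :: "bresse_params \<Rightarrow> state \<Rightarrow> bool" where
  "inDA P U \<longleftrightarrow> H2 (len P) (U 1) \<and> H10 (len P) (U 1) \<and> H10 (len P) (U 2) \<and>
                 H2 (len P) (U 3) \<and> H10 (len P) (U 3) \<and> H10 (len P) (U 4) \<and>
                 H2 (len P) (U 5) \<and> H10 (len P) (U 5) \<and> H10 (len P) (U 6)"

(* the operator A; (v1_x + v3 + l v5)_x is written out as v1_xx + v3_x + l v5_x
   and (v5_x - l v1)_x as v5_xx - l v1_x *)
definition opA :: "bresse_params \<Rightarrow> state \<Rightarrow> state" where
  "opA P U = (\<lambda>i x.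
     let L = len P; l = of_real (ll P) :: complex;
         r1 = of_real (rho1 P) :: complex; r2 = of_real (rho2 P) :: complex;
         c1 = of_real (kk1 P) :: complex; c2 = of_real (kk2 P) :: complex;
         c3 = of_real (kk3 P) :: complex;
         S = wd L (U 1) x + U 3 x + l * U 5 x;
         Sx = wd2 L (U 1) x + wd L (U 3) x + l * wd L (U 5) x;
         Y = wd L (U 5) x - l * U 1 x;
         Yx = wd2 L (U 5) x - l * wd L (U 1) x
     in if i = 1 then U 2 x
        else if i = 2 then c1 / r1 * Sx + l * c3 / r1 * Y
        else if i = 3 then U 4 x
        else if i = 4 then c2 / r2 * wd2 L (U 3) x - c1 / r2 * S
        else if i = 5 then U 6 x
        else if i = 6 then c3 / r1 * Yx - l * c1 / r1 * S - of_real (damp P x) / r1 * U 6 x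
        else 0)"

(* T is a C_0-semigroup of bounded linear operators on H whose infinitesimal
   generator is A (states are identified when their H-distance is 0) *)
definition C0_semigroup_generated_by_A :: "bresse_params \<Rightarrow> (real \<Rightarrow> state \<Rightarrow> state) \<Rightarrow> bool" where
  "C0_semigroup_generated_by_A P T \<longleftrightarrow>
     (\<forall>t\<ge>0. \<forall>U. inH P U \<longrightarrow> inH P (T t U)) \<and>
     (\<forall>t\<ge>0. \<forall>U V c. inH P U \<longrightarrow> inH P V \<longrightarrow>
        normH P (sdiff (T t (sadd (sscale c U) V)) (sadd (sscale c (T t U)) (T t V))) = 0) \<and>
     (\<forall>t\<ge>0. \<exists>C. \<forall>U. inH P U \<longrightarrow> normH P (T t U) \<le> C * normH P U) \<and>
     (\<forall>U. inH P U \<longrightarrow> normH P (sdiff (T 0 U) U) = 0) \<and>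
     (\<forall>t\<ge>0. \<forall>s\<ge>0. \<forall>U. inH P U \<longrightarrow> normH P (sdiff (T (t + s) U) (T t (T s U))) = 0) \<and>
     (\<forall>U. inH P U \<longrightarrow> ((\<lambda>t. normH P (sdiff (T t U) U)) \<longlongrightarrow> 0) (at_right 0)) \<and>
     (\<forall>U. inH P U \<longrightarrow>
        ((\<exists>V. inH P V \<and>
             ((\<lambda>h. normH P (sdiff (sscale (of_real (1 / h)) (sdiff (T h U) U)) V)) \<longlongrightarrow> 0) (at_right 0))
         \<longleftrightarrow> (\<exists>W. inDA P W \<and> normH P (sdiff U W) = 0))) \<and>
     (\<forall>U V W. inH P U \<longrightarrow> inH P V \<longrightarrow> inDA P W \<longrightarrow> normH P (sdiff U W) = 0 \<longrightarrow>
        ((\<lambda>h. normH P (sdiff (sscale (of_real (1 / h)) (sdiff (T h U) U)) V)) \<longlongrightarrow> 0) (at_right 0) \<longrightarrow>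
        normH P (sdiff V (opA P W)) = 0)"

(* \<lambda> belongs to the resolvent set of A: \<lambda>I - A : D(A) \<rightarrow> H is bijective
   (modulo identification) with bounded inverse *)
definition in_resolvent :: "bresse_params \<Rightarrow> complex \<Rightarrow> bool" where
  "in_resolvent P z \<longleftrightarrow>
     (\<forall>U. inDA P U \<longrightarrow> normH P (sdiff (sscale z U) (opA P U)) = 0 \<longrightarrow> normH P U = 0) \<and>
     (\<forall>F. inH P F \<longrightarrow> (\<exists>U. inDA P U \<and> normH P (sdiff (sdiff (sscale z U) (opA P U)) F) = 0)) \<and>
     (\<exists>C. \<forall>U. inDA P U \<longrightarrow> normH P U \<le> C * normH P (sdiff (sscale z U) (opA P U)))"

definition spectrum_A :: "bresse_params \<Rightarrow> complex set" where
  "spectrum_A P = {z. \<not> in_resolvent P z}"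

end

theory Submission
  imports Defs "HOL-Library.Function_Algebras" "HOL-Complex_Analysis.Great_Picard"
begin

text \<open>An eigenfunction of an imaginary eigenvalue dissipates no energy, so its longitudinal velocity
  vanishes on the damped interval. There the remaining equations leave only the zero solution with
  homogeneous Dirichlet data at 0, and uniqueness for the Cauchy problem propagates this to the whole
  beam. Solvability of the resolvent equation follows from injectivity by a shooting argument, and
  boundedness of the inverse from compactness of the embedding of the domain.

  For stability let B be the inverse of the generator. An omega-limit point w of an orbit starting in
  the domain is such that, for every k, the orbit of the k-th iterate of B at w has constant norm; so w lies
  in a closed B-invariant subspace N on which B is skew. The compact operator B has a maximising vector
  on N, which yields an imaginary eigenvalue unless N is trivial. Hence orbits
  starting in the domain tend to zero, and so do all orbits by density and contractivity.\<close>

section \<open>Dissipative operators in a seminormed space\<close>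

text \<open>States are functions rather than classes, and the weak derivatives inside
  \<open>normH\<close> and \<open>opA\<close> are chosen only up to null sets, so
  \<open>normH\<close> is a seminorm and \<open>opA\<close> is linear only up to null states. The
  abstract part therefore works modulo vectors of norm zero and replaces the generator by the
  relation \<open>graph\<close>, saturated under distance zero. Its form \<open>ip\<close> is the
  real part of the inner product, which is what energy arguments see.

  The semigroup comes with a bound for each fixed time and with continuity at time zero only.
  Contractivity has to be earned: orbits are shown to be continuous from both sides, the squared
  norm has a nonpositive right derivative on the domain, and density does the rest.

  Limits are supplied by the compact embedding of the domain. Closedness of the generator is deduced
  from solvability of u - A u = f, where dissipativity excludes a kernel. For the beam, solvability
  must cope with a damping coefficient that jumps at \<beta>: the resolvent equation becomes a
  linear Volterra system, and compactness is Arzela-Ascoli for slopes and velocities.\<close>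

lemma quadratic_form_discriminant:
  fixes a b c :: real
  assumes "\<And>t. 0 \<le> a + 2 * t * b + t\<^sup>2 * c" and "0 \<le> c"
  shows "b\<^sup>2 \<le> a * c"
proof (cases "c = 0")
  case True
  have "b = 0"
  proof (rule ccontr)
    assume "b \<noteq> 0"
    \<comment> \<open>An affine function of nonzero slope takes every value; this argument is solved
      from the value -1.\<close>
    then have "a + 2 * (-(a+1)/(2*b)) * b = -1" by (simp add: field_simps)
    with assms(1)[of "-(a+1)/(2*b)"] True show False by simp
  qed
  with True show ?thesis by simp
next
  case False
  with assms have "c > 0" by simp
  moreover have "a + 2 * (-b/c) * b + (-b/c)\<^sup>2 * c = (a * c - b\<^sup>2)/c"
    using \<open>c > 0\<close> by (simp add: field_simps power2_eq_square)
  ultimately show ?thesis using assms(1)[of "-b/c"] by (simp add: zero_le_divide_iff)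
qed

text \<open>The model is the real part of a complex inner product. Complex scalars stay available
  because eigenvalues are imaginary; real bilinearity together with \<open>ip_i\<close> is enough
  for homogeneity under all of them. There is no definiteness: null vectors are genuine
  here.\<close>

locale seminorm_space =
  fixes H :: "'v::ab_group_add set" and sc :: "complex \<Rightarrow> 'v \<Rightarrow> 'v" and ip :: "'v \<Rightarrow> 'v \<Rightarrow> real"
  assumes zero_mem: "0 \<in> H"
    and add_mem: "x \<in> H \<Longrightarrow> y \<in> H \<Longrightarrow> x + y \<in> H"
    and sc_mem: "x \<in> H \<Longrightarrow> sc c x \<in> H"
    and sc_add_left: "sc (a + b) x = sc a x + sc b x"
    and sc_add_right: "sc a (x + y) = sc a x + sc a y"
    and sc_sc: "sc a (sc b x) = sc (a * b) x"
    and sc_one: "sc 1 x = x"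
    and ip_sym: "x \<in> H \<Longrightarrow> y \<in> H \<Longrightarrow> ip x y = ip y x"
    and ip_add_left: "x \<in> H \<Longrightarrow> y \<in> H \<Longrightarrow> z \<in> H \<Longrightarrow> ip (x + y) z = ip x z + ip y z"
    and ip_real_left: "x \<in> H \<Longrightarrow> y \<in> H \<Longrightarrow> ip (sc (of_real r) x) y = r * ip x y"
    and ip_i: "x \<in> H \<Longrightarrow> y \<in> H \<Longrightarrow> ip (sc \<i> x) (sc \<i> y) = ip x y"
    and ip_nonneg: "x \<in> H \<Longrightarrow> 0 \<le> ip x x"
begin

definition nrm :: "'v \<Rightarrow> real" where "nrm x = sqrt (ip x x)"

lemma sc_zero: "sc 0 x = 0"
  using sc_add_left[of 0 0 x] by simp

lemma sc_minus: "sc (- c) x = - sc c x"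
  using sc_add_left[of c "-c" x] by (simp add: sc_zero minus_equation_iff eq_neg_iff_add_eq_0 add.commute)

lemma sc_minus_one: "sc (-1) x = - x"
  by (simp add: sc_minus sc_one)

lemma sc_diff_right: "sc a (x - y) = sc a x - sc a y"
  using sc_add_right[of a "x - y" y] by (simp add: algebra_simps)

lemma minus_mem: "x \<in> H \<Longrightarrow> - x \<in> H"
  using sc_mem[of x "-1"] by (simp add: sc_minus_one)

lemma diff_mem: "x \<in> H \<Longrightarrow> y \<in> H \<Longrightarrow> x - y \<in> H"
  using add_mem[of x "-y"] by (simp add: minus_mem)

lemmas mem = zero_mem add_mem sc_mem minus_mem diff_mem

lemma ip_add_right: "x \<in> H \<Longrightarrow> y \<in> H \<Longrightarrow> z \<in> H \<Longrightarrow> ip z (x + y) = ip z x + ip z y"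
  by (simp add: ip_add_left ip_sym[of z] mem)

lemma ip_real_right: "x \<in> H \<Longrightarrow> y \<in> H \<Longrightarrow> ip x (sc (of_real r) y) = r * ip x y"
  by (simp add: ip_real_left ip_sym[of x] mem)

lemma ip_minus_left: "x \<in> H \<Longrightarrow> y \<in> H \<Longrightarrow> ip (- x) y = - ip x y"
  using ip_real_left[of x y "-1"] by (simp add: sc_minus_one)

lemma ip_minus_right: "x \<in> H \<Longrightarrow> y \<in> H \<Longrightarrow> ip x (- y) = - ip x y"
  using ip_real_right[of x y "-1"] by (simp add: sc_minus_one)

lemma ip_diff_left: "x \<in> H \<Longrightarrow> y \<in> H \<Longrightarrow> z \<in> H \<Longrightarrow> ip (x - y) z = ip x z - ip y z"
  using ip_add_left[of x "-y" z] by (simp add: mem ip_minus_left)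

lemma ip_diff_right: "x \<in> H \<Longrightarrow> y \<in> H \<Longrightarrow> z \<in> H \<Longrightarrow> ip z (x - y) = ip z x - ip z y"
  using ip_add_right[of x "-y" z] by (simp add: mem ip_minus_right)

lemmas ip_simps = ip_add_left ip_add_right ip_real_left ip_real_right ip_minus_left ip_minus_right
  ip_diff_left ip_diff_right

lemma nrm_nonneg: "x \<in> H \<Longrightarrow> 0 \<le> nrm x"
  by (simp add: nrm_def ip_nonneg)

lemma nrm_sq: "x \<in> H \<Longrightarrow> (nrm x)\<^sup>2 = ip x x"
  by (simp add: nrm_def ip_nonneg)

lemma cauchy_schwarz:
  assumes "x \<in> H" "y \<in> H" shows "\<bar>ip x y\<bar> \<le> nrm x * nrm y"
proof -
  have "(ip x y)\<^sup>2 \<le> ip x x * ip y y"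
  proof (rule quadratic_form_discriminant)
    fix t :: real
    have "0 \<le> ip (x + sc (of_real t) y) (x + sc (of_real t) y)"
      using assms by (intro ip_nonneg mem)
    also have "\<dots> = ip x x + 2 * t * ip x y + t\<^sup>2 * ip y y"
      using assms by (simp add: mem ip_simps ip_sym[of y x] power2_eq_square algebra_simps)
    finally show "0 \<le> ip x x + 2 * t * ip x y + t\<^sup>2 * ip y y" .
  qed (use assms in \<open>simp add: ip_nonneg\<close>)
  then have "sqrt ((ip x y)\<^sup>2) \<le> sqrt (ip x x * ip y y)" by (rule real_sqrt_le_mono)
  then show ?thesis by (simp add: nrm_def real_sqrt_mult)
qed

lemma nrm_triangle: assumes "x \<in> H" "y \<in> H" shows "nrm (x + y) \<le> nrm x + nrm y"
proof (rule power2_le_imp_le)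
  have "(nrm (x + y))\<^sup>2 = (nrm x)\<^sup>2 + 2 * ip x y + (nrm y)\<^sup>2"
    using assms by (simp add: nrm_sq mem ip_simps ip_sym[of y x])
  also have "\<dots> \<le> (nrm x + nrm y)\<^sup>2"
    using cauchy_schwarz[OF assms] by (simp add: power2_sum)
  finally show "(nrm (x + y))\<^sup>2 \<le> (nrm x + nrm y)\<^sup>2" .
qed (use assms in \<open>simp add: nrm_nonneg\<close>)

lemma ip_sc_sc: assumes "x \<in> H" "y \<in> H" shows "ip (sc c x) (sc c y) = (cmod c)\<^sup>2 * ip x y"
proof -
  have c: "sc c z = sc (of_real (Re c)) z + sc (of_real (Im c)) (sc \<i> z)" for z
    using complex_eq[of c] by (metis sc_add_left sc_sc mult.commute)
  \<comment> \<open>Multiplication by \<i> is skew for \<open>ip\<close>; this cancels the cross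
    terms when c is split into real and imaginary part.\<close>
  have "ip (sc \<i> x) y = - ip x (sc \<i> y)"
    using ip_i[of "x" "sc \<i> y"] assms by (simp add: mem sc_sc sc_minus_one ip_simps)
  then show ?thesis using assms
    by (simp add: c[of x] c[of y] mem ip_simps ip_i cmod_power2) (simp add: algebra_simps power2_eq_square)
qed

lemma nrm_sc: "x \<in> H \<Longrightarrow> nrm (sc c x) = cmod c * nrm x"
  by (simp add: nrm_def ip_sc_sc real_sqrt_mult)

lemma nrm_minus: "x \<in> H \<Longrightarrow> nrm (- x) = nrm x"
  using nrm_sc[of x "-1"] by (simp add: sc_minus_one)

lemma nrm_zero: "nrm 0 = 0"
  using nrm_sc[OF zero_mem, of 0] by (simp add: sc_zero)

lemma nrm_diff_sym: "x \<in> H \<Longrightarrow> y \<in> H \<Longrightarrow> nrm (x - y) = nrm (y - x)"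
  using nrm_minus[of "x - y"] by (simp add: mem)

lemma nrm_triangle_diff: "x \<in> H \<Longrightarrow> y \<in> H \<Longrightarrow> nrm (x - y) \<le> nrm x + nrm y"
  using nrm_triangle[of x "-y"] by (simp add: mem nrm_minus)

lemma nrm_triangle3: "x \<in> H \<Longrightarrow> y \<in> H \<Longrightarrow> z \<in> H \<Longrightarrow> nrm (x - z) \<le> nrm (x - y) + nrm (y - z)"
  using nrm_triangle[of "x - y" "y - z"] by (simp add: mem)

lemma nrm_lipschitz: "x \<in> H \<Longrightarrow> y \<in> H \<Longrightarrow> \<bar>nrm x - nrm y\<bar> \<le> nrm (x - y)"
  using nrm_triangle[of "x - y" y] nrm_triangle[of "y - x" x] nrm_diff_sym[of x y] by (simp add: mem abs_le_iff)

lemma eqv_sym: "x \<in> H \<Longrightarrow> y \<in> H \<Longrightarrow> nrm (x - y) = 0 \<Longrightarrow> nrm (y - x) = 0"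
  by (simp add: nrm_diff_sym)

lemma eqv_trans:
  "x \<in> H \<Longrightarrow> y \<in> H \<Longrightarrow> z \<in> H \<Longrightarrow> nrm (x - y) = 0 \<Longrightarrow> nrm (y - z) = 0 \<Longrightarrow> nrm (x - z) = 0"
  using nrm_triangle3[of x y z] nrm_nonneg[of "x - z"] by (simp add: mem)

lemma eqv_add:
  "x \<in> H \<Longrightarrow> y \<in> H \<Longrightarrow> x' \<in> H \<Longrightarrow> y' \<in> H \<Longrightarrow> nrm (x - x') = 0 \<Longrightarrow> nrm (y - y') = 0 \<Longrightarrow>
   nrm ((x + y) - (x' + y')) = 0"
  using nrm_triangle[of "x - x'" "y - y'"] nrm_nonneg[of "x + y - (x' + y')"]
  by (simp add: mem algebra_simps)

lemma eqv_diff: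
  "x \<in> H \<Longrightarrow> y \<in> H \<Longrightarrow> x' \<in> H \<Longrightarrow> y' \<in> H \<Longrightarrow> nrm (x - x') = 0 \<Longrightarrow> nrm (y - y') = 0 \<Longrightarrow>
   nrm ((x - y) - (x' - y')) = 0"
  using nrm_triangle_diff[of "x - x'" "y - y'"] nrm_nonneg[of "x - y - (x' - y')"]
  by (simp add: mem algebra_simps)

lemma eqv_sc: "x \<in> H \<Longrightarrow> x' \<in> H \<Longrightarrow> nrm (x - x') = 0 \<Longrightarrow> nrm (sc c x - sc c x') = 0"
  using nrm_sc[of "x - x'" c] by (simp add: mem sc_diff_right)

lemma eqv_nrm: "x \<in> H \<Longrightarrow> x' \<in> H \<Longrightarrow> nrm (x - x') = 0 \<Longrightarrow> nrm x = nrm x'"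
  using nrm_lipschitz[of x x'] by simp

lemma eqv_ip:
  assumes "x \<in> H" "y \<in> H" "x' \<in> H" "y' \<in> H" "nrm (x - x') = 0" "nrm (y - y') = 0"
  shows "ip x y = ip x' y'"
proof -
  have "ip x y - ip x' y' = ip (x - x') y + ip x' (y - y')"
    using assms by (simp add: mem ip_simps)
  then show ?thesis
    using cauchy_schwarz[of "x - x'" y] cauchy_schwarz[of x' "y - y'"] assms by (simp add: mem)
qed

lemma eqv_left:
  "x \<in> H \<Longrightarrow> x' \<in> H \<Longrightarrow> y \<in> H \<Longrightarrow> nrm (x - x') = 0 \<Longrightarrow> nrm (x - y) = nrm (x' - y)"
  by (rule eqv_nrm) (auto simp: mem)

lemma limit_nrm:
  assumes "\<And>n. x n \<in> H" "y \<in> H" "((\<lambda>n. nrm (x n - y)) \<longlongrightarrow> 0) F"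
  shows "((\<lambda>n. nrm (x n)) \<longlongrightarrow> nrm y) F"
proof -
  have "((\<lambda>n. nrm (x n) - nrm y) \<longlongrightarrow> 0) F"
    by (rule Lim_null_comparison[OF _ assms(3)]) (use nrm_lipschitz assms in auto)
  then show ?thesis by (simp add: LIM_zero_iff)
qed

lemma limit_ip:
  assumes "\<And>n. x n \<in> H" "y \<in> H" "((\<lambda>n. nrm (x n - y)) \<longlongrightarrow> 0) F"
    and "\<And>n. u n \<in> H" "v \<in> H" "((\<lambda>n. nrm (u n - v)) \<longlongrightarrow> 0) F"
  shows "((\<lambda>n. ip (x n) (u n)) \<longlongrightarrow> ip y v) F"
proof -
  have "((\<lambda>n. ip (x n) (u n) - ip y v) \<longlongrightarrow> 0) F"
  proof (rule Lim_null_comparison)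
    have "ip (x n) (u n) - ip y v = ip (x n - y) (u n) + ip y (u n - v)" for n
      using assms by (simp add: mem ip_simps)
    moreover have "\<bar>ip (x n - y) (u n) + ip y (u n - v)\<bar> \<le> nrm (x n - y) * nrm (u n) + nrm y * nrm (u n - v)" for n
      using cauchy_schwarz[of "x n - y" "u n"] cauchy_schwarz[of y "u n - v"] assms by (simp add: mem)
    ultimately show "\<forall>\<^sub>F n in F. norm (ip (x n) (u n) - ip y v) \<le> nrm (x n - y) * nrm (u n) + nrm y * nrm (u n - v)"
      by simp
    have "((\<lambda>n. nrm (x n - y) * nrm (u n) + nrm y * nrm (u n - v)) \<longlongrightarrow> 0 * nrm v + nrm y * 0) F"
      by (intro tendsto_intros assms limit_nrm)
    then show "((\<lambda>n. nrm (x n - y) * nrm (u n) + nrm y * nrm (u n - v)) \<longlongrightarrow> 0) F" by simp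
  qed
  then show ?thesis by (simp add: LIM_zero_iff)
qed

lemma limit_unique:
  assumes "\<And>n. x n \<in> H" "y \<in> H" "z \<in> H" "((\<lambda>n. nrm (x n - y)) \<longlongrightarrow> 0) F"
    "((\<lambda>n. nrm (x n - z)) \<longlongrightarrow> 0) F" "F \<noteq> bot"
  shows "nrm (y - z) = 0"
proof -
  have "((\<lambda>n. nrm (x n - y) + nrm (x n - z)) \<longlongrightarrow> 0 + 0) F"
    by (intro tendsto_intros assms)
  moreover have "\<forall>\<^sub>F n in F. nrm (y - z) \<le> nrm (x n - y) + nrm (x n - z)"
    using nrm_triangle3[of y _ z] nrm_diff_sym assms by (metis (no_types, lifting) always_eventually)
  ultimately have "nrm (y - z) \<le> 0"
    using assms(6) tendsto_lowerbound by fastforce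
  then show ?thesis using nrm_nonneg[of "y - z"] assms by (simp add: mem)
qed

end

text \<open>\<open>compact_embedding\<close> plays the role of a compact resolvent and asks of the
  limit only that it lie in \<open>H\<close>. \<open>fredholm\<close> is the Fredholm alternative
  for every z; it is applied at z = 1, to obtain closedness, and on the imaginary axis.\<close>

locale dissipative_operator = seminorm_space H sc ip
  for H :: "'v::ab_group_add set" and sc ip +
  fixes D :: "'v set" and A :: "'v \<Rightarrow> 'v"
  assumes D_mem: "x \<in> D \<Longrightarrow> x \<in> H"
    and A_mem: "x \<in> D \<Longrightarrow> A x \<in> H"
    and D_add: "x \<in> D \<Longrightarrow> y \<in> D \<Longrightarrow> x + y \<in> D"
    and D_sc: "x \<in> D \<Longrightarrow> sc c x \<in> D"
    and A_add: "x \<in> D \<Longrightarrow> y \<in> D \<Longrightarrow> nrm (A (x + y) - (A x + A y)) = 0"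
    and A_sc: "x \<in> D \<Longrightarrow> nrm (A (sc c x) - sc c (A x)) = 0"
    and dissipative: "x \<in> D \<Longrightarrow> ip (A x) x \<le> 0"
    and compact_embedding: "(\<And>n. X n \<in> D) \<Longrightarrow> (\<And>n. nrm (X n) \<le> C) \<Longrightarrow> (\<And>n. nrm (A (X n)) \<le> C) \<Longrightarrow>
        \<exists>r w. strict_mono (r :: nat \<Rightarrow> nat) \<and> w \<in> H \<and> (\<lambda>n. nrm (X (r n) - w)) \<longlonglongrightarrow> 0"
    and dense: "x \<in> H \<Longrightarrow> 0 < e \<Longrightarrow> \<exists>u\<in>D. nrm (x - u) < e"
    and fredholm: "(\<And>u. u \<in> D \<Longrightarrow> nrm (sc z u - A u) = 0 \<Longrightarrow> nrm u = 0) \<Longrightarrow> f \<in> H \<Longrightarrow>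
        \<exists>u\<in>D. nrm (sc z u - A u - f) = 0"
    and no_imaginary_eigenvalue: "u \<in> D \<Longrightarrow> nrm (sc (\<i> * of_real w) u - A u) = 0 \<Longrightarrow> nrm u = 0"
begin

text \<open>The generator saturated under distance zero. The derivative of an orbit at time zero
  determines its value only up to null vectors, so this relation, and not a function, is what a
  semigroup can see.\<close>

definition graph :: "'v \<Rightarrow> 'v \<Rightarrow> bool" where
  "graph x y \<longleftrightarrow> x \<in> H \<and> y \<in> H \<and> (\<exists>w\<in>D. nrm (x - w) = 0 \<and> nrm (y - A w) = 0)"

lemma graph_mem: "graph x y \<Longrightarrow> x \<in> H" "graph x y \<Longrightarrow> y \<in> H"
  by (auto simp: graph_def)

lemma graph_D: "u \<in> D \<Longrightarrow> graph u (A u)"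
  by (auto simp: graph_def D_mem A_mem nrm_zero intro!: bexI[of _ u])

lemma graph_eqv:
  assumes "graph x y" "x' \<in> H" "y' \<in> H" "nrm (x - x') = 0" "nrm (y - y') = 0"
  shows "graph x' y'"
  using assms unfolding graph_def by (metis A_mem D_mem eqv_sym eqv_trans)

lemma graph_add: assumes "graph x y" "graph x' y'" shows "graph (x + x') (y + y')"
proof -
  obtain w w' where w: "w \<in> D" "nrm (x - w) = 0" "nrm (y - A w) = 0"
    "w' \<in> D" "nrm (x' - w') = 0" "nrm (y' - A w') = 0"
    using assms by (auto simp: graph_def)
  note m = graph_mem[OF assms(1)] graph_mem[OF assms(2)]
  have "graph (w + w') (A (w + w'))" using w by (intro graph_D D_add)
  then show ?thesis
    by (rule graph_eqv)
      (use w m A_add in \<open>auto simp: mem D_mem A_mem D_add intro!: eqv_add eqv_sym[of "x+x'"] eqv_trans[of "A (w + w')" "A w + A w'" "y + y'"] intro: eqv_sym\<close>)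
qed

lemma graph_sc: assumes "graph x y" shows "graph (sc c x) (sc c y)"
proof -
  obtain w where w: "w \<in> D" "nrm (x - w) = 0" "nrm (y - A w) = 0"
    using assms by (auto simp: graph_def)
  note m = graph_mem[OF assms(1)]
  have "graph (sc c w) (A (sc c w))" using w by (intro graph_D D_sc)
  then show ?thesis
    by (rule graph_eqv)
      (use w m A_sc in \<open>auto simp: mem D_mem A_mem D_sc intro!: eqv_sc eqv_trans[of "A (sc c w)" "sc c (A w)" "sc c y"] intro: eqv_sym\<close>)
qed

lemma graph_diff: "graph x y \<Longrightarrow> graph x' y' \<Longrightarrow> graph (x - x') (y - y')"
  using graph_add[of x y "- x'" "- y'"] graph_sc[of x' y' "-1"] by (simp add: sc_minus_one)

lemma graph_dissipative: "graph x y \<Longrightarrow> ip y x \<le> 0"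
  unfolding graph_def using dissipative eqv_ip A_mem D_mem by metis

lemma graph_compact:
  assumes "\<And>n. graph (X n) (Y n)" "\<And>n. nrm (X n) \<le> C" "\<And>n. nrm (Y n) \<le> C"
  shows "\<exists>r w. strict_mono (r :: nat \<Rightarrow> nat) \<and> w \<in> H \<and> (\<lambda>n. nrm (X (r n) - w)) \<longlonglongrightarrow> 0"
proof -
  note m = graph_mem[OF assms(1)]
  have "\<forall>n. \<exists>w. w\<in>D \<and> nrm (X n - w) = 0 \<and> nrm (Y n - A w) = 0"
    using assms(1) unfolding graph_def by blast
  then obtain W where W: "\<And>n. W n \<in> D" "\<And>n. nrm (X n - W n) = 0" "\<And>n. nrm (Y n - A (W n)) = 0"
    by metis
  have "nrm (W n) \<le> C" "nrm (A (W n)) \<le> C" for n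
    using eqv_nrm[of "X n" "W n"] eqv_nrm[of "Y n" "A (W n)"] m W assms(2,3)[of n] by (auto simp: D_mem A_mem)
  with compact_embedding[of W C] W(1) obtain r w where
    r: "strict_mono (r :: nat \<Rightarrow> nat)" "w \<in> H" "(\<lambda>n. nrm (W (r n) - w)) \<longlonglongrightarrow> 0" by blast
  have "nrm (X (r n) - w) = nrm (W (r n) - w)" for n
    using m W r(2) by (intro eqv_left) (auto simp: D_mem)
  then have "(\<lambda>n. nrm (X (r n) - w)) \<longlonglongrightarrow> 0" using r(3) by simp
  with r show ?thesis by blast
qed

text \<open>Pairing x - y with x and dropping the nonpositive term (y, x) leaves the square of the
  norm. In other words the resolvent at 1 does not expand.\<close>

lemma nrm_le_of_dissipative:
  assumes "graph x y" shows "nrm x \<le> nrm (x - y)"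
proof -
  note m = graph_mem[OF assms(1)]
  have "(nrm x)\<^sup>2 \<le> ip (x - y) x"
    using graph_dissipative[OF assms] m by (simp add: nrm_sq ip_simps)
  also have "\<dots> \<le> nrm (x - y) * nrm x" using cauchy_schwarz[of "x - y" x] m by (simp add: mem)
  finally show ?thesis using nrm_nonneg[of x] nrm_nonneg[of "x - y"] m
    by (cases "nrm x = 0") (auto simp: mem power2_eq_square)
qed

lemma graph_fredholm:
  assumes "\<And>u v. graph u v \<Longrightarrow> nrm (sc z u - v) = 0 \<Longrightarrow> nrm u = 0" "f \<in> H"
  shows "\<exists>u v. graph u v \<and> nrm (sc z u - v - f) = 0"
  using fredholm[of z f] assms graph_D by blast

text \<open>First solve u - A u = x - y. Applied to the difference of \<open>X n\<close> and u, the
  non-expansive resolvent forces \<open>X n\<close> to converge to u, so u agrees with x and its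
  image with y, both up to null vectors.\<close>

lemma graph_closed:
  assumes "\<And>n. graph (X n) (Y n)" "x \<in> H" "y \<in> H"
    "(\<lambda>n. nrm (X n - x)) \<longlonglongrightarrow> 0" "(\<lambda>n. nrm (Y n - y)) \<longlonglongrightarrow> 0"
  shows "graph x y"
proof -
  note m = graph_mem[OF assms(1)] assms(2,3)
  have "\<exists>u v. graph u v \<and> nrm (sc 1 u - v - (x - y)) = 0"
  proof (rule graph_fredholm)
    fix u v assume "graph u v" "nrm (sc 1 u - v) = 0"
    then show "nrm u = 0" using nrm_le_of_dissipative[of u v] nrm_nonneg[of u] graph_mem(1)[of u v] by (simp add: sc_one)
  qed (use m in \<open>simp add: mem\<close>)
  then obtain u v where uv: "graph u v" "nrm (u - v - (x - y)) = 0" by (auto simp: sc_one)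
  note m' = graph_mem[OF uv(1)]
  have "nrm (X n - u) \<le> nrm (X n - x) + nrm (Y n - y)" for n
  proof -
    have "nrm (X n - u) \<le> nrm ((X n - u) - (Y n - v))"
      by (intro nrm_le_of_dissipative graph_diff assms uv)
    also have "(X n - u) - (Y n - v) = ((X n - x) - (Y n - y)) - (u - v - (x - y))" by simp
    also have "nrm \<dots> \<le> nrm ((X n - x) - (Y n - y)) + nrm (u - v - (x - y))"
      using m m' by (intro nrm_triangle_diff mem) auto
    also have "\<dots> \<le> nrm (X n - x) + nrm (Y n - y)"
      using nrm_triangle_diff[of "X n - x" "Y n - y"] uv m by (simp add: mem)
    finally show ?thesis .
  qed
  then have "norm (nrm (X n - u)) \<le> nrm (X n - x) + nrm (Y n - y)" for n
    using m m' by (simp add: mem nrm_nonneg)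
  then have "(\<lambda>n. nrm (X n - u)) \<longlonglongrightarrow> 0"
    by (intro Lim_null_comparison[OF always_eventually tendsto_add_zero[OF assms(4,5)]] allI)
  then have ux: "nrm (u - x) = 0"
    using limit_unique[of X u x sequentially] m m' assms(4) by simp
  have "nrm (v - y) = nrm ((u - x) - (u - v - (x - y)))" by (simp add: algebra_simps)
  also have "\<dots> \<le> 0" using nrm_triangle_diff[of "u - x" "u - v - (x - y)"] ux uv m m' by (simp add: mem)
  finally have "nrm (v - y) = 0" using nrm_nonneg[of "v - y"] m m' by (simp add: mem)
  with ux uv m show ?thesis by (intro graph_eqv[OF uv(1)])
qed

text \<open>If the inverse were unbounded, compactness would produce a normalised approximate eigenvector
  that converges, and closedness would make its limit an eigenvector.\<close>

lemma bounded_inverse_imaginary: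
  "\<exists>C. \<forall>x y. graph x y \<longrightarrow> nrm x \<le> C * nrm (sc (\<i> * of_real w) x - y)"
proof (rule ccontr)
  let ?z = "\<i> * complex_of_real w"
  assume neg: "\<not> ?thesis"
  have "\<exists>x y. graph x y \<and> nrm x = 1 \<and> nrm (sc ?z x - y) < 1 / real (Suc n)" for n
  proof -
    obtain x y where xy: "graph x y" "nrm x > real (Suc n) * nrm (sc ?z x - y)"
      using neg by (metis linorder_not_less)
    note m = graph_mem[OF xy(1)]
    have pos: "nrm x > 0" using xy(2) nrm_nonneg[of "sc ?z x - y"] m
      by (smt (verit) mem mult_nonneg_nonneg of_nat_0_le_iff)
    define c where "c = complex_of_real (1 / nrm x)"
    have "sc ?z (sc c x) - sc c y = sc c (sc ?z x - y)"
      by (simp add: sc_diff_right sc_sc mult.commute)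
    then have "nrm (sc ?z (sc c x) - sc c y) = nrm (sc ?z x - y) / nrm x"
      using m pos by (simp add: nrm_sc mem c_def norm_divide)
    also have "\<dots> < 1 / real (Suc n)" using xy(2) pos by (simp add: field_simps)
    finally have "nrm (sc ?z (sc c x) - sc c y) < 1 / real (Suc n)" .
    moreover have "nrm (sc c x) = 1" using m pos by (simp add: nrm_sc c_def norm_divide)
    ultimately show ?thesis using graph_sc[OF xy(1), of c] by blast
  qed
  then obtain X Y where XY: "\<And>n. graph (X n) (Y n)" "\<And>n. nrm (X n) = 1"
    "\<And>n. nrm (sc ?z (X n) - Y n) < 1 / real (Suc n)" by metis
  note m = graph_mem[OF XY(1)]
  have bound: "nrm (Y n) \<le> cmod ?z + 1" for n
  proof -
    have "nrm (Y n) \<le> nrm (sc ?z (X n)) + nrm (sc ?z (X n) - Y n)"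
      using nrm_triangle_diff[of "sc ?z (X n)" "sc ?z (X n) - Y n"] m by (simp add: mem)
    also have "\<dots> \<le> cmod ?z + 1"
      using XY(2,3)[of n] m by (simp add: nrm_sc) (smt (verit) divide_le_eq_1_pos of_nat_0_le_iff)
    finally show ?thesis .
  qed
  obtain r x where r: "strict_mono (r::nat\<Rightarrow>nat)" "x \<in> H" "(\<lambda>n. nrm (X (r n) - x)) \<longlonglongrightarrow> 0"
    using graph_compact[of X Y "cmod ?z + 1"] XY(1,2) bound by auto
  have res: "(\<lambda>n. nrm (sc ?z (X n) - Y n)) \<longlonglongrightarrow> 0"
  proof (rule Lim_null_comparison[OF always_eventually LIMSEQ_inverse_real_of_nat], rule allI)
    fix n
    show "norm (nrm (sc ?z (X n) - Y n)) \<le> inverse (real (Suc n))"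
      using XY(3)[of n] nrm_nonneg[of "sc ?z (X n) - Y n"] m
      by (simp add: mem inverse_eq_divide)
  qed
  \<comment> \<open>\<open>Y\<close> is \<open>sc ?z X\<close> minus a vanishing residual, so it
    converges along with \<open>X\<close>, and \<open>graph_closed\<close> applies to the pair of
    limits.\<close>
  have "(\<lambda>n. nrm (Y (r n) - sc ?z x)) \<longlonglongrightarrow> 0"
  proof (rule Lim_null_comparison[OF always_eventually])
    show "(\<lambda>n. cmod ?z * nrm (X (r n) - x) + nrm (sc ?z (X (r n)) - Y (r n))) \<longlonglongrightarrow> 0"
      using tendsto_add_zero[OF tendsto_mult_right_zero[OF r(3)] LIMSEQ_subseq_LIMSEQ[OF res r(1), unfolded o_def]] .
    show "\<forall>n. norm (nrm (Y (r n) - sc ?z x)) \<le> cmod ?z * nrm (X (r n) - x) + nrm (sc ?z (X (r n)) - Y (r n))"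
    proof
      fix n
      have e: "Y (r n) - sc ?z x = sc ?z (X (r n) - x) - (sc ?z (X (r n)) - Y (r n))"
        by (simp add: sc_diff_right)
      have "nrm (Y (r n) - sc ?z x) \<le> nrm (sc ?z (X (r n) - x)) + nrm (sc ?z (X (r n)) - Y (r n))"
        unfolding e using m r(2) by (intro nrm_triangle_diff mem) auto
      then show "norm (nrm (Y (r n) - sc ?z x)) \<le> cmod ?z * nrm (X (r n) - x) + nrm (sc ?z (X (r n)) - Y (r n))"
        using m r(2) by (simp add: mem nrm_nonneg nrm_sc)
    qed
  qed
  then have g: "graph x (sc ?z x)"
    using graph_closed[of "\<lambda>n. X (r n)" "\<lambda>n. Y (r n)" x] XY(1) r by (auto simp: mem)
  then obtain u where u: "u \<in> D" "nrm (x - u) = 0" "nrm (sc ?z x - A u) = 0" by (auto simp: graph_def)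
  have "nrm (sc ?z u - A u) = 0"
    using eqv_trans[of "sc ?z u" "sc ?z x" "A u"] eqv_sc[of u x ?z] u r(2) by (auto simp: mem D_mem A_mem nrm_diff_sym)
  then have "nrm x = 0" using no_imaginary_eigenvalue[OF u(1)] eqv_nrm[of x u] u r(2) by (simp add: D_mem)
  moreover have "nrm x = 1"
    using limit_nrm[of "\<lambda>n. X (r n)" x sequentially] r XY(2) m by (simp add: LIMSEQ_const_iff)
  ultimately show False by simp
qed

lemma graph_no_imaginary_eigenvalue:
  assumes "graph x y" "nrm (sc (\<i> * of_real w) x - y) = 0" shows "nrm x = 0"
proof -
  obtain C where "nrm x \<le> C * nrm (sc (\<i> * of_real w) x - y)"
    using bounded_inverse_imaginary[of w] assms(1) by blast
  then show ?thesis using assms(2) nrm_nonneg[of x] graph_mem[OF assms(1)] by simp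
qed

lemma graph_surj_imaginary: "f \<in> H \<Longrightarrow> \<exists>u v. graph u v \<and> nrm (sc (\<i> * of_real w) u - v - f) = 0"
  using graph_fredholm graph_no_imaginary_eigenvalue by blast

end

section \<open>Strong stability\<close>

text \<open>The norm of an orbit has a known derivative from the right only, so the mean value
  theorem does not apply. Instead a slightly tilted function is followed up to the last time until
  which it has stayed nonpositive; the right derivative there carries it further.\<close>

lemma right_derivative_nonpos_imp_le:
  fixes f :: "real \<Rightarrow> real"
  assumes "a \<le> b" and cont: "continuous_on {a..b} f"
    and der: "\<And>t. a \<le> t \<Longrightarrow> t < b \<Longrightarrow> \<exists>D\<le>0. ((\<lambda>h. (f (t + h) - f t) / h) \<longlongrightarrow> D) (at_right 0)"
  shows "f b \<le> f a"
proof (rule ccontr)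
  assume neg: "\<not> f b \<le> f a"
  then have "a < b" using assms(1) by (cases "a = b") auto
  \<comment> \<open>Half of the supposed mean slope: after subtracting it the function is still
    positive at b, while its right derivatives are at most -e.\<close>
  define e where "e = (f b - f a) / (2 * (b - a))"
  have "e > 0" using neg \<open>a < b\<close> by (simp add: e_def)
  define g where "g t = f t - f a - e * (t - a)" for t
  have gcont: "continuous_on {a..b} g" unfolding g_def by (intro continuous_intros cont)
  have "e * (b - a) = (f b - f a) / 2" using \<open>a < b\<close> unfolding e_def by (simp add: divide_simps)
  then have gb: "g b > 0" using neg by (simp add: g_def)
  \<comment> \<open>Times up to which \<open>g\<close> has stayed nonpositive throughout. The
    supremum c inherits the sign by continuity, and the derivative at c produces a larger element of
    \<open>S\<close>, unless c = b, which \<open>gb\<close> excludes.\<close>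
  define S where "S = {t \<in> {a..b}. \<forall>s\<in>{a..t}. g s \<le> 0}"
  have aS: "a \<in> S" using \<open>a < b\<close> by (simp add: S_def g_def)
  have bdd: "bdd_above S" by (rule bdd_aboveI[of _ b]) (simp add: S_def)
  define c where "c = Sup S"
  have ub: "t \<le> b" if "t \<in> S" for t using that by (simp add: S_def)
  have c: "a \<le> c" "c \<le> b"
    unfolding c_def by (rule cSup_upper[OF aS bdd], rule cSup_least[OF _ ub]) (use aS in blast)
  have below: "g s \<le> 0" if s: "a \<le> s" "s < c" for s
  proof -
    obtain t where "t \<in> S" "s < t" using s(2) less_cSup_iff[OF _ bdd] aS by (auto simp: c_def)
    then show ?thesis using s by (auto simp: S_def)
  qed
  have gc: "g c \<le> 0"
  proof (cases "a = c")
    case True then show ?thesis by (simp add: g_def)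
  next
    case False
    with c have "a < c" by simp
    have "(g \<longlongrightarrow> g c) (at c within {a..b})"
      using gcont c by (auto simp: continuous_on_def)
    then have "(g \<longlongrightarrow> g c) (at c within {a<..<c})"
      by (rule tendsto_within_subset) (use c in auto)
    moreover have "at c within {a<..<c} \<noteq> bot"
      using \<open>a < c\<close> by (simp add: at_within_eq_bot_iff)
    moreover have "\<forall>\<^sub>F s in at c within {a<..<c}. g s \<le> 0"
      by (rule eventually_at_topological[THEN iffD2]) (use below in \<open>auto intro!: exI[of _ UNIV]\<close>)
    ultimately show ?thesis using tendsto_upperbound by blast
  qed
  then have "c < b" using gb c by (cases "c = b") auto
  obtain D where D: "D \<le> 0" "((\<lambda>h. (f (c + h) - f c) / h) \<longlongrightarrow> D) (at_right 0)"
    using der[OF c(1) \<open>c < b\<close>] by blast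
  have "\<forall>\<^sub>F h in at_right 0. (f (c + h) - f c) / h < e"
    using order_tendstoD(2)[OF D(2), of e] D(1) \<open>e > 0\<close> by simp
  then obtain d where d: "d > 0" "\<And>h. 0 < h \<Longrightarrow> h < d \<Longrightarrow> (f (c + h) - f c) / h < e"
    unfolding eventually_at_right_field by auto
  define h where "h = min (d / 2) (b - c)"
  have h: "0 < h" "h < d" "c + h \<le> b" using d \<open>c < b\<close> by (auto simp: h_def)
  have "g s \<le> 0" if "s \<in> {a..c + h}" for s
  proof (cases "s \<le> c")
    case True
    with that below gc show ?thesis by (cases "s = c") auto
  next
    case False
    with d(2)[of "s - c"] that h have "f s - f c < e * (s - c)" by (simp add: divide_less_eq mult.commute)
    then show ?thesis using gc by (simp add: g_def algebra_simps)
  qed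
  then have "c + h \<in> S" using h c by (auto simp: S_def)
  then have "c + h \<le> c" unfolding c_def by (rule cSup_upper[OF _ bdd])
  with h show False by simp
qed

text \<open>Without a uniform boundedness principle, left continuity of an orbit at one point is extracted
  by a Baire category argument; the semigroup law then propagates it to all later times.\<close>

lemma right_continuous_imp_continuous_somewhere:
  fixes d :: "real \<Rightarrow> real \<Rightarrow> real"
  assumes sym: "\<And>s t. 0 < s \<Longrightarrow> 0 < t \<Longrightarrow> d s t = d t s"
    and tri: "\<And>s t u. 0 < s \<Longrightarrow> 0 < t \<Longrightarrow> 0 < u \<Longrightarrow> d s u \<le> d s t + d t u"
    and right: "\<And>t e. 0 < t \<Longrightarrow> 0 < e \<Longrightarrow> \<exists>r>0. \<forall>h. 0 < h \<and> h < r \<longrightarrow> d (t + h) t < e"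
    and "0 < b"
  shows "\<exists>t. 0 < t \<and> t < b \<and> (\<forall>e>0. \<exists>r>0. \<forall>s. \<bar>s - t\<bar> < r \<longrightarrow> d s t < e)"
proof -
  \<comment> \<open>\<open>Q n t r\<close> says that the oscillation on the interval of radius r
    about t is below 1/(n+1). \<open>V n\<close> collects the positive points admitting such a
    radius; the negative half-line is added so that \<open>V n\<close> can be dense in the whole
    real line, where the category theorem is applied.\<close>
  define Q where "Q n t r \<longleftrightarrow> r > 0 \<and> (\<forall>s s'. \<bar>s - t\<bar> < r \<and> \<bar>s' - t\<bar> < r \<longrightarrow> d s s' < 1 / real (Suc n))" for n t r
  define V where "V n = {..<0} \<union> {t. 0 < t \<and> (\<exists>r. Q n t r)}" for n :: nat
  have op: "open (V n)" for n
  proof -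
    have "\<forall>t\<in>{t. 0 < t \<and> (\<exists>r. Q n t r)}. \<exists>U. open U \<and> t \<in> U \<and> U \<subseteq> {t. 0 < t \<and> (\<exists>r. Q n t r)}"
    proof (rule ballI)
      fix t assume "t \<in> {t. 0 < t \<and> (\<exists>r. Q n t r)}"
      then obtain r where t: "0 < t" "Q n t r" by auto
      have "ball t (min (r/2) t) \<subseteq> {t. 0 < t \<and> (\<exists>r. Q n t r)}"
      proof
        fix u assume u: "u \<in> ball t (min (r/2) t)"
        have "Q n u (r/2)"
          using t(2) u unfolding Q_def
          by (smt (verit) dist_real_def field_sum_of_halves mem_ball min_less_iff_conj)
        then show "u \<in> {t. 0 < t \<and> (\<exists>r. Q n t r)}" using u by (auto simp: dist_real_def)
      qed
      moreover have "t \<in> ball t (min (r/2) t)" using t by (auto simp: Q_def)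
      ultimately show "\<exists>U. open U \<and> t \<in> U \<and> U \<subseteq> {t. 0 < t \<and> (\<exists>r. Q n t r)}"
        using open_ball by blast
    qed
    then have "open {t. 0 < t \<and> (\<exists>r. Q n t r)}" by (subst open_subopen)
    then show ?thesis unfolding V_def by (intro open_Un) auto
  qed
  have dns: "x \<in> closure (V n)" for x n
    unfolding closure_approachable
  proof (intro allI impI)
    fix e :: real assume "0 < e"
    show "\<exists>y\<in>V n. dist y x < e"
    proof (cases "x < 0")
      case True then show ?thesis using \<open>0 < e\<close> by (intro bexI[of _ x]) (auto simp: V_def)
    next
      case False
      define t where "t = x + e/2"
      have "t > 0" using False \<open>e > 0\<close> by (simp add: t_def)
      obtain r where r: "r > 0" "\<And>h. 0 < h \<Longrightarrow> h < r \<Longrightarrow> d (t + h) t < 1 / (2 * real (Suc n))"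
        using right[OF \<open>t > 0\<close>, of "1 / (2 * real (Suc n))"] by auto
      define m where "m = min r (e/2)"
      have m: "0 < m" "m \<le> r" "m \<le> e/2" using r \<open>e > 0\<close> by (auto simp: m_def)
      \<comment> \<open>Density of \<open>V n\<close>: immediately to the right of any t all values
        are close to the value at t, hence close to each other, so the middle of such an interval
        belongs to \<open>V n\<close>.\<close>
      have "d s s' < 1 / real (Suc n)" if "\<bar>s - (t + m/2)\<bar> < m/2" "\<bar>s' - (t + m/2)\<bar> < m/2" for s s'
      proof -
        have *: "0 < s - t" "s - t < r" "0 < s' - t" "s' - t < r" using that m by arith+
        have pos: "0 < s" "0 < s'" using * \<open>t > 0\<close> by auto
        have "d s s' \<le> d s t + d s' t" using tri[of s t s'] sym[of s' t] pos \<open>t > 0\<close> by simp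
        also have "\<dots> < 1 / (2 * real (Suc n)) + 1 / (2 * real (Suc n))"
          using r(2)[of "s - t"] r(2)[of "s' - t"] * by simp
        also have "\<dots> = 1 / real (Suc n)" by (simp add: field_simps)
        finally show ?thesis .
      qed
      then have "Q n (t + m/2) (m/2)" using m by (auto simp: Q_def)
      then have "t + m/2 \<in> V n" using m \<open>t > 0\<close> by (auto simp: V_def)
      moreover have "dist (t + m/2) x < e" using m \<open>e > 0\<close> by (auto simp: dist_real_def t_def)
      ultimately show ?thesis by blast
    qed
  qed
  have "UNIV \<subseteq> closure (\<Inter>(range V))"
  proof (rule Baire)
    fix U assume "U \<in> range V"
    then obtain n where "U = V n" by blast
    with op[of n] dns show "openin (top_of_set UNIV) U \<and> UNIV \<subseteq> closure U"
      by (simp add: open_openin[symmetric] subset_eq)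
  qed auto
  then have "b/2 \<in> closure (\<Inter>(range V))" by blast
  then obtain t where t: "\<And>n. t \<in> V n" "dist t (b/2) < b/2"
    using \<open>0 < b\<close> unfolding closure_approachable by (metis INT_E half_gt_zero UNIV_I)
  have tb: "0 < t" "t < b" using t(2) by (auto simp: dist_real_def abs_if split: if_splits)
  have "\<exists>r>0. \<forall>s. \<bar>s - t\<bar> < r \<longrightarrow> d s t < e" if e: "e > 0" for e
  proof -
    obtain n where n: "1 / real (Suc n) < e" using reals_Archimedean[OF e] by (auto simp: inverse_eq_divide)
    obtain r where "Q n t r" using t(1)[of n] tb by (auto simp: V_def)
    then have "r > 0" "\<And>s. \<bar>s - t\<bar> < r \<Longrightarrow> d s t < 1 / real (Suc n)" by (simp_all add: Q_def)
    then show ?thesis using n by (meson less_trans)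
  qed
  with tb show ?thesis by blast
qed

text \<open>\<open>T_generator\<close> condenses the description of the generator: the difference
  quotient at x tends to y exactly when \<open>graph x y\<close>. The bounds in
  \<open>T_bounded\<close> may depend on t in any manner; they are replaced by 1 in
  \<open>T_contraction\<close>.\<close>

locale generated_semigroup = dissipative_operator H sc ip D A
  for H :: "'v::ab_group_add set" and sc ip D A +
  fixes T :: "real \<Rightarrow> 'v \<Rightarrow> 'v"
  assumes T_mem: "0 \<le> t \<Longrightarrow> x \<in> H \<Longrightarrow> T t x \<in> H"
    and T_linear: "0 \<le> t \<Longrightarrow> x \<in> H \<Longrightarrow> y \<in> H \<Longrightarrow> nrm (T t (sc c x + y) - (sc c (T t x) + T t y)) = 0"
    and T_bounded: "0 \<le> t \<Longrightarrow> \<exists>C. \<forall>x\<in>H. nrm (T t x) \<le> C * nrm x"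
    and T_zero: "x \<in> H \<Longrightarrow> nrm (T 0 x - x) = 0"
    and T_add: "0 \<le> t \<Longrightarrow> 0 \<le> s \<Longrightarrow> x \<in> H \<Longrightarrow> nrm (T (t + s) x - T t (T s x)) = 0"
    and T_cont: "x \<in> H \<Longrightarrow> ((\<lambda>h. nrm (T h x - x)) \<longlongrightarrow> 0) (at_right 0)"
    and T_generator: "x \<in> H \<Longrightarrow> y \<in> H \<Longrightarrow>
      ((\<lambda>h. nrm (sc (of_real (1 / h)) (T h x - x) - y)) \<longlongrightarrow> 0) (at_right 0) \<longleftrightarrow> graph x y"
begin

lemma T_diff: "0 \<le> t \<Longrightarrow> x \<in> H \<Longrightarrow> y \<in> H \<Longrightarrow> nrm (T t (x - y) - (T t x - T t y)) = 0"
  using T_linear[of t y x "-1"] by (simp add: sc_minus_one algebra_simps)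

lemma T_nrm_diff: "0 \<le> t \<Longrightarrow> x \<in> H \<Longrightarrow> y \<in> H \<Longrightarrow> nrm (T t x - T t y) = nrm (T t (x - y))"
  using T_diff[of t x y] eqv_nrm[of "T t (x - y)" "T t x - T t y"] by (simp add: mem T_mem)

lemma T_lipschitz:
  assumes "0 \<le> t"
  obtains C where "0 \<le> C" "\<And>x y. x \<in> H \<Longrightarrow> y \<in> H \<Longrightarrow> nrm (T t x - T t y) \<le> C * nrm (x - y)"
proof -
  obtain C where C: "\<And>x. x \<in> H \<Longrightarrow> nrm (T t x) \<le> C * nrm x" using T_bounded[OF assms] by blast
  show thesis
  proof (rule that[of "\<bar>C\<bar>"])
    fix x y assume "x \<in> H" "y \<in> H"
    then show "nrm (T t x - T t y) \<le> \<bar>C\<bar> * nrm (x - y)"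
      using T_nrm_diff[OF assms, of x y] C[of "x - y"] abs_ge_self[of C] nrm_nonneg[of "x - y"]
      by (smt (verit, ccfv_SIG) mem(5) mult_right_mono)
  qed simp
qed

lemma T_eqv: "0 \<le> t \<Longrightarrow> x \<in> H \<Longrightarrow> y \<in> H \<Longrightarrow> nrm (x - y) = 0 \<Longrightarrow> nrm (T t x - T t y) = 0"
  using T_lipschitz[of t] nrm_nonneg[of "T t x - T t y"] by (metis T_mem antisym diff_mem mult_zero_right)

lemma T_sc: "0 \<le> t \<Longrightarrow> x \<in> H \<Longrightarrow> nrm (T t (sc c x) - sc c (T t x)) = 0"
proof -
  assume a: "0 \<le> t" "x \<in> H"
  have "nrm (T t 0) = 0" using T_nrm_diff[of t 0 0] a by (simp add: mem nrm_zero)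
  have "nrm (T t (sc c x + 0) - (sc c (T t x) + T t 0)) = 0" by (rule T_linear) (use a in \<open>auto simp: mem\<close>)
  moreover have "nrm (sc c (T t x) + T t 0 - sc c (T t x)) = 0" using \<open>nrm (T t 0) = 0\<close> by simp
  ultimately show ?thesis using a eqv_trans[of "T t (sc c x + 0)" "sc c (T t x) + T t 0" "sc c (T t x)"]
    by (simp add: mem T_mem)
qed

lemma T_commute: "0 \<le> t \<Longrightarrow> 0 \<le> s \<Longrightarrow> x \<in> H \<Longrightarrow> nrm (T s (T t x) - T t (T s x)) = 0"
  by (rule eqv_trans[OF _ _ _ eqv_sym[OF _ _ T_add[of s t x]] T_add[of t s x, folded add.commute[of s t]]])
    (auto intro!: T_mem)

text \<open>Up to a null vector the difference quotient at \<open>T t x\<close> is the image under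
  \<open>T t\<close> of the one at x, and the bound for the single operator \<open>T t\<close>
  passes to the limit.\<close>

lemma graph_T:
  assumes "graph x y" "0 \<le> t" shows "graph (T t x) (T t y)"
proof -
  note m = graph_mem[OF assms(1)]
  obtain C where C: "0 \<le> C" "\<And>x y. x \<in> H \<Longrightarrow> y \<in> H \<Longrightarrow> nrm (T t x - T t y) \<le> C * nrm (x - y)"
    using T_lipschitz[OF assms(2)] by blast
  have lim: "((\<lambda>h. nrm (sc (of_real (1 / h)) (T h x - x) - y)) \<longlongrightarrow> 0) (at_right 0)"
    using T_generator[OF m] assms(1) by simp
  have ev: "\<forall>\<^sub>F h in at_right 0. norm (nrm (sc (of_real (1 / h)) (T h (T t x) - T t x) - T t y))
      \<le> C * nrm (sc (of_real (1 / h)) (T h x - x) - y)"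
    unfolding eventually_at_right_field
  proof (intro exI[of _ 1] conjI allI impI)
    fix h :: real assume "0 < h" "h < 1"
    let ?c = "complex_of_real (1 / h)"
    have mm: "T h x \<in> H" "T t x \<in> H" "T h (T t x) \<in> H" "T t (T h x) \<in> H" "T t y \<in> H"
      using m assms(2) \<open>0 < h\<close> by (auto intro!: T_mem)
    have a: "nrm (sc ?c (T h (T t x) - T t x) - sc ?c (T t (T h x) - T t x)) = 0"
      using mm m assms(2) \<open>0 < h\<close> by (auto intro!: eqv_sc eqv_diff T_commute mem simp: nrm_zero)
    have b: "nrm (sc ?c (T t (T h x - x)) - sc ?c (T t (T h x) - T t x)) = 0"
      using mm m assms(2) \<open>0 < h\<close> by (auto intro!: eqv_sc T_diff mem T_mem)
    have c: "nrm (T t (sc ?c (T h x - x)) - sc ?c (T t (T h x - x))) = 0"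
      using mm m assms(2) \<open>0 < h\<close> by (auto intro!: T_sc mem T_mem)
    have d: "nrm (T t (sc ?c (T h x - x)) - sc ?c (T t (T h x) - T t x)) = 0"
      by (rule eqv_trans[OF _ _ _ c b]) (use mm m assms(2) \<open>0 < h\<close> in \<open>auto intro!: mem T_mem\<close>)
    have e: "nrm (sc ?c (T h (T t x) - T t x) - T t (sc ?c (T h x - x))) = 0"
      by (rule eqv_trans[OF _ _ _ a eqv_sym[OF _ _ d]]) (use mm m assms(2) \<open>0 < h\<close> in \<open>auto intro!: mem T_mem\<close>)
    have "nrm (sc ?c (T h (T t x) - T t x) - T t y) = nrm (T t (sc ?c (T h x - x)) - T t y)"
      by (rule eqv_left[OF _ _ _ e]) (use mm m assms(2) \<open>0 < h\<close> in \<open>auto intro!: mem T_mem\<close>)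
    also have "\<dots> \<le> C * nrm (sc ?c (T h x - x) - y)"
      by (rule C(2)) (use mm m in \<open>auto simp: mem\<close>)
    finally show "norm (nrm (sc ?c (T h (T t x) - T t x) - T t y)) \<le> C * nrm (sc ?c (T h x - x) - y)"
      using mm by (simp add: nrm_nonneg mem)
  qed simp
  have "((\<lambda>h. nrm (sc (of_real (1 / h)) (T h (T t x) - T t x) - T t y)) \<longlongrightarrow> 0) (at_right 0)"
    by (rule Lim_null_comparison[OF ev tendsto_mult_right_zero[OF lim]])
  then show ?thesis using T_generator[of "T t x" "T t y"] m assms(2) by (simp add: T_mem)
qed

lemma orbit_right_continuous:
  assumes "x \<in> H" "0 \<le> t" "0 < e"
  shows "\<exists>r>0. \<forall>h. 0 < h \<and> h < r \<longrightarrow> nrm (T (t + h) x - T t x) < e"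
proof -
  obtain C where C: "0 \<le> C" "\<And>x y. x \<in> H \<Longrightarrow> y \<in> H \<Longrightarrow> nrm (T t x - T t y) \<le> C * nrm (x - y)"
    using T_lipschitz[OF assms(2)] by blast
  have "((\<lambda>h. C * nrm (T h x - x)) \<longlongrightarrow> 0) (at_right 0)"
    by (intro tendsto_mult_right_zero T_cont assms)
  then have "\<forall>\<^sub>F h in at_right 0. C * nrm (T h x - x) < e"
    using order_tendstoD(2) assms(3) by blast
  then obtain r where r: "r > 0" "\<And>h. 0 < h \<Longrightarrow> h < r \<Longrightarrow> C * nrm (T h x - x) < e"
    unfolding eventually_at_right_field by auto
  have "nrm (T (t + h) x - T t x) < e" if "0 < h" "h < r" for h
  proof -
    have "nrm (T (t + h) x - T t x) = nrm (T t (T h x) - T t x)"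
      using assms that by (intro eqv_left T_add) (auto simp: T_mem)
    also have "\<dots> \<le> C * nrm (T h x - x)" using assms that by (intro C) (auto simp: T_mem)
    also have "\<dots> < e" using r that by simp
    finally show ?thesis .
  qed
  with r(1) show ?thesis by blast
qed

lemma orbit_continuous:
  assumes "x \<in> H" "0 \<le> t" "0 < e"
  shows "\<exists>r>0. \<forall>s\<ge>0. \<bar>s - t\<bar> < r \<longrightarrow> nrm (T s x - T t x) < e"
proof -
  obtain r1 where r1: "r1 > 0" "\<And>h. 0 < h \<Longrightarrow> h < r1 \<Longrightarrow> nrm (T (t + h) x - T t x) < e"
    using orbit_right_continuous[OF assms] by blast
  have right: "nrm (T s x - T t x) < e" if "t \<le> s" "s < t + r1" for s
    using r1(2)[of "s - t"] that assms by (cases "s = t") (auto simp: nrm_zero)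
  show ?thesis
  proof (cases "t = 0")
    case True
    then show ?thesis using r1(1) right by (intro exI[of _ r1]) auto
  next
    case False
    then have "t > 0" using assms by simp
    have "\<exists>p. 0 < p \<and> p < t \<and> (\<forall>e>0. \<exists>r>0. \<forall>s. \<bar>s - p\<bar> < r \<longrightarrow> nrm (T s x - T p x) < e)"
      by (rule right_continuous_imp_continuous_somewhere)
        (use assms \<open>t > 0\<close> in \<open>auto intro!: nrm_diff_sym nrm_triangle3 T_mem orbit_right_continuous\<close>)
    then obtain p where p: "0 < p" "p < t" "\<And>e. e > 0 \<Longrightarrow> \<exists>r>0. \<forall>s. \<bar>s - p\<bar> < r \<longrightarrow> nrm (T s x - T p x) < e"
      by blast
    obtain C where C: "0 \<le> C" "\<And>x y. x \<in> H \<Longrightarrow> y \<in> H \<Longrightarrow> nrm (T (t - p) x - T (t - p) y) \<le> C * nrm (x - y)"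
      using T_lipschitz[of "t - p"] p by auto
    obtain r2 where r2: "r2 > 0" "\<And>s. \<bar>s - p\<bar> < r2 \<Longrightarrow> nrm (T s x - T p x) < e / (C + 1)"
      using p(3)[of "e / (C + 1)"] assms C by (auto simp: field_simps)
    have left: "nrm (T s x - T t x) < e" if "s < t" "t - s < min r2 p" for s
    proof -
      \<comment> \<open>Moving back by t - p lands near p, where the orbit is continuous from both
        sides; the bound for \<open>T (t - p)\<close> then brings the estimate forward to t.\<close>
      define q where "q = p - (t - s)"
      have q: "0 < q" "\<bar>q - p\<bar> < r2" "s = (t - p) + q" using that by (auto simp: q_def)
      have "nrm (T s x - T t x) = nrm (T (t - p) (T q x) - T t x)"
        unfolding q(3) by (rule eqv_left) (use assms p q in \<open>auto intro!: T_mem T_add\<close>)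
      also have "\<dots> = nrm (T t x - T (t - p) (T q x))"
        by (rule nrm_diff_sym) (use assms p q in \<open>auto intro!: T_mem\<close>)
      also have "\<dots> = nrm (T (t - p) (T p x) - T (t - p) (T q x))"
        using T_add[of "t - p" p x] by (intro eqv_left) (use assms p q in \<open>auto intro!: T_mem\<close>)
      also have "\<dots> \<le> C * nrm (T p x - T q x)"
        by (rule C) (use assms p q in \<open>auto intro!: T_mem\<close>)
      also have "\<dots> = C * nrm (T q x - T p x)"
        using nrm_diff_sym[of "T p x" "T q x"] assms p q by (simp add: T_mem)
      also have "\<dots> \<le> C * (e / (C + 1))"
        using r2(2)[OF q(2)] C(1) by (intro mult_left_mono) auto
      also have "\<dots> < e" using C(1) assms by (simp add: field_simps)
      finally show ?thesis .
    qed
    show ?thesis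
    proof (intro exI[of _ "min r1 (min r2 p)"] conjI allI impI)
      fix s assume "0 \<le> s" "\<bar>s - t\<bar> < min r1 (min r2 p)"
      then show "nrm (T s x - T t x) < e" using left[of s] right[of s] by (cases "s < t") auto
    qed (use r1 r2 p in auto)
  qed
qed

text \<open>The difference of squares is the inner product of T h x - x with T h x + x. Divided by
  h, the first factor tends to y, and the second tends to 2 x.\<close>

lemma norm_derivative:
  assumes "graph x y"
  shows "((\<lambda>h. ((nrm (T h x))\<^sup>2 - (nrm x)\<^sup>2) / h) \<longlongrightarrow> 2 * ip y x) (at_right 0)"
proof -
  note m = graph_mem[OF assms]
  have pos: "\<forall>\<^sub>F h in at_right 0. \<bar>h\<bar> = (h::real)"
    unfolding eventually_at_right_field by (auto intro: exI[of _ 1])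
  have abs: "((\<lambda>h. f \<bar>h\<bar>) \<longlongrightarrow> l) (at_right 0) \<longleftrightarrow> (f \<longlongrightarrow> l) (at_right 0)" for f :: "real \<Rightarrow> real" and l
    by (rule tendsto_cong) (use pos in eventually_elim, simp)
  \<comment> \<open>\<open>limit_ip\<close> asks for membership in \<open>H\<close> at every index,
    while \<open>T\<close> preserves \<open>H\<close> at nonnegative times; the absolute value
    repairs this and is invisible to a limit from the right.\<close>
  have 1: "((\<lambda>h. nrm (sc (of_real (1 / \<bar>h\<bar>)) (T \<bar>h\<bar> x - x) - y)) \<longlongrightarrow> 0) (at_right 0)"
    using T_generator[OF m] assms abs[of "\<lambda>h. nrm (sc (of_real (1 / h)) (T h x - x) - y)"] by simp
  have 2: "((\<lambda>h. nrm (T \<bar>h\<bar> x + x - (x + x))) \<longlongrightarrow> 0) (at_right 0)"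
    using T_cont[OF m(1)] abs[of "\<lambda>h. nrm (T h x - x)"] by simp
  have "((\<lambda>h. ip (sc (of_real (1 / \<bar>h\<bar>)) (T \<bar>h\<bar> x - x)) (T \<bar>h\<bar> x + x)) \<longlongrightarrow> ip y (x + x)) (at_right 0)"
    by (rule limit_ip[OF _ _ 1 _ _ 2]) (use m in \<open>auto intro!: mem T_mem\<close>)
  also have "ip y (x + x) = 2 * ip y x" using m by (simp add: ip_simps)
  finally have lim: "((\<lambda>h. ip (sc (of_real (1 / \<bar>h\<bar>)) (T \<bar>h\<bar> x - x)) (T \<bar>h\<bar> x + x)) \<longlongrightarrow> 2 * ip y x) (at_right 0)" .
  have "ip (sc (of_real (1 / \<bar>h\<bar>)) (T \<bar>h\<bar> x - x)) (T \<bar>h\<bar> x + x) = ((nrm (T \<bar>h\<bar> x))\<^sup>2 - (nrm x)\<^sup>2) / \<bar>h\<bar>" for h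
    using m T_mem[of "\<bar>h\<bar>" x] ip_real_left[of "T \<bar>h\<bar> x - x" "T \<bar>h\<bar> x + x" "1 / \<bar>h\<bar>"]
    by (simp add: mem nrm_sq ip_simps ip_sym[of x "T \<bar>h\<bar> x"])
  with lim show ?thesis using abs[of "\<lambda>h. ((nrm (T h x))\<^sup>2 - (nrm x)\<^sup>2) / h"] by simp
qed

lemma T_contraction_graph:
  assumes "graph x y" "0 \<le> t" shows "nrm (T t x) \<le> nrm x"
proof -
  note m = graph_mem[OF assms(1)]
  have "(nrm (T t x))\<^sup>2 \<le> (nrm (T 0 x))\<^sup>2"
  proof (rule right_derivative_nonpos_imp_le[OF assms(2)])
    have "continuous_on {0..t} (\<lambda>s. nrm (T s x))"
      unfolding continuous_on_iff
    proof (intro ballI allI impI)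
      fix s e :: real assume "s \<in> {0..t}" "0 < e"
      then obtain r where r: "r > 0" "\<And>s'. 0 \<le> s' \<Longrightarrow> \<bar>s' - s\<bar> < r \<Longrightarrow> nrm (T s' x - T s x) < e"
        using orbit_continuous[OF m(1), of s e] by auto
      have "dist (nrm (T s' x)) (nrm (T s x)) < e" if "s' \<in> {0..t}" "dist s' s < r" for s'
        using nrm_lipschitz[of "T s' x" "T s x"] r(2)[of s'] that \<open>s \<in> {0..t}\<close> m
        by (simp add: dist_real_def T_mem)
      with r(1) show "\<exists>d>0. \<forall>s'\<in>{0..t}. dist s' s < d \<longrightarrow> dist (nrm (T s' x)) (nrm (T s x)) < e" by blast
    qed
    then show "continuous_on {0..t} (\<lambda>s. (nrm (T s x))\<^sup>2)" by (intro continuous_intros)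
  next
    fix s :: real assume "0 \<le> s" "s < t"
    have g: "graph (T s x) (T s y)" using assms(1) \<open>0 \<le> s\<close> by (rule graph_T)
    have "((\<lambda>h. ((nrm (T (s + h) x))\<^sup>2 - (nrm (T s x))\<^sup>2) / h) \<longlongrightarrow> 2 * ip (T s y) (T s x)) (at_right 0)"
    proof (rule Lim_transform_eventually[OF norm_derivative[OF g]])
      show "\<forall>\<^sub>F h in at_right 0. ((nrm (T h (T s x)))\<^sup>2 - (nrm (T s x))\<^sup>2) / h = ((nrm (T (s + h) x))\<^sup>2 - (nrm (T s x))\<^sup>2) / h"
        unfolding eventually_at_right_field
      proof (intro exI[of _ 1] conjI allI impI)
        fix h :: real assume "0 < h" "h < 1"
        then have "nrm (T (h + s) x) = nrm (T h (T s x))"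
          using m \<open>0 \<le> s\<close> by (intro eqv_nrm T_add T_mem) auto
        then show "((nrm (T h (T s x)))\<^sup>2 - (nrm (T s x))\<^sup>2) / h = ((nrm (T (s + h) x))\<^sup>2 - (nrm (T s x))\<^sup>2) / h"
          by (simp add: add.commute)
      qed simp
    qed
    with graph_dissipative[OF g]
    show "\<exists>D\<le>0. ((\<lambda>h. ((nrm (T (s + h) x))\<^sup>2 - (nrm (T s x))\<^sup>2) / h) \<longlongrightarrow> D) (at_right 0)"
      by (intro exI[of _ "2 * ip (T s y) (T s x)"]) simp
  qed
  also have "nrm (T 0 x) = nrm x" using T_zero[of x] m by (intro eqv_nrm T_mem) auto
  finally show ?thesis using m nrm_nonneg[of x] by (auto intro: power2_le_imp_le)
qed

text \<open>Approximate x from the domain. The uncontrolled bound C of \<open>T t\<close> multiplies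
  only the approximation error, so it disappears with e.\<close>

lemma T_contraction:
  assumes "x \<in> H" "0 \<le> t" shows "nrm (T t x) \<le> nrm x"
proof (rule field_le_epsilon)
  fix e :: real assume "e > 0"
  obtain C where C: "0 \<le> C" "\<And>x y. x \<in> H \<Longrightarrow> y \<in> H \<Longrightarrow> nrm (T t x - T t y) \<le> C * nrm (x - y)"
    using T_lipschitz[OF assms(2)] by blast
  obtain u where u: "u \<in> D" "nrm (x - u) < e / (C + 1)"
    using dense[OF assms(1), of "e / (C + 1)"] \<open>e > 0\<close> C by auto
  note m = D_mem[OF u(1)] assms(1) T_mem[OF assms(2)]
  have "nrm (T t x) \<le> nrm (T t u) + nrm (T t x - T t u)"
    using nrm_triangle[of "T t u" "T t x - T t u"] m by (simp add: mem)
  also have "\<dots> \<le> nrm u + C * nrm (x - u)"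
    using T_contraction_graph[OF graph_D[OF u(1)] assms(2)] C(2)[of x u] m by simp
  also have "nrm u \<le> nrm x + nrm (x - u)"
    using nrm_triangle_diff[of x "x - u"] m by (simp add: mem)
  finally have "nrm (T t x) \<le> nrm x + (C + 1) * nrm (x - u)" by (simp add: algebra_simps)
  also have "\<dots> \<le> nrm x + e" using u(2) C(1) by (simp add: field_simps)
  finally show "nrm (T t x) \<le> nrm x + e" .
qed

lemma T_antimono:
  assumes "x \<in> H" "0 \<le> s" "s \<le> t" shows "nrm (T t x) \<le> nrm (T s x)"
proof -
  have "nrm (T (t - s + s) x) = nrm (T (t - s) (T s x))"
    using assms by (intro eqv_nrm T_add T_mem) auto
  also have "\<dots> \<le> nrm (T s x)" using assms by (intro T_contraction T_mem) auto
  finally show ?thesis by simp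
qed

end

section \<open>The inverse of the generator, its iterates, and the set on which it is skew\<close>

context generated_semigroup
begin

text \<open>A chosen inverse of the generator, available because zero lies on the imaginary axis.
  Being a choice, it is linear and commutes with the semigroup only up to null vectors.\<close>

definition B :: "'v \<Rightarrow> 'v" where "B f = (SOME u. graph u f)"

lemma B_graph: assumes "f \<in> H" shows "graph (B f) f"
proof -
  obtain u v where uv: "graph u v" "nrm (sc (\<i> * of_real 0) u - v - f) = 0"
    using graph_surj_imaginary[OF assms] by blast
  note m = graph_mem[OF uv(1)]
  have "nrm (- v - f) = 0" using uv(2) by (simp add: sc_zero)
  moreover have "graph (- u) (- v)" using graph_sc[OF uv(1), of "-1"] by (simp add: sc_minus_one)
  ultimately have "graph (- u) f" using m assms by (elim graph_eqv) (auto simp: mem nrm_zero)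
  then show ?thesis unfolding B_def by (rule someI)
qed

lemma B_mem: "f \<in> H \<Longrightarrow> B f \<in> H"
  using B_graph graph_mem by blast

definition K :: real where "K = (SOME K. 0 < K \<and> (\<forall>x y. graph x y \<longrightarrow> nrm x \<le> K * nrm y))"

lemma K: "0 < K" "graph x y \<Longrightarrow> nrm x \<le> K * nrm y"
proof -
  obtain C where C: "\<And>x y. graph x y \<Longrightarrow> nrm x \<le> C * nrm (sc (\<i> * of_real 0) x - y)"
    using bounded_inverse_imaginary[of 0] by blast
  have "nrm x \<le> (\<bar>C\<bar> + 1) * nrm y" if g: "graph x y" for x y
  proof -
    have "nrm x \<le> C * nrm y" using C[OF g] graph_mem[OF g] by (simp add: sc_zero nrm_minus)
    also have "\<dots> \<le> (\<bar>C\<bar> + 1) * nrm y" using nrm_nonneg[OF graph_mem(2)[OF g]] by (intro mult_right_mono) auto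
    finally show ?thesis .
  qed
  then have "0 < \<bar>C\<bar> + 1 \<and> (\<forall>x y. graph x y \<longrightarrow> nrm x \<le> (\<bar>C\<bar> + 1) * nrm y)" by auto
  then have "0 < K \<and> (\<forall>x y. graph x y \<longrightarrow> nrm x \<le> K * nrm y)" unfolding K_def by (rule someI)
  then show "0 < K" "graph x y \<Longrightarrow> nrm x \<le> K * nrm y" by auto
qed

lemma graph_unique:
  assumes "graph x y" "graph x' y'" "nrm (y - y') = 0" shows "nrm (x - x') = 0"
  using K(2)[OF graph_diff[OF assms(1,2)]] assms(3) nrm_nonneg[of "x - x'"]
    graph_mem[OF assms(1)] graph_mem[OF assms(2)] by (simp add: mem)

text \<open>The orbit of a null vector is null by contractivity, and so is its derivative at time
  zero. Thus the generator is single-valued up to null vectors, which is injectivity of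
  \<open>B\<close>.\<close>

lemma graph_injective:
  assumes "graph x y" "nrm x = 0" shows "nrm y = 0"
proof -
  note m = graph_mem[OF assms(1)]
  have "((\<lambda>h. nrm (sc (of_real (1 / h)) (T h x - x) - y)) \<longlongrightarrow> 0) (at_right 0)"
    using T_generator[OF m] assms(1) by simp
  moreover have "\<forall>\<^sub>F h in at_right 0. nrm (sc (of_real (1 / h)) (T h x - x) - y) = nrm y"
    unfolding eventually_at_right_field
  proof (intro exI[of _ 1] conjI allI impI)
    fix h :: real assume "0 < h" "h < 1"
    then have Th: "T h x \<in> H" using m by (intro T_mem) auto
    have "nrm (T h x) = 0" using T_contraction[of x h] assms(2) m \<open>0 < h\<close> nrm_nonneg[OF Th] by simp
    then have "nrm (T h x - x) = 0"
      using nrm_triangle_diff[of "T h x" x] nrm_nonneg[of "T h x - x"] assms(2) Th m by (simp add: mem)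
    then have "nrm (sc (of_real (1 / h)) (T h x - x)) = 0" using Th m by (simp add: nrm_sc mem)
    then show "nrm (sc (of_real (1 / h)) (T h x - x) - y) = nrm y"
      using eqv_left[of "sc (of_real (1 / h)) (T h x - x)" 0 y] Th m by (simp add: mem nrm_minus)
  qed simp
  ultimately have "((\<lambda>h::real. nrm y) \<longlongrightarrow> 0) (at_right 0)"
    by (rule Lim_transform_eventually)
  then show ?thesis by (simp add: tendsto_const_iff)
qed

lemma B_diff: "f \<in> H \<Longrightarrow> g \<in> H \<Longrightarrow> nrm (B f - B g) \<le> K * nrm (f - g)"
  using K(2)[OF graph_diff[OF B_graph B_graph]] .

lemma B_eqv: "f \<in> H \<Longrightarrow> g \<in> H \<Longrightarrow> nrm (f - g) = 0 \<Longrightarrow> nrm (B f - B g) = 0"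
  using B_diff[of f g] nrm_nonneg[of "B f - B g"] by (simp add: mem B_mem)

lemma B_sc: "f \<in> H \<Longrightarrow> nrm (B (sc c f) - sc c (B f)) = 0"
  by (rule graph_unique[OF B_graph graph_sc[OF B_graph]]) (auto simp: mem nrm_zero)

lemma T_B: "f \<in> H \<Longrightarrow> 0 \<le> t \<Longrightarrow> nrm (T t (B f) - B (T t f)) = 0"
  by (rule graph_unique[OF graph_T[OF B_graph] B_graph]) (auto simp: T_mem nrm_zero)

lemma Bk_mem: "f \<in> H \<Longrightarrow> (B ^^ k) f \<in> H"
  by (induction k) (auto simp: B_mem)

lemma Bk_diff: "f \<in> H \<Longrightarrow> g \<in> H \<Longrightarrow> nrm ((B ^^ k) f - (B ^^ k) g) \<le> K ^ k * nrm (f - g)"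
proof (induction k)
  case (Suc k)
  have "nrm (B ((B ^^ k) f) - B ((B ^^ k) g)) \<le> K * nrm ((B ^^ k) f - (B ^^ k) g)"
    using Suc by (intro B_diff Bk_mem)
  also have "\<dots> \<le> K * (K ^ k * nrm (f - g))" using Suc K(1) by (intro mult_left_mono) auto
  finally show ?case by simp
qed simp

lemma T_Bk: "f \<in> H \<Longrightarrow> 0 \<le> t \<Longrightarrow> nrm (T t ((B ^^ k) f) - (B ^^ k) (T t f)) = 0"
proof (induction k)
  case 0 then show ?case by (simp add: nrm_zero)
next
  case (Suc k)
  have "nrm (T t (B ((B ^^ k) f)) - B (T t ((B ^^ k) f))) = 0" using Suc by (intro T_B Bk_mem)
  moreover have "nrm (B (T t ((B ^^ k) f)) - B ((B ^^ k) (T t f))) = 0"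
    using Suc by (intro B_eqv Bk_mem T_mem) auto
  ultimately have "nrm (T t (B ((B ^^ k) f)) - B ((B ^^ k) (T t f))) = 0"
    by (rule eqv_trans[rotated 3]) (use Suc in \<open>auto intro!: T_mem Bk_mem B_mem\<close>)
  then show ?case by simp
qed

lemma Bk_sc: "f \<in> H \<Longrightarrow> nrm ((B ^^ k) (sc c f) - sc c ((B ^^ k) f)) = 0"
proof (induction k)
  case 0 then show ?case by (simp add: nrm_zero)
next
  case (Suc k)
  have "nrm (B ((B ^^ k) (sc c f)) - B (sc c ((B ^^ k) f))) = 0"
    using Suc by (intro B_eqv Bk_mem mem) auto
  moreover have "nrm (B (sc c ((B ^^ k) f)) - sc c (B ((B ^^ k) f))) = 0"
    using Suc by (intro B_sc Bk_mem)
  ultimately have "nrm (B ((B ^^ k) (sc c f)) - sc c (B ((B ^^ k) f))) = 0"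
    by (rule eqv_trans[rotated 3]) (use Suc in \<open>auto intro!: mem Bk_mem B_mem\<close>)
  then show ?case by simp
qed

lemma Bk_limit:
  assumes "\<And>n. X n \<in> H" "x \<in> H" "((\<lambda>n. nrm (X n - x)) \<longlongrightarrow> 0) F"
  shows "((\<lambda>n. nrm ((B ^^ k) (X n) - (B ^^ k) x)) \<longlongrightarrow> 0) F"
proof (rule Lim_null_comparison[OF always_eventually tendsto_mult_right_zero[OF assms(3)]])
  show "\<forall>n. norm (nrm ((B ^^ k) (X n) - (B ^^ k) x)) \<le> K ^ k * nrm (X n - x)"
    using Bk_diff[OF assms(1,2)] nrm_nonneg assms by (simp add: mem Bk_mem)
qed

text \<open>By \<open>norm_derivative\<close> the k-th condition says that the squared norm along
  the orbit of the iterate of order k+1 has derivative zero at time zero. The conditions are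
  quadratic; stability under \<open>B\<close>, scaling and limits is what the maximisation in
  \<open>N_null\<close> relies on.\<close>

definition N :: "'v set" where
  "N = {f \<in> H. \<forall>k. ip ((B ^^ k) f) ((B ^^ Suc k) f) = 0}"

lemma N_mem: "f \<in> N \<Longrightarrow> f \<in> H"
  by (simp add: N_def)

lemma N_B: "f \<in> N \<Longrightarrow> B f \<in> N"
proof -
  assume f: "f \<in> N"
  have "(B ^^ k) (B f) = (B ^^ Suc k) f" for k by (simp add: funpow_swap1)
  with f show ?thesis by (simp add: N_def B_mem del: funpow.simps)
qed

lemma N_sc: assumes "f \<in> N" shows "sc c f \<in> N"
proof -
  note m = N_mem[OF assms]
  have "ip ((B ^^ k) (sc c f)) ((B ^^ Suc k) (sc c f)) = ip (sc c ((B ^^ k) f)) (sc c ((B ^^ Suc k) f))" for k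
    using m by (intro eqv_ip Bk_sc mem Bk_mem)
  also have "\<dots> k = 0" for k
    using assms Bk_mem[OF m, of k] Bk_mem[OF m, of "Suc k"] by (simp add: ip_sc_sc N_def)
  finally show ?thesis using m by (simp add: N_def mem)
qed

lemma N_closed:
  assumes "\<And>n. X n \<in> N" "x \<in> H" "(\<lambda>n. nrm (X n - x)) \<longlonglongrightarrow> 0"
  shows "x \<in> N"
proof -
  note m = N_mem[OF assms(1)]
  have "ip ((B ^^ k) x) ((B ^^ Suc k) x) = 0" for k
  proof -
    have "(\<lambda>n. ip ((B ^^ k) (X n)) ((B ^^ Suc k) (X n))) \<longlonglongrightarrow> ip ((B ^^ k) x) ((B ^^ Suc k) x)"
      by (rule limit_ip[OF _ _ Bk_limit _ _ Bk_limit]) (use m assms in \<open>auto intro!: Bk_mem B_mem\<close>)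
    moreover have "ip ((B ^^ k) (X n)) ((B ^^ Suc k) (X n)) = 0" for n
      using assms(1)[of n] by (simp add: N_def)
    ultimately show ?thesis by (simp add: LIMSEQ_const_iff del: funpow.simps)
  qed
  with assms show ?thesis by (simp add: N_def)
qed

text \<open>The form f -> - (f, B f) is positive semidefinite, so its null vectors are orthogonal, with respect
  to its polarisation, to everything.\<close>

lemma N_skew:
  assumes "f \<in> N" "g \<in> H" shows "ip f (B g) = - ip g (B f)"
proof -
  note m = N_mem[OF assms(1)] assms(2)
  note m' = m B_mem[OF m(1)] B_mem[OF m(2)]
  have f0: "ip f (B f) = 0" using assms(1) by (auto simp: N_def dest: spec[of _ 0])
  \<comment> \<open>The polarised form at f and g. The quadratic in t has constant coefficient 0 by
    \<open>f0\<close>, so its discriminant bound forces b = 0.\<close>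
  define b where "b = - (ip f (B g) + ip g (B f)) / 2"
  have "b\<^sup>2 \<le> 0 * (- ip g (B g))"
  proof (rule quadratic_form_discriminant)
    fix t :: real
    let ?t = "complex_of_real t"
    have e: "nrm (B (f + sc ?t g) - (B f + sc ?t (B g))) = 0"
      by (rule graph_unique[OF B_graph graph_add[OF B_graph graph_sc[OF B_graph]]])
        (use m in \<open>auto intro!: mem simp: nrm_zero\<close>)
    have "ip (f + sc ?t g) (B (f + sc ?t g)) = ip (f + sc ?t g) (B f + sc ?t (B g))"
      by (rule eqv_ip) (use m' e in \<open>auto intro!: mem B_mem simp: nrm_zero\<close>)
    also have "\<dots> = t * (ip f (B g) + ip g (B f)) + t\<^sup>2 * ip g (B g)"
      using m' f0 by (simp add: ip_simps mem power2_eq_square algebra_simps)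
    finally show "0 \<le> 0 + 2 * t * b + t\<^sup>2 * (- ip g (B g))"
      using graph_dissipative[OF B_graph[of "f + sc ?t g"]] m by (simp add: mem b_def algebra_simps)
  next
    show "0 \<le> - ip g (B g)" using graph_dissipative[OF B_graph[of g]] m by simp
  qed
  then show ?thesis by (simp add: b_def)
qed

text \<open>An eigenvalue \<i>c of the inverse is the eigenvalue 1/(\<i>c) = -\<i>/c of the
  generator, again on the imaginary axis.\<close>

lemma B_no_eigenvalue:
  assumes "f \<in> H" "c \<noteq> 0" "nrm (B f - sc (\<i> * of_real c) f) = 0" shows "nrm f = 0"
proof -
  let ?c = "\<i> * complex_of_real c"
  have "graph (sc ?c f) f"
    by (rule graph_eqv[OF B_graph]) (use assms in \<open>auto simp: mem nrm_zero\<close>)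
  from graph_sc[OF this, of "1 / ?c"] assms(2) have "graph f (sc (1 / ?c) f)"
    by (simp add: sc_sc sc_one)
  moreover have "1 / ?c = \<i> * of_real (- 1 / c)"
    using assms(2) by (simp add: field_simps)
  ultimately have "graph f (sc (\<i> * of_real (- 1 / c)) f)" by simp
  then show ?thesis by (rule graph_no_imaginary_eigenvalue[where w="-1/c"]) (simp add: nrm_zero)
qed

text \<open>On N the compact operator B is skew; a maximiser of the norm of B f over the unit ball of N is an
  eigenvector of the square of B and hence yields an imaginary eigenvalue.\<close>

lemma N_null:
  assumes "f0 \<in> N" shows "nrm f0 = 0"
proof (rule ccontr)
  assume "nrm f0 \<noteq> 0"
  then have p0: "nrm f0 > 0" using nrm_nonneg[OF N_mem[OF assms]] by simp
  define S where "S = {nrm (B f) |f. f \<in> N \<and> nrm f \<le> 1}"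
  have ubS: "s \<le> K" if "s \<in> S" for s
  proof -
    from that obtain f where f: "f \<in> N" "nrm f \<le> 1" "s = nrm (B f)" by (auto simp: S_def)
    have "s \<le> K * nrm f" using K(2)[OF B_graph[OF N_mem[OF f(1)]]] f by simp
    also have "\<dots> \<le> K * 1" using f K(1) by (intro mult_left_mono) auto
    finally show ?thesis by simp
  qed
  then have bdd: "bdd_above S" by (rule bdd_aboveI)
  define M where "M = Sup S"
  have le1: "nrm (B f) \<le> M" if "f \<in> N" "nrm f \<le> 1" for f
    unfolding M_def by (rule cSup_upper[OF _ bdd]) (use that in \<open>auto simp: S_def\<close>)
  have le: "nrm (B f) \<le> M * nrm f" if f: "f \<in> N" for f
  proof (cases "nrm f = 0")
    case True then show ?thesis using K(2)[OF B_graph[OF N_mem[OF f]]] by simp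
  next
    case False
    then have pos: "nrm f > 0" using nrm_nonneg[OF N_mem[OF f]] by simp
    let ?c = "complex_of_real (1 / nrm f)"
    have "nrm (B (sc ?c f)) = nrm (sc ?c (B f))"
      using N_mem[OF f] by (intro eqv_nrm B_sc mem B_mem)
    also have "\<dots> = nrm (B f) / nrm f" using pos N_mem[OF f] by (simp add: nrm_sc B_mem norm_divide)
    finally have "nrm (B f) / nrm f \<le> M"
      using le1[OF N_sc[OF f], of ?c] pos N_mem[OF f] by (simp add: nrm_sc norm_divide)
    then show ?thesis using pos by (simp add: field_simps)
  qed
  have "nrm (B f0) \<noteq> 0" using graph_injective[OF B_graph[OF N_mem[OF assms]]] p0 by auto
  then have "nrm (B f0) > 0" using nrm_nonneg[OF B_mem[OF N_mem[OF assms]]] by simp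
  then have "M > 0" using le[OF assms] p0 by (metis less_le_trans zero_less_mult_pos2)
  have Sne: "S \<noteq> {}" using \<open>M > 0\<close> N_sc[OF assms, of 0] N_mem[OF assms]
    by (auto simp: S_def intro!: exI[of _ "sc 0 f0"] simp: nrm_sc)
  have "\<exists>f. f \<in> N \<and> nrm f \<le> 1 \<and> nrm (B f) > M - inverse (real (Suc n))" for n
  proof -
    have "M - inverse (real (Suc n)) < Sup S" by (simp add: M_def)
    then obtain s where "s \<in> S" "s > M - inverse (real (Suc n))" using less_cSup_iff[OF Sne bdd] by blast
    then show ?thesis by (auto simp: S_def)
  qed
  then obtain X where X: "\<And>n. X n \<in> N" "\<And>n. nrm (X n) \<le> 1" "\<And>n. nrm (B (X n)) > M - inverse (real (Suc n))"
    by metis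
  note m = N_mem[OF X(1)]
  note mB = B_mem[OF m]
  note mBB = B_mem[OF mB]
  have limM: "(\<lambda>n. nrm (B (X n))) \<longlonglongrightarrow> M"
  proof (rule tendsto_sandwich[OF always_eventually always_eventually])
    show "(\<lambda>n. M - inverse (real (Suc n))) \<longlonglongrightarrow> M"
      using tendsto_diff[OF tendsto_const LIMSEQ_inverse_real_of_nat, of M] by simp
    show "\<forall>n. M - inverse (real (Suc n)) \<le> nrm (B (X n))" using X(3) less_imp_le by blast
    show "\<forall>n. nrm (B (X n)) \<le> M" using le1 X by blast
  qed auto
  let ?M = "complex_of_real (M\<^sup>2)"
  \<comment> \<open>The residual of the maximising sequence in the equation B B x = - M^2 x.
    Skewness evaluates its mixed term and maximality of M bounds B B x, so its square is at most M^2
    times the defect M^2 - |B x|^2, which tends to zero.\<close>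
  define E where "E n = B (B (X n)) + sc ?M (X n)" for n
  have mE: "E n \<in> H" for n unfolding E_def by (intro mem mBB m)
  have Ebound: "(nrm (E n))\<^sup>2 \<le> M\<^sup>2 * (M\<^sup>2 - (nrm (B (X n)))\<^sup>2)" for n
  proof -
    have skew: "ip (B (B (X n))) (X n) = - (nrm (B (X n)))\<^sup>2"
      using N_skew[OF X(1)[of n] mB[of n]] m mB mBB by (simp add: nrm_sq ip_sym[of "B (B (X n))" "X n"])
    have "(nrm (E n))\<^sup>2 = (nrm (B (B (X n))))\<^sup>2 + 2 * M\<^sup>2 * ip (B (B (X n))) (X n) + M\<^sup>2 * (M\<^sup>2 * (nrm (X n))\<^sup>2)"
      unfolding nrm_sq[OF mE] unfolding E_def using m mBB
      by (simp add: mem ip_simps nrm_sq ip_sym[of "X n" "B (B (X n))"] del: of_real_power)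
        (simp add: algebra_simps power2_eq_square power4_eq_xxxx)
    also have "\<dots> \<le> (M * nrm (B (X n)))\<^sup>2 + 2 * M\<^sup>2 * ip (B (B (X n))) (X n) + M\<^sup>2 * (M\<^sup>2 * 1)"
    proof -
      have "(nrm (B (B (X n))))\<^sup>2 \<le> (M * nrm (B (X n)))\<^sup>2"
        using le[OF N_B[OF X(1)]] nrm_nonneg[OF mBB] by (intro power_mono) auto
      moreover have "(nrm (X n))\<^sup>2 \<le> 1" using X(2)[of n] nrm_nonneg[OF m] by (simp add: power_le_one)
      then have "M\<^sup>2 * (M\<^sup>2 * (nrm (X n))\<^sup>2) \<le> M\<^sup>2 * (M\<^sup>2 * 1)" by (intro mult_left_mono) auto
      ultimately show ?thesis by linarith
    qed
    also have "\<dots> = M\<^sup>2 * (M\<^sup>2 - (nrm (B (X n)))\<^sup>2)"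
      unfolding skew by (simp add: power_mult_distrib algebra_simps)
    finally show ?thesis .
  qed
  have "(\<lambda>n. M\<^sup>2 * (M\<^sup>2 - (nrm (B (X n)))\<^sup>2)) \<longlonglongrightarrow> M\<^sup>2 * (M\<^sup>2 - M\<^sup>2)"
    by (intro tendsto_intros limM)
  then have "(\<lambda>n. (nrm (E n))\<^sup>2) \<longlonglongrightarrow> 0"
    using Lim_null_comparison[OF always_eventually, of "\<lambda>n. (nrm (E n))\<^sup>2" "\<lambda>n. M\<^sup>2 * (M\<^sup>2 - (nrm (B (X n)))\<^sup>2)"]
      Ebound by simp
  from tendsto_real_sqrt[OF this] have limE: "(\<lambda>n. nrm (E n)) \<longlonglongrightarrow> 0"
    using nrm_nonneg[OF mE] by simp
  obtain r g where r: "strict_mono (r::nat\<Rightarrow>nat)" "g \<in> H" "(\<lambda>n. nrm (B (X (r n)) - g)) \<longlonglongrightarrow> 0"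
    using graph_compact[of "\<lambda>n. B (X n)" X "max M 1"] B_graph[OF m] X(2) le1[OF X(1) X(2)]
    by (meson max.coboundedI1 max.coboundedI2)
  \<comment> \<open>Compactness gives convergence of \<open>B (X n)\<close> only. Solving the
    definition of \<open>E\<close> for \<open>X n\<close> shows that \<open>X n\<close> converges
    too, and to this h.\<close>
  define h where "h = sc (- 1 / ?M) (B g)"
  have mg: "B g \<in> H" using B_mem[OF r(2)] .
  have mh: "h \<in> H" unfolding h_def by (intro mem mg)
  have M0: "?M \<noteq> 0" using \<open>M > 0\<close> by simp
  have Xh: "(\<lambda>n. nrm (X (r n) - h)) \<longlonglongrightarrow> 0"
  proof (rule Lim_null_comparison[OF always_eventually])
    show "(\<lambda>n. (nrm (E (r n)) + nrm (B (B (X (r n))) - B g)) / M\<^sup>2) \<longlonglongrightarrow> 0"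
    proof (rule tendsto_divide_zero, rule tendsto_add_zero)
      show "(\<lambda>n. nrm (E (r n))) \<longlonglongrightarrow> 0"
        using LIMSEQ_subseq_LIMSEQ[OF limE r(1)] by (simp add: o_def)
      show "(\<lambda>n. nrm (B (B (X (r n))) - B g)) \<longlonglongrightarrow> 0"
        using Bk_limit[of "\<lambda>n. B (X (r n))" g sequentially 1] mB r by simp
    qed
    show "\<forall>n. norm (nrm (X (r n) - h)) \<le> (nrm (E (r n)) + nrm (B (B (X (r n))) - B g)) / M\<^sup>2"
    proof
      fix n
      have "X (r n) - h = sc (1 / ?M) (E (r n) - (B (B (X (r n))) - B g))"
        using M0 by (simp add: E_def h_def sc_diff_right sc_add_right sc_sc sc_one sc_minus)
      then have "nrm (X (r n) - h) = nrm (E (r n) - (B (B (X (r n))) - B g)) / M\<^sup>2"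
        using mE mBB mg by (simp add: nrm_sc mem norm_divide norm_power del: of_real_power)
      also have "\<dots> \<le> (nrm (E (r n)) + nrm (B (B (X (r n))) - B g)) / M\<^sup>2"
        using mE mBB mg by (intro divide_right_mono nrm_triangle_diff mem) auto
      finally show "norm (nrm (X (r n) - h)) \<le> (nrm (E (r n)) + nrm (B (B (X (r n))) - B g)) / M\<^sup>2"
        using m mh by (simp add: nrm_nonneg mem)
    qed
  qed
  have hN: "h \<in> N" using N_closed[of "\<lambda>n. X (r n)"] X mh Xh by blast
  have lim1: "(\<lambda>n. nrm (B (X (r n)) - B h)) \<longlonglongrightarrow> 0"
    using Bk_limit[of "\<lambda>n. X (r n)" h sequentially 1] m mh Xh by simp
  have Bhg: "nrm (B h - g) = 0"
    by (rule limit_unique[OF _ _ _ lim1 r(3)]) (use mB B_mem[OF mh] r in auto)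
  have "(\<lambda>n. nrm (B (X (r n)))) \<longlonglongrightarrow> nrm (B h)"
    by (rule limit_nrm[OF _ _ lim1]) (use mB B_mem[OF mh] in auto)
  then have nBh: "nrm (B h) = M"
    using LIMSEQ_unique LIMSEQ_subseq_LIMSEQ[OF limM r(1)] by (force simp: o_def)
  have mBh: "B h \<in> H" "B (B h) \<in> H" using B_mem[OF mh] B_mem[OF B_mem[OF mh]] by auto
  have BBh: "nrm (B (B h) - sc (- ?M) h) = 0"
  proof -
    have "sc (- ?M) h = B g" using M0 by (simp add: h_def sc_sc sc_one)
    then show ?thesis using B_eqv[OF mBh(1) r(2) Bhg] by simp
  qed
  let ?iM = "\<i> * complex_of_real M"
  \<comment> \<open>B B + M^2 factors as (B - \<i>M)(B + \<i>M). The first factor annihilates z, so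
    z is null; then the second annihilates h, so h is null, although \<open>nrm (B h)\<close> equals
    M > 0.\<close>
  define z where "z = B h + sc ?iM h"
  have mz: "z \<in> H" unfolding z_def by (intro mem mBh mh)
  have "nrm (B z - sc ?iM z) = 0"
  proof -
    have e1: "nrm (B z - (B (B h) + sc ?iM (B h))) = 0"
      unfolding z_def by (rule graph_unique[OF B_graph graph_add[OF B_graph graph_sc[OF B_graph]]])
        (use mh mBh in \<open>auto intro!: mem simp: nrm_zero\<close>)
    have e2: "nrm ((B (B h) + sc ?iM (B h)) - (sc (- ?M) h + sc ?iM (B h))) = 0"
      by (rule eqv_add[OF _ _ _ _ BBh]) (use mh mBh in \<open>auto intro!: mem simp: nrm_zero\<close>)
    have e3: "sc ?iM z = sc (- ?M) h + sc ?iM (B h)"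
      by (simp add: z_def sc_add_right sc_sc power2_eq_square algebra_simps)
    show ?thesis unfolding e3
      by (rule eqv_trans[OF _ _ _ e1 e2]) (use mh mBh mz in \<open>auto intro!: mem B_mem\<close>)
  qed
  then have "nrm z = 0" using B_no_eigenvalue[OF mz, of M] \<open>M > 0\<close> by simp
  then have "nrm (B h - sc (\<i> * of_real (- M)) h) = 0" by (simp add: z_def sc_minus)
  then have "nrm h = 0" using B_no_eigenvalue[OF mh, of "- M"] \<open>M > 0\<close> by simp
  then have "nrm (B h) = 0" using le[OF hN] nrm_nonneg[OF mBh(1)] by simp
  with nBh \<open>M > 0\<close> show False by simp
qed

section \<open>Omega-limit points and decay of orbits\<close>

lemma T_limit:
  assumes "\<And>n. X n \<in> H" "x \<in> H" "(\<lambda>n. nrm (X n - x)) \<longlonglongrightarrow> 0" "0 \<le> t"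
  shows "(\<lambda>n. nrm (T t (X n) - T t x)) \<longlonglongrightarrow> 0"
proof (rule Lim_null_comparison[OF always_eventually assms(3)])
  show "\<forall>n. norm (nrm (T t (X n) - T t x)) \<le> nrm (X n - x)"
    using T_nrm_diff[OF assms(4) assms(1,2)] T_contraction[of "X n - x" t for n] nrm_nonneg assms
    by (auto simp: mem T_mem)
qed

text \<open>The norm is nonincreasing along orbits, so integer times decide.\<close>

lemma stable_of_sequence:
  assumes "x \<in> H" "(\<lambda>n. nrm (T (real n) x)) \<longlonglongrightarrow> 0"
  shows "((\<lambda>t. nrm (T t x)) \<longlongrightarrow> 0) at_top"
proof (rule tendstoI)
  fix e :: real assume "e > 0"
  from LIMSEQ_D[OF assms(2) this] obtain n where n: "norm (nrm (T (real n) x) - 0) < e" by blast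
  show "\<forall>\<^sub>F t in at_top. dist (nrm (T t x)) 0 < e"
  proof (rule eventually_at_top_linorderI)
    fix t assume "real n \<le> t"
    then have "nrm (T t x) \<le> nrm (T (real n) x)" "0 \<le> nrm (T t x)"
      using assms by (auto intro!: T_antimono nrm_nonneg T_mem)
    with n show "dist (nrm (T t x)) 0 < e" by simp
  qed
qed

lemma stable_range_B:
  assumes "v \<in> H" shows "((\<lambda>t. nrm (T t (B v))) \<longlongrightarrow> 0) at_top"
proof (rule stable_of_sequence[OF B_mem[OF assms]])
  define u where "u = B v"
  have u: "u \<in> H" unfolding u_def by (rule B_mem[OF assms])
  have g: "graph (T (real n) u) (T (real n) v)" for n
    unfolding u_def by (intro graph_T B_graph assms) simp
  have "nrm (T (real n) u) \<le> max (nrm u) (nrm v)" "nrm (T (real n) v) \<le> max (nrm u) (nrm v)" for n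
    using T_contraction[OF u, of n] T_contraction[OF assms, of n] by auto
  with graph_compact[of "\<lambda>n. T (real n) u" "\<lambda>n. T (real n) v", OF g] obtain r w where
    r: "strict_mono (r::nat\<Rightarrow>nat)" "w \<in> H" "(\<lambda>n. nrm (T (real (r n)) u - w)) \<longlonglongrightarrow> 0"
    by blast
  \<comment> \<open>Monotonicity makes the whole sequence of norms converge; the subsequence
    identifies its limit as the norm of \<open>(B ^^ k) w\<close>. A time shift by s does not change
    the limit, which gives the second half.\<close>
  have conv: "(\<lambda>n. nrm (T (real n) ((B ^^ k) u))) \<longlonglongrightarrow> nrm ((B ^^ k) w) \<and>
      (\<forall>s\<ge>0. nrm (T s ((B ^^ k) w)) = nrm ((B ^^ k) w))" for k
  proof -
    define x where "x = (B ^^ k) u"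
    define y where "y = (B ^^ k) w"
    have m: "x \<in> H" "y \<in> H" unfolding x_def y_def using u r by (auto intro: Bk_mem)
    have mT: "T (real n) x \<in> H" for n using m by (intro T_mem) auto
    have "nrm (T (real n) x - y) = nrm ((B ^^ k) (T (real n) u) - y)" for n
      using u m mT unfolding x_def by (intro eqv_left T_Bk) (auto intro!: Bk_mem T_mem)
    then have lim: "(\<lambda>n. nrm (T (real (r n)) x - y)) \<longlonglongrightarrow> 0"
      using Bk_limit[of "\<lambda>n. T (real (r n)) u" w sequentially k] u r unfolding y_def by (simp add: T_mem)
    have "decseq (\<lambda>n. nrm (T (real n) x))"
      unfolding decseq_def using m by (auto intro!: T_antimono)
    then obtain l where l: "(\<lambda>n. nrm (T (real n) x)) \<longlonglongrightarrow> l"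
      using decseq_convergent[of _ 0] nrm_nonneg[OF mT] by metis
    have "(\<lambda>n. nrm (T (real (r n)) x)) \<longlonglongrightarrow> nrm y"
      by (rule limit_nrm[OF _ m(2) lim]) (use mT in auto)
    then have ly: "l = nrm y" using LIMSEQ_unique LIMSEQ_subseq_LIMSEQ[OF l r(1)] by (force simp: o_def)
    have "nrm (T s y) = nrm y" if s: "s \<ge> 0" for s
    proof -
      have "(\<lambda>n. nrm (T s (T (real (r n)) x))) \<longlonglongrightarrow> nrm (T s y)"
        by (rule limit_nrm[OF _ _ T_limit[OF _ m(2) lim s]]) (use mT m s in \<open>auto intro!: T_mem\<close>)
      moreover have "(\<lambda>n. nrm (T s (T (real (r n)) x))) \<longlonglongrightarrow> l"
      proof (rule tendsto_sandwich[OF always_eventually always_eventually])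
        \<comment> \<open>s need not be an integer: the norms at time s + r n lie between those at
          the integer times r n + ceiling s and r n.\<close>
        show "(\<lambda>n. nrm (T (real (r n + nat \<lceil>s\<rceil>)) x)) \<longlonglongrightarrow> l"
          using LIMSEQ_subseq_LIMSEQ[OF LIMSEQ_ignore_initial_segment[OF l, of "nat \<lceil>s\<rceil>"] r(1)]
          by (simp add: o_def)
        show "(\<lambda>n. nrm (T (real (r n)) x)) \<longlonglongrightarrow> l"
          using LIMSEQ_subseq_LIMSEQ[OF l r(1)] by (simp add: o_def)
        show "\<forall>n. nrm (T s (T (real (r n)) x)) \<le> nrm (T (real (r n)) x)"
          using T_contraction[OF mT s] by blast
        show "\<forall>n. nrm (T (real (r n + nat \<lceil>s\<rceil>)) x) \<le> nrm (T s (T (real (r n)) x))"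
        proof
          fix n
          have "nrm (T (real (r n + nat \<lceil>s\<rceil>)) x) \<le> nrm (T (s + real (r n)) x)"
            using m s by (intro T_antimono) (auto simp: of_nat_nat)
          also have "\<dots> = nrm (T s (T (real (r n)) x))"
            using m s mT by (intro eqv_nrm T_add T_mem) auto
          finally show "nrm (T (real (r n + nat \<lceil>s\<rceil>)) x) \<le> nrm (T s (T (real (r n)) x))" .
        qed
      qed
      ultimately show ?thesis using LIMSEQ_unique ly by blast
    qed
    with l ly show ?thesis unfolding x_def y_def by simp
  qed
  have "w \<in> N"
  proof -
    have "ip ((B ^^ k) w) ((B ^^ Suc k) w) = 0" for k
    proof -
      let ?x = "(B ^^ Suc k) w"
      have gx: "graph ?x ((B ^^ k) w)" using B_graph[OF Bk_mem[OF r(2), of k]] by simp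
      \<comment> \<open>The orbit of the iterate of order k+1 has constant norm, so the derivative
        from \<open>norm_derivative\<close> is zero; this is exactly the k-th condition of
        \<open>N\<close>.\<close>
      have "((\<lambda>h::real. 0::real) \<longlongrightarrow> 2 * ip ((B ^^ k) w) ?x) (at_right 0)"
      proof (rule Lim_transform_eventually[OF norm_derivative[OF gx]])
        show "\<forall>\<^sub>F h in at_right 0. ((nrm (T h ?x))\<^sup>2 - (nrm ?x)\<^sup>2) / h = 0"
          unfolding eventually_at_right_field using conv[of "Suc k"] by (intro exI[of _ 1]) simp
      qed
      then show ?thesis by (simp add: tendsto_const_iff del: funpow.simps)
    qed
    with r show ?thesis by (simp add: N_def)
  qed
  then show "(\<lambda>n. nrm (T (real n) (B v))) \<longlonglongrightarrow> 0"
    using conv[of 0] N_null by (simp add: u_def)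
qed

theorem strongly_stable:
  assumes "x \<in> H" shows "((\<lambda>t. nrm (T t x)) \<longlongrightarrow> 0) at_top"
proof (rule tendstoI)
  fix e :: real assume "e > 0"
  obtain u where u: "u \<in> D" "nrm (x - u) < e / 2" using dense[OF assms, of "e/2"] \<open>e > 0\<close> by auto
  note m = D_mem[OF u(1)] A_mem[OF u(1)] assms
  have uB: "nrm (u - B (A u)) = 0"
    by (rule graph_unique[OF graph_D[OF u(1)] B_graph]) (use m in \<open>auto simp: nrm_zero\<close>)
  have "\<forall>\<^sub>F t in at_top. nrm (T t (B (A u))) < e / 2"
    using order_tendstoD(2)[OF stable_range_B[OF m(2)], of "e/2"] \<open>e > 0\<close> by simp
  with eventually_ge_at_top[of 0] show "\<forall>\<^sub>F t in at_top. dist (nrm (T t x)) 0 < e"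
  proof eventually_elim
    case (elim t)
    have "nrm (T t x) \<le> nrm (T t u) + nrm (T t x - T t u)"
      using nrm_triangle[of "T t u" "T t x - T t u"] m elim by (simp add: mem T_mem)
    moreover have "nrm (T t u) = nrm (T t (B (A u)))"
      using m elim by (intro eqv_nrm T_eqv T_mem B_mem uB) auto
    moreover have "nrm (T t x - T t u) \<le> nrm (x - u)"
      using T_nrm_diff[of t x u] T_contraction[of "x - u" t] m elim by (simp add: mem)
    ultimately show ?case using u(2) elim nrm_nonneg[of "T t x"] m by (simp add: T_mem)
  qed
qed

end

section \<open>Square integrable functions on an interval\<close>

text \<open>A bridge between two languages: gauge integrals ignore negligible sets, whereas
  \<open>AE\<close> statements combine well under \<open>eventually_elim\<close>.\<close>

lemma AE_lebesgue_on_iff_negligible: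
  fixes S :: "real set"
  assumes "S \<in> sets lebesgue"
  shows "(AE x in lebesgue_on S. P x) \<longleftrightarrow> (\<exists>N. negligible N \<and> (\<forall>x\<in>S - N. P x))"
proof
  assume "AE x in lebesgue_on S. P x"
  then obtain N where N: "N \<in> null_sets (lebesgue_on S)" "{x \<in> space (lebesgue_on S). \<not> P x} \<subseteq> N"
    by (auto simp: eventually_ae_filter)
  then show "\<exists>N. negligible N \<and> (\<forall>x\<in>S - N. P x)"
    using assms by (intro exI[of _ N]) (auto simp: null_sets_restrict_space negligible_iff_null_sets)
next
  assume "\<exists>N. negligible N \<and> (\<forall>x\<in>S - N. P x)"
  then obtain N where N: "negligible N" "\<forall>x\<in>S - N. P x" by blast
  then have "N \<inter> S \<in> null_sets (lebesgue_on S)"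
    using assms by (simp add: null_sets_restrict_space negligible_iff_null_sets[symmetric] negligible_Int)
  with N show "AE x in lebesgue_on S. P x" by (intro AE_I') auto
qed

lemma interval_lebesgue: "{a..b::real} \<in> sets lebesgue" by simp

lemmas AE_negligible = AE_lebesgue_on_iff_negligible[OF interval_lebesgue]

lemma integral_cong_AE_interval:
  fixes f g :: "real \<Rightarrow> 'a::banach"
  assumes "AE x in lebesgue_on {a..b}. f x = g x" "{c..d} \<subseteq> {a..b}"
  shows "integral {c..d} f = integral {c..d} g"
proof -
  obtain N where "negligible N" "\<forall>x\<in>{a..b} - N. f x = g x" using assms(1) unfolding AE_negligible by blast
  then show ?thesis using assms(2) by (intro integral_spike[of N]) auto
qed

text \<open>A negligible set contains no nonempty open set, so its complement is dense in the
  interval, and equality of continuous functions passes to the closure. The hypothesis is localised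
  to [a, c] for use on the damped part of the beam.\<close>

lemma AE_interval_continuous_eq:
  fixes f g :: "real \<Rightarrow> 'a::real_normed_vector"
  assumes "AE x in lebesgue_on {0..b}. a \<le> x \<longrightarrow> x \<le> c \<longrightarrow> f x = g x"
    and f: "continuous_on {a..c} f" and g: "continuous_on {a..c} g"
    and "0 \<le> a" "a < c" "c \<le> b" and x: "x \<in> {a..c}"
  shows "f x = g x"
proof -
  obtain N where N: "negligible N" "\<forall>x\<in>{0..b} - N. a \<le> x \<longrightarrow> x \<le> c \<longrightarrow> f x = g x"
    using assms(1) unfolding AE_negligible by blast
  have "continuous_on {a..c} (\<lambda>x. f x - g x)" by (intro continuous_intros f g)
  then have cl: "closedin (top_of_set {a..c}) {x \<in> {a..c}. f x - g x = 0}"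
    by (rule continuous_closedin_preimage_constant)
  have "{a<..<c} \<subseteq> closure ({a<..<c} - N)"
  proof
    fix y assume y: "y \<in> {a<..<c}"
    show "y \<in> closure ({a<..<c} - N)"
    proof (rule ccontr)
      assume "y \<notin> closure ({a<..<c} - N)"
      then obtain e where e: "e > 0" "\<And>z. z \<in> {a<..<c} - N \<Longrightarrow> e \<le> dist z y"
        unfolding closure_approachable by (metis linorder_not_less)
      have "open (ball y e \<inter> {a<..<c})" by auto
      moreover have "y \<in> ball y e \<inter> {a<..<c}" using y e(1) by auto
      moreover have "ball y e \<inter> {a<..<c} \<subseteq> N" using e(2) by (auto simp: dist_commute) (meson DiffI greaterThanLessThan_iff linorder_not_less)
      then have "negligible (ball y e \<inter> {a<..<c})" using N(1) negligible_subset by blast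
      ultimately show False using open_not_negligible by blast
    qed
  qed
  then have "{a..c} \<subseteq> closure ({a<..<c} - N)"
    using closure_minimal[of "{a<..<c}" "closure ({a<..<c} - N)"] \<open>a < c\<close> by simp
  moreover have "{a<..<c} - N \<subseteq> {x \<in> {a..c}. f x - g x = 0}" using N(2) assms(4-6) by auto
  moreover have "closed {x \<in> {a..c}. f x - g x = 0}" using cl closedin_closed_trans by blast
  ultimately have "{a..c} \<subseteq> {x \<in> {a..c}. f x - g x = 0}" by (meson closure_minimal order_trans)
  with x show ?thesis by auto
qed

lemma L2_measurable: "L2 L f \<Longrightarrow> f \<in> borel_measurable (lebesgue_on {0..L})"
  by (simp add: L2_def measurable_on_iff_borel_measurable)

lemma L2I:
  assumes "f \<in> borel_measurable (lebesgue_on {0..L})" "g integrable_on {0..L}"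
    "\<And>x. x \<in> {0..L} \<Longrightarrow> (cmod (f x))\<^sup>2 \<le> g x"
  shows "L2 L f"
proof -
  have "(\<lambda>x. (cmod (f x))\<^sup>2) \<in> borel_measurable (lebesgue_on {0..L})" using assms(1) by measurable
  then have "(\<lambda>x. (cmod (f x))\<^sup>2) absolutely_integrable_on {0..L}"
    by (rule measurable_bounded_by_integrable_imp_absolutely_integrable[OF _ _ assms(2)]) (use assms(3) in auto)
  then show ?thesis using assms(1) by (simp add: L2_def measurable_on_iff_borel_measurable absolutely_integrable_on_def)
qed

lemma L2_sq: "L2 L f \<Longrightarrow> (\<lambda>x. (cmod (f x))\<^sup>2) integrable_on {0..L}"
  by (simp add: L2_def)

lemma L2_continuous: "continuous_on {0..L} f \<Longrightarrow> L2 L f"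
  by (rule L2I[where g="\<lambda>x. (cmod (f x))\<^sup>2"])
    (auto intro!: continuous_imp_measurable_on_sets_lebesgue integrable_continuous_real continuous_intros)

lemma L2_mult_bounded:
  assumes "L2 L f" "b \<in> borel_measurable (lebesgue_on {0..L})" "\<And>x. x \<in> {0..L} \<Longrightarrow> cmod (b x) \<le> C"
  shows "L2 L (\<lambda>x. b x * f x)"
proof (rule L2I)
  show "(\<lambda>x. b x * f x) \<in> borel_measurable (lebesgue_on {0..L})"
    using L2_measurable[OF assms(1)] assms(2) by measurable
  show "(\<lambda>x. C\<^sup>2 * (cmod (f x))\<^sup>2) integrable_on {0..L}"
    using integrable_on_cmult_left[OF L2_sq[OF assms(1)], of "C\<^sup>2"] by simp
  fix x assume "x \<in> {0..L}"
  then show "(cmod (b x * f x))\<^sup>2 \<le> C\<^sup>2 * (cmod (f x))\<^sup>2"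
    using assms(3)[of x] by (auto simp: norm_mult power_mult_distrib intro!: mult_right_mono power_mono)
qed

lemma L2_cmult: "L2 L f \<Longrightarrow> L2 L (\<lambda>x. c * f x)"
  by (rule L2_mult_bounded) auto

lemma L2_add: assumes "L2 L f" "L2 L g" shows "L2 L (\<lambda>x. f x + g x)"
proof (rule L2I)
  show "(\<lambda>x. f x + g x) \<in> borel_measurable (lebesgue_on {0..L})"
    using L2_measurable[OF assms(1)] L2_measurable[OF assms(2)] by measurable
  show "(\<lambda>x. 2 * (cmod (f x))\<^sup>2 + 2 * (cmod (g x))\<^sup>2) integrable_on {0..L}"
    using integrable_add[OF integrable_on_cmult_left[OF L2_sq[OF assms(1)], of 2] integrable_on_cmult_left[OF L2_sq[OF assms(2)], of 2]]
    by simp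
  fix x
  have "(cmod (f x + g x))\<^sup>2 \<le> (cmod (f x) + cmod (g x))\<^sup>2" by (intro power_mono norm_triangle_ineq) auto
  also have "\<dots> \<le> 2 * (cmod (f x))\<^sup>2 + 2 * (cmod (g x))\<^sup>2"
    using sum_squares_bound[of "cmod (f x)" "cmod (g x)"] by (simp add: power2_sum)
  finally show "(cmod (f x + g x))\<^sup>2 \<le> 2 * (cmod (f x))\<^sup>2 + 2 * (cmod (g x))\<^sup>2" .
qed

lemma L2_diff: "L2 L f \<Longrightarrow> L2 L g \<Longrightarrow> L2 L (\<lambda>x. f x - g x)"
  using L2_add[OF _ L2_cmult[of L g "-1"]] by simp

lemma L2_minus: "L2 L f \<Longrightarrow> L2 L (\<lambda>x. - f x)"
  using L2_cmult[of L f "-1"] by simp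

lemma L2_divide: "L2 L f \<Longrightarrow> L2 L (\<lambda>x. f x / c)"
  using L2_cmult[of L f "inverse c"] by (simp add: field_simps)

lemma L2_cnj: assumes "L2 L f" shows "L2 L (\<lambda>x. cnj (f x))"
proof (rule L2I[OF _ L2_sq[OF assms]])
  have "cnj \<in> borel_measurable borel" by (intro borel_measurable_continuous_onI continuous_intros)
  with L2_measurable[OF assms] show "(\<lambda>x. cnj (f x)) \<in> borel_measurable (lebesgue_on {0..L})"
    by measurable
qed simp

lemma L2_cong_AE:
  assumes "L2 L f" "AE x in lebesgue_on {0..L}. f x = g x" shows "L2 L g"
proof -
  obtain N where N: "negligible N" "\<forall>x\<in>{0..L} - N. f x = g x" using assms(2) unfolding AE_negligible by blast
  have "g measurable_on {0..L}"
    using assms(1) N by (auto simp: L2_def intro: measurable_on_spike)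
  moreover have "(\<lambda>x. (cmod (g x))\<^sup>2) integrable_on {0..L}"
    by (rule integrable_spike[OF L2_sq[OF assms(1)] N(1)]) (use N in auto)
  ultimately show ?thesis by (simp add: L2_def)
qed

lemmas L2_intros = L2_add L2_diff L2_minus L2_cmult L2_divide L2_cnj

lemma L2_prod_integrable: assumes "L2 L f" "L2 L g" shows "(\<lambda>x. f x * g x) absolutely_integrable_on {0..L}"
proof (rule measurable_bounded_by_integrable_imp_absolutely_integrable)
  show "(\<lambda>x. f x * g x) \<in> borel_measurable (lebesgue_on {0..L})"
    using L2_measurable[OF assms(1)] L2_measurable[OF assms(2)] by measurable
  show "(\<lambda>x. (cmod (f x))\<^sup>2 + (cmod (g x))\<^sup>2) integrable_on {0..L}"
    by (intro integrable_add L2_sq assms)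
  show "norm (f x * g x) \<le> (cmod (f x))\<^sup>2 + (cmod (g x))\<^sup>2" for x
    using sum_squares_bound[of "cmod (f x)" "cmod (g x)"] mult_nonneg_nonneg[OF norm_ge_zero norm_ge_zero, of "f x" "g x"]
    unfolding norm_mult by linarith
qed simp

lemma L2_abs_integrable: assumes "L2 L f" shows "f absolutely_integrable_on {0..L}"
  using L2_prod_integrable[OF assms L2_continuous[of L "\<lambda>_. 1"]] by simp

lemma L2_integrable: "L2 L f \<Longrightarrow> 0 \<le> a \<Longrightarrow> b \<le> L \<Longrightarrow> f integrable_on {a..b}"
  using L2_abs_integrable[of L f] integrable_on_subinterval[of f "{0..L}" a b]
  by (auto simp: absolutely_integrable_on_def)

lemma L2_norm_integrable: "L2 L f \<Longrightarrow> 0 \<le> a \<Longrightarrow> b \<le> L \<Longrightarrow> (\<lambda>x. cmod (f x)) integrable_on {a..b}"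
  using L2_abs_integrable[of L f] integrable_on_subinterval[of "\<lambda>x. cmod (f x)" "{0..L}" a b]
  by (auto simp: absolutely_integrable_on_def)

lemma L2_sq_integrable: "L2 L f \<Longrightarrow> 0 \<le> a \<Longrightarrow> b \<le> L \<Longrightarrow> (\<lambda>x. (cmod (f x))\<^sup>2) integrable_on {a..b}"
  using L2_sq[of L f] integrable_on_subinterval[of "\<lambda>x. (cmod (f x))\<^sup>2" "{0..L}" a b] by auto

text \<open>Only the real part of the product in L2, matching the real form of
  \<open>seminorm_space\<close>.\<close>

definition l2ip :: "real \<Rightarrow> (real \<Rightarrow> complex) \<Rightarrow> (real \<Rightarrow> complex) \<Rightarrow> real" where
  "l2ip L f g = integral {0..L} (\<lambda>x. Re (f x * cnj (g x)))"

lemma l2ip_integrable: "L2 L f \<Longrightarrow> L2 L g \<Longrightarrow> (\<lambda>x. Re (f x * cnj (g x))) integrable_on {0..L}"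
  using L2_prod_integrable[OF _ L2_cnj, of L f g] integrable_linear[OF _ bounded_linear_Re, of "\<lambda>x. f x * cnj (g x)" "{0..L}"]
  by (simp add: absolutely_integrable_on_def o_def)

lemma l2ip_self: "l2ip L f f = integral {0..L} (\<lambda>x. (cmod (f x))\<^sup>2)"
proof -
  have "Re (z * cnj z) = (cmod z)\<^sup>2" for z by (simp add: cmod_power2) (simp add: power2_eq_square)
  then show ?thesis by (simp add: l2ip_def)
qed

lemma l2ip_nonneg: "L2 L f \<Longrightarrow> 0 \<le> l2ip L f f"
  unfolding l2ip_self by (intro integral_nonneg L2_sq) auto

lemma l2ip_sym: "l2ip L f g = l2ip L g f"
  unfolding l2ip_def by (intro arg_cong[where f="integral {0..L}"] ext) (simp add: algebra_simps)

lemma l2ip_cong_AE: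
  assumes "AE x in lebesgue_on {0..L}. f x = f' x" "AE x in lebesgue_on {0..L}. g x = g' x"
  shows "l2ip L f g = l2ip L f' g'"
  unfolding l2ip_def by (rule integral_cong_AE_interval[where a=0 and b=L]) (use assms in \<open>auto elim: eventually_elim2\<close>)

lemma l2ip_add_left: "L2 L f \<Longrightarrow> L2 L g \<Longrightarrow> L2 L h \<Longrightarrow> l2ip L (\<lambda>x. f x + g x) h = l2ip L f h + l2ip L g h"
  using integral_add[OF l2ip_integrable[of L f h] l2ip_integrable[of L g h]]
  by (simp add: l2ip_def algebra_simps)

lemma l2ip_scale_left: "l2ip L (\<lambda>x. of_real r * f x) h = r * l2ip L f h"
proof -
  have "(\<lambda>x. Re (of_real r * f x * cnj (h x))) = (\<lambda>x. r * Re (f x * cnj (h x)))"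
    by (auto simp: algebra_simps)
  then show ?thesis unfolding l2ip_def by (simp only: integral_mult_right)
qed

lemma l2ip_i: "l2ip L (\<lambda>x. \<i> * f x) (\<lambda>x. \<i> * g x) = l2ip L f g"
  unfolding l2ip_def by (intro arg_cong[where f="integral {0..L}"] ext) (simp add: algebra_simps)

lemma l2ip_diff_left: "L2 L f \<Longrightarrow> L2 L g \<Longrightarrow> L2 L h \<Longrightarrow> l2ip L (\<lambda>x. f x - g x) h = l2ip L f h - l2ip L g h"
  using l2ip_add_left[of L f "\<lambda>x. - g x" h] l2ip_scale_left[of L "-1" g h] by (simp add: L2_intros)

lemma l2ip_add_right: "L2 L f \<Longrightarrow> L2 L g \<Longrightarrow> L2 L h \<Longrightarrow> l2ip L h (\<lambda>x. f x + g x) = l2ip L h f + l2ip L h g"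
  by (simp add: l2ip_sym[of L h] l2ip_add_left)

lemma l2ip_diff_right: "L2 L f \<Longrightarrow> L2 L g \<Longrightarrow> L2 L h \<Longrightarrow> l2ip L h (\<lambda>x. f x - g x) = l2ip L h f - l2ip L h g"
  by (simp add: l2ip_sym[of L h] l2ip_diff_left)

lemma l2ip_scale_right: "l2ip L h (\<lambda>x. of_real r * f x) = r * l2ip L h f"
  by (simp add: l2ip_sym[of L h] l2ip_scale_left)

lemma l2ip_eq_0:
  assumes "L2 L f" "l2ip L f f = 0" shows "AE x in lebesgue_on {0..L}. f x = 0"
proof -
  have "(\<lambda>x. (cmod (f x))\<^sup>2) absolutely_integrable_on {0..L}"
    by (rule nonnegative_absolutely_integrable_1[OF L2_sq[OF assms(1)]]) auto
  then have int: "integrable (lebesgue_on {0..L}) (\<lambda>x. (cmod (f x))\<^sup>2)"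
    by (simp add: absolutely_integrable_measurable o_def)
  have "integral\<^sup>L (lebesgue_on {0..L}) (\<lambda>x. (cmod (f x))\<^sup>2) = 0"
    using lebesgue_integral_eq_integral[OF int] assms(2) by (simp add: l2ip_self)
  then show ?thesis using integral_nonneg_eq_0_iff_AE[OF int] by simp
qed

text \<open>Cauchy-Schwarz for |g| against the constant 1. The factor b - a is what turns a bound on
  a weak derivative into continuity.\<close>

lemma L2_cauchy_schwarz:
  assumes "L2 L g" "0 \<le> a" "a \<le> b" "b \<le> L"
  shows "(integral {a..b} (\<lambda>x. cmod (g x)))\<^sup>2 \<le> (b - a) * integral {a..b} (\<lambda>x. (cmod (g x))\<^sup>2)"
proof -
  note i = L2_norm_integrable[OF assms(1,2,4)] L2_sq_integrable[OF assms(1,2,4)]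
  have "(integral {a..b} (\<lambda>x. cmod (g x)))\<^sup>2 \<le> integral {a..b} (\<lambda>x. (cmod (g x))\<^sup>2) * (b - a)"
  proof (rule quadratic_form_discriminant)
    fix t :: real
    have "0 \<le> integral {a..b} (\<lambda>x. (cmod (g x))\<^sup>2 + 2 * t * cmod (g x) + t\<^sup>2)"
    proof (rule integral_nonneg)
      show "(\<lambda>x. (cmod (g x))\<^sup>2 + 2 * t * cmod (g x) + t\<^sup>2) integrable_on {a..b}"
        using i integrable_on_cmult_left[OF i(1), of "2 * t"] by (intro integrable_add) auto
      show "0 \<le> (cmod (g x))\<^sup>2 + 2 * t * cmod (g x) + t\<^sup>2" for x
        using zero_le_power2[of "cmod (g x) + t"] by (simp add: power2_sum algebra_simps)
    qed
    also have "\<dots> = integral {a..b} (\<lambda>x. (cmod (g x))\<^sup>2) + integral {a..b} (\<lambda>x. 2 * t * cmod (g x)) + integral {a..b} (\<lambda>x. t\<^sup>2)"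
      using i integrable_on_cmult_left[OF i(1), of "2 * t"] by (subst integral_add) (auto simp: integral_add intro!: integrable_add)
    also have "\<dots> = integral {a..b} (\<lambda>x. (cmod (g x))\<^sup>2) + 2 * t * integral {a..b} (\<lambda>x. cmod (g x)) + t\<^sup>2 * (b - a)"
      using assms(3) by simp
    finally show "0 \<le> integral {a..b} (\<lambda>x. (cmod (g x))\<^sup>2) + 2 * t * integral {a..b} (\<lambda>x. cmod (g x)) + t\<^sup>2 * (b - a)" .
  qed (use assms in simp)
  then show ?thesis by (simp add: mult.commute)
qed

section \<open>Weak derivatives\<close>

lemma wderiv_L2: "has_wderiv L u g \<Longrightarrow> L2 L g"
  by (simp add: has_wderiv_def)

lemma wderiv_eq: "has_wderiv L u g \<Longrightarrow> x \<in> {0..L} \<Longrightarrow> u x = u 0 + integral {0..x} g"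
  unfolding has_wderiv_def by blast

lemma wderivI: "L2 L g \<Longrightarrow> (\<And>x. 0 \<le> x \<Longrightarrow> x \<le> L \<Longrightarrow> u x = u 0 + integral {0..x} g) \<Longrightarrow> has_wderiv L u g"
  unfolding has_wderiv_def atLeastAtMost_iff Ball_def by blast

lemma wderiv_diff_eq:
  assumes "has_wderiv L u g" "0 \<le> x" "x \<le> y" "y \<le> L"
  shows "u y - u x = integral {x..y} g"
proof -
  have "integral {0..x} g + integral {x..y} g = integral {0..y} g"
    using assms L2_integrable[OF wderiv_L2[OF assms(1)], of 0 y] by (intro Henstock_Kurzweil_Integration.integral_combine) auto
  then show ?thesis using wderiv_eq[OF assms(1), of x] wderiv_eq[OF assms(1), of y] assms
    by (metis add_diff_cancel_left add_diff_cancel_left' atLeastAtMost_iff order_trans)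
qed

lemma wderiv_continuous: assumes "has_wderiv L u g" shows "continuous_on {0..L} u"
proof -
  have "continuous_on {0..L} (\<lambda>x. u 0 + integral {0..x} g)"
  proof (cases "0 \<le> L")
    case True
    then show ?thesis
      by (intro continuous_intros indefinite_integral_continuous_1 L2_integrable[OF wderiv_L2[OF assms]]) auto
  qed simp
  then show ?thesis by (rule continuous_on_eq) (simp only: wderiv_eq[OF assms, symmetric])
qed

lemma wderiv_dist_le:
  assumes "has_wderiv L u g" "0 \<le> x" "x \<le> y" "y \<le> L"
  shows "cmod (u y - u x) \<le> integral {x..y} (\<lambda>s. cmod (g s))"
  unfolding wderiv_diff_eq[OF assms] using L2_integrable[OF wderiv_L2[OF assms(1)] assms(2,4)]
    L2_norm_integrable[OF wderiv_L2[OF assms(1)] assms(2,4)] by (intro integral_norm_bound_integral) auto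

text \<open>Continuity with exponent one half, with a constant depending only on the derivative in
  L2: the source of equicontinuity in the compactness proof.\<close>

lemma wderiv_holder:
  assumes "has_wderiv L u g" "x \<in> {0..L}" "y \<in> {0..L}"
  shows "(cmod (u y - u x))\<^sup>2 \<le> \<bar>y - x\<bar> * l2ip L g g"
proof -
  have *: "(cmod (u y - u x))\<^sup>2 \<le> (y - x) * l2ip L g g" if xy: "0 \<le> x" "x \<le> y" "y \<le> L" for x y
  proof -
    note g = wderiv_L2[OF assms(1)]
    have "(cmod (u y - u x))\<^sup>2 \<le> (integral {x..y} (\<lambda>s. cmod (g s)))\<^sup>2"
      by (intro power_mono wderiv_dist_le[OF assms(1)] xy) auto
    also have "\<dots> \<le> (y - x) * integral {x..y} (\<lambda>x. (cmod (g x))\<^sup>2)"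
      by (rule L2_cauchy_schwarz[OF g xy])
    also have "\<dots> \<le> (y - x) * integral {0..L} (\<lambda>x. (cmod (g x))\<^sup>2)"
      using xy by (intro mult_left_mono integral_subset_le L2_sq_integrable[OF g]) auto
    finally show ?thesis by (simp add: l2ip_self)
  qed
  show ?thesis
    using *[of x y] *[of y x] assms(2,3) by (cases "x \<le> y") (auto simp: norm_minus_commute)
qed

lemma wderiv_add:
  assumes u: "has_wderiv L u g" and v: "has_wderiv L v h"
  shows "has_wderiv L (\<lambda>x. u x + v x) (\<lambda>x. g x + h x)"
proof (rule wderivI)
  show "L2 L (\<lambda>x. g x + h x)" by (intro L2_intros wderiv_L2[OF u] wderiv_L2[OF v])
  fix x assume x: "0 \<le> x" "x \<le> L"
  have "integral {0..x} (\<lambda>x. g x + h x) = integral {0..x} g + integral {0..x} h"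
    by (intro integral_add L2_integrable[of L] wderiv_L2[OF u] wderiv_L2[OF v] x) auto
  then show "u x + v x = u 0 + v 0 + integral {0..x} (\<lambda>x. g x + h x)"
    using wderiv_eq[OF u, of x] wderiv_eq[OF v, of x] x by (metis ab_semigroup_add_class.add_ac(1) add.left_commute atLeastAtMost_iff)
qed

lemma wderiv_cmult:
  assumes u: "has_wderiv L u g" shows "has_wderiv L (\<lambda>x. c * u x) (\<lambda>x. c * g x)"
proof (rule wderivI)
  show "L2 L (\<lambda>x. c * g x)" by (intro L2_intros wderiv_L2[OF u])
  fix x assume x: "0 \<le> x" "x \<le> L"
  then show "c * u x = c * u 0 + integral {0..x} (\<lambda>x. c * g x)"
    using wderiv_eq[OF u, of x] by (metis atLeastAtMost_iff distrib_left integral_mult_right)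
qed

lemma wderiv_cnj:
  assumes u: "has_wderiv L u g" shows "has_wderiv L (\<lambda>x. cnj (u x)) (\<lambda>x. cnj (g x))"
proof (rule wderivI)
  show "L2 L (\<lambda>x. cnj (g x))" by (intro L2_intros wderiv_L2[OF u])
  fix x assume x: "0 \<le> x" "x \<le> L"
  then show "cnj (u x) = cnj (u 0) + integral {0..x} (\<lambda>x. cnj (g x))"
    using wderiv_eq[OF u, of x] by (metis atLeastAtMost_iff complex_cnj_add integral_cnj)
qed

lemma wderiv_diff: "has_wderiv L u g \<Longrightarrow> has_wderiv L v h \<Longrightarrow> has_wderiv L (\<lambda>x. u x - v x) (\<lambda>x. g x - h x)"
  using wderiv_add[OF _ wderiv_cmult[of L v h "-1"]] by simp

lemma wderiv_cong_AE:
  assumes "has_wderiv L u g" "\<And>x. x \<in> {0..L} \<Longrightarrow> u x = v x" "AE x in lebesgue_on {0..L}. g x = h x" "0 \<le> L"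
  shows "has_wderiv L v h"
  unfolding has_wderiv_def
proof (intro conjI ballI)
  show "L2 L h" using L2_cong_AE[OF wderiv_L2[OF assms(1)] assms(3)] .
  fix x assume x: "x \<in> {0..L}"
  have "integral {0..x} g = integral {0..x} h" using x by (intro integral_cong_AE_interval[OF assms(3)]) auto
  moreover have "u x = u 0 + integral {0..x} g" by (rule wderiv_eq[OF assms(1) x])
  ultimately show "v x = v 0 + integral {0..x} h" using assms(2)[OF x] assms(2)[of 0] assms(4) by simp
qed

lemma wderiv_C1:
  assumes "\<And>x. x \<in> {0..L} \<Longrightarrow> (u has_vector_derivative g x) (at x within {0..L})" "continuous_on {0..L} g"
  shows "has_wderiv L u g"
  unfolding has_wderiv_def
proof (intro conjI ballI)
  fix x assume x: "x \<in> {0..L}"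
  have "(g has_integral (u x - u 0)) {0..x}"
    using x by (intro fundamental_theorem_of_calculus) (auto intro: has_vector_derivative_within_subset[OF assms(1)])
  then show "u x = u 0 + integral {0..x} g" by (simp add: integral_unique)
qed (rule L2_continuous[OF assms(2)])

text \<open>The bound is the length of the interval times an increment of a continuous function,
  hence o(|y - x|). So F is differentiable with derivative zero at every point, and the classical
  theorem applies.\<close>

lemma constant_of_superlinear_modulus:
  fixes F :: "real \<Rightarrow> complex" and G :: "real \<Rightarrow> real"
  assumes G: "continuous_on {0..L} G"
    and FG: "\<And>x y. 0 \<le> x \<Longrightarrow> x \<le> y \<Longrightarrow> y \<le> L \<Longrightarrow> cmod (F y - F x) \<le> (y - x) * (G y - G x)"
    and xy: "x \<in> {0..L}" "y \<in> {0..L}"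
  shows "F x = F y"
proof -
  have "\<exists>c. \<forall>x\<in>{0..L}. F x = c"
  proof (rule has_derivative_zero_constant)
    fix x assume x: "x \<in> {0..L}"
    show "(F has_derivative (\<lambda>h. 0)) (at x within {0..L})"
      unfolding has_derivative_within_alt
    proof (intro conjI allI impI bounded_linear_zero)
      fix e :: real assume "0 < e"
      then obtain d where d: "d > 0" "\<And>y. y \<in> {0..L} \<Longrightarrow> dist y x < d \<Longrightarrow> dist (G y) (G x) < e"
        using G x unfolding continuous_on_iff by metis
      have "norm (F y - F x - 0) \<le> e * norm (y - x)" if y: "y \<in> {0..L}" "norm (y - x) < d" for y
      proof -
        have "cmod (F y - F x) \<le> \<bar>y - x\<bar> * \<bar>G y - G x\<bar>"
        proof (cases "x \<le> y")
          case True
          have "cmod (F y - F x) \<le> (y - x) * (G y - G x)" using FG[of x y] x y True by simp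
          also have "\<dots> \<le> \<bar>y - x\<bar> * \<bar>G y - G x\<bar>" using True by (simp add: mult_left_mono)
          finally show ?thesis .
        next
          case False
          have "cmod (F y - F x) \<le> (x - y) * (G x - G y)"
            using FG[of y x] x y False by (simp add: norm_minus_commute)
          also have "\<dots> \<le> \<bar>y - x\<bar> * \<bar>G y - G x\<bar>" using False by (simp add: mult_left_mono)
          finally show ?thesis .
        qed
        also have "\<dots> \<le> \<bar>y - x\<bar> * e" using d(2)[of y] y by (intro mult_left_mono) (auto simp: dist_real_def)
        finally show ?thesis by (simp add: mult.commute)
      qed
      with d(1) show "\<exists>d>0. \<forall>y\<in>{0..L}. norm (y - x) < d \<longrightarrow> norm (F y - F x - 0) \<le> e * norm (y - x)" by blast
    qed
  qed simp
  with xy show ?thesis by auto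
qed

text \<open>The product rule is proved by showing that the defect has modulus of continuity o(h): by
  Cauchy-Schwarz it is bounded by the interval length times the increment of a continuous function.\<close>

lemma wderiv_product:
  assumes u: "has_wderiv L u p" and w: "has_wderiv L w q" and "0 \<le> L"
  shows "integral {0..L} (\<lambda>x. p x * w x + u x * q x) = u L * w L - u 0 * w 0"
proof -
  note p = wderiv_L2[OF u] and q = wderiv_L2[OF w]
  note cu = wderiv_continuous[OF u] and cw = wderiv_continuous[OF w]
  define f where "f x = p x * w x + u x * q x" for x
  have fint: "f integrable_on {a..b}" if "0 \<le> a" "b \<le> L" for a b
    unfolding f_def using that
      integrable_on_subinterval[of "\<lambda>x. p x * w x" "{0..L}" a b] integrable_on_subinterval[of "\<lambda>x. u x * q x" "{0..L}" a b]
      L2_prod_integrable[OF p L2_continuous[OF cw]] L2_prod_integrable[OF L2_continuous[OF cu] q]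
    by (intro integrable_add) (auto simp: absolutely_integrable_on_def)
  \<comment> \<open>F is the defect in the product rule. G dominates it: its increments bound the
    integrals of |p|^2 and |q|^2 over a subinterval, and it is continuous.\<close>
  define F where "F x = u x * w x - integral {0..x} f" for x
  define G where "G x = integral {0..x} (\<lambda>s. (cmod (p s))\<^sup>2 + (cmod (q s))\<^sup>2)" for x
  have sqint: "(\<lambda>s. (cmod (p s))\<^sup>2 + (cmod (q s))\<^sup>2) integrable_on {a..b}" if "0 \<le> a" "b \<le> L" for a b
    using that by (intro integrable_add L2_sq_integrable[OF p] L2_sq_integrable[OF q])
  have "F 0 = F L"
  proof (rule constant_of_superlinear_modulus[where L=L and G=G])
    show "continuous_on {0..L} G" unfolding G_def by (intro indefinite_integral_continuous_1 sqint) auto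
    fix x y assume xy: "0 \<le> x" "x \<le> y" "y \<le> L"
    define a where "a = integral {x..y} (\<lambda>s. cmod (p s))"
    define b where "b = integral {x..y} (\<lambda>s. cmod (q s))"
    have pint: "(\<lambda>s. p s * w y) integrable_on {x..y}" and qint: "(\<lambda>s. u x * q s) integrable_on {x..y}"
      using L2_integrable[OF p, of x y] L2_integrable[OF q, of x y] xy
      by (auto intro: integrable_on_mult_left integrable_on_mult_right)
    have "integral {0..x} f + integral {x..y} f = integral {0..y} f"
      using xy by (intro Henstock_Kurzweil_Integration.integral_combine fint) auto
    \<comment> \<open>With w frozen at y and u frozen at x the increment is exactly an integral.
      Against f the error is p (w y - w s) + (u x - u s) q, whose integral is at most 2 a b.\<close>
    then have "F y - F x = (u y - u x) * w y + u x * (w y - w x) - integral {x..y} f"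
      by (simp add: F_def algebra_simps)
    also have "\<dots> = integral {x..y} (\<lambda>s. p s * w y + u x * q s) - integral {x..y} f"
      using wderiv_diff_eq[OF u xy] wderiv_diff_eq[OF w xy] pint qint by (simp add: integral_add)
    also have "\<dots> = integral {x..y} (\<lambda>s. (p s * w y + u x * q s) - f s)"
      using pint qint fint[of x y] xy by (intro integral_diff[symmetric] integrable_add) auto
    finally have eq: "F y - F x = integral {x..y} (\<lambda>s. (p s * w y + u x * q s) - f s)" .
    have bint: "(\<lambda>s. cmod (p s) * b + a * cmod (q s)) integrable_on {x..y}"
      using L2_norm_integrable[OF p, of x y] L2_norm_integrable[OF q, of x y] xy
      by (auto intro!: integrable_add integrable_on_mult_left integrable_on_mult_right)
    have "cmod (F y - F x) \<le> integral {x..y} (\<lambda>s. cmod (p s) * b + a * cmod (q s))"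
      unfolding eq
    proof (rule integral_norm_bound_integral[OF _ bint])
      show "(\<lambda>s. (p s * w y + u x * q s) - f s) integrable_on {x..y}"
        using pint qint fint[of x y] xy by (intro integrable_diff integrable_add) auto
      fix s assume s: "s \<in> {x..y}"
      have "cmod (w y - w s) \<le> integral {s..y} (\<lambda>s. cmod (q s))"
        using s xy by (intro wderiv_dist_le[OF w]) auto
      also have "\<dots> \<le> b" unfolding b_def
        using s xy by (intro integral_subset_le L2_norm_integrable[OF q]) auto
      finally have 1: "cmod (w y - w s) \<le> b" .
      have "cmod (u s - u x) \<le> integral {x..s} (\<lambda>s. cmod (p s))"
        using s xy by (intro wderiv_dist_le[OF u]) auto
      also have "\<dots> \<le> a" unfolding a_def
        using s xy by (intro integral_subset_le L2_norm_integrable[OF p]) auto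
      finally have 2: "cmod (u x - u s) \<le> a" by (simp add: norm_minus_commute)
      have "(p s * w y + u x * q s) - f s = p s * (w y - w s) + (u x - u s) * q s"
        by (simp add: f_def algebra_simps)
      then show "norm ((p s * w y + u x * q s) - f s) \<le> cmod (p s) * b + a * cmod (q s)"
        using norm_triangle_ineq[of "p s * (w y - w s)" "(u x - u s) * q s"]
          mult_left_mono[OF 1, of "cmod (p s)"] mult_right_mono[OF 2, of "cmod (q s)"]
        by (simp add: norm_mult)
    qed
    also have "\<dots> = 2 * a * b"
      using L2_norm_integrable[OF p, of x y] L2_norm_integrable[OF q, of x y] xy
      by (subst integral_add) (auto simp: a_def b_def intro!: integrable_on_mult_left integrable_on_mult_right)
    also have "\<dots> \<le> a\<^sup>2 + b\<^sup>2" by (rule sum_squares_bound)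
    also have "\<dots> \<le> (y - x) * integral {x..y} (\<lambda>s. (cmod (p s))\<^sup>2) + (y - x) * integral {x..y} (\<lambda>s. (cmod (q s))\<^sup>2)"
      unfolding a_def b_def by (intro add_mono L2_cauchy_schwarz[OF p xy] L2_cauchy_schwarz[OF q xy])
    also have "\<dots> = (y - x) * integral {x..y} (\<lambda>s. (cmod (p s))\<^sup>2 + (cmod (q s))\<^sup>2)"
      using L2_sq_integrable[OF p, of x y] L2_sq_integrable[OF q, of x y] xy by (simp add: integral_add algebra_simps)
    also have "integral {x..y} (\<lambda>s. (cmod (p s))\<^sup>2 + (cmod (q s))\<^sup>2) = G y - G x"
      using Henstock_Kurzweil_Integration.integral_combine[of 0 x y "\<lambda>s. (cmod (p s))\<^sup>2 + (cmod (q s))\<^sup>2"] sqint[of 0 y] xy by (simp add: G_def)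
    finally show "cmod (F y - F x) \<le> (y - x) * (G y - G x)" .
  qed (use assms in auto)
  moreover have "f = (\<lambda>x. p x * w x + u x * q x)" by (simp add: fun_eq_iff f_def)
  ultimately show ?thesis by (simp add: F_def)
qed

lemma l2ip_parts:
  assumes u: "has_wderiv L u p" and w: "has_wderiv L w q" and "0 \<le> L"
  shows "l2ip L p w + l2ip L u q = Re (u L * cnj (w L)) - Re (u 0 * cnj (w 0))"
proof -
  note p = wderiv_L2[OF u] and q = wderiv_L2[OF w]
  note cu = L2_continuous[OF wderiv_continuous[OF u]] and cw = L2_continuous[OF wderiv_continuous[OF w]]
  have i: "(\<lambda>x. p x * cnj (w x)) integrable_on {0..L}" "(\<lambda>x. u x * cnj (q x)) integrable_on {0..L}"
    using L2_prod_integrable[OF p L2_cnj[OF cw]] L2_prod_integrable[OF cu L2_cnj[OF q]]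
    by (auto simp: absolutely_integrable_on_def)
  have "l2ip L p w + l2ip L u q = Re (integral {0..L} (\<lambda>x. p x * cnj (w x) + u x * cnj (q x)))"
    using integral_linear[OF i(1) bounded_linear_Re] integral_linear[OF i(2) bounded_linear_Re]
    by (simp add: l2ip_def o_def integral_add[OF i])
  then show ?thesis using wderiv_product[OF u wderiv_cnj[OF w] assms(3)] by simp
qed

section \<open>Density and uniqueness of weak derivatives\<close>

text \<open>The radial retraction onto the disc of radius M. Truncating first makes all later
  approximants bounded, so that constants can serve as dominating functions.\<close>

definition clip :: "real \<Rightarrow> complex \<Rightarrow> complex" where
  "clip M z = of_real (M / max M (cmod z)) * z"

lemma clip_le: assumes "M > 0" shows "cmod (clip M z) \<le> M" "cmod (z - clip M z) \<le> cmod z"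
proof -
  have pos: "0 < max M (cmod z)" using assms by simp
  have "cmod (clip M z) = M * (cmod z / max M (cmod z))" using assms pos by (simp add: clip_def norm_mult norm_divide)
  also have "\<dots> \<le> M * 1" using assms pos by (intro mult_left_mono) auto
  finally show "cmod (clip M z) \<le> M" by simp
  have "z - clip M z = of_real (1 - M / max M (cmod z)) * z" by (simp add: clip_def algebra_simps)
  then have "cmod (z - clip M z) = \<bar>1 - M / max M (cmod z)\<bar> * cmod z" by (simp only: norm_mult norm_of_real)
  also have "\<dots> \<le> 1 * cmod z" using assms pos by (intro mult_right_mono) (auto simp: abs_le_iff field_simps)
  finally show "cmod (z - clip M z) \<le> cmod z" by simp
qed

lemma clip_eq: "cmod z \<le> M \<Longrightarrow> 0 < M \<Longrightarrow> clip M z = z"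
  by (simp add: clip_def max_def)

lemma continuous_clip: "M > 0 \<Longrightarrow> continuous_on UNIV (clip M)"
  unfolding clip_def by (intro continuous_intros) auto

lemma l2ip_tendsto_0:
  assumes "\<And>n. L2 L (F n)" "h integrable_on {0..L}"
    and "\<And>n x. x \<in> {0..L} \<Longrightarrow> (cmod (F n x))\<^sup>2 \<le> h x"
    and "negligible N" "\<And>x. x \<in> {0..L} - N \<Longrightarrow> (\<lambda>n. F n x) \<longlonglongrightarrow> 0"
  shows "(\<lambda>n. l2ip L (F n) (F n)) \<longlonglongrightarrow> 0"
proof -
  \<comment> \<open>\<open>measurable_on\<close> provides pointwise limits off a negligible set,
    while dominated convergence asks for them everywhere; the values on the exceptional set are
    overwritten by 0.\<close>
  define G where "G n x = (if x \<in> N then 0 else (cmod (F n x))\<^sup>2)" for n x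
  have eq: "integral {0..L} (\<lambda>x. (cmod (F n x))\<^sup>2) = integral {0..L} (G n)" for n
    by (rule integral_spike[OF assms(4)]) (auto simp: G_def)
  have "(\<lambda>n. integral {0..L} (G n)) \<longlonglongrightarrow> integral {0..L} (\<lambda>x. 0)"
  proof (rule dominated_convergence(2)[where h=h])
    show "G n integrable_on {0..L}" for n
      by (rule integrable_spike[OF L2_sq[OF assms(1)] assms(4)]) (auto simp: G_def)
    show "norm (G n x) \<le> h x" if "x \<in> {0..L}" for n x
      using assms(3)[OF that, of n] order_trans[OF zero_le_power2 assms(3)[OF that, of n]] by (auto simp: G_def)
    show "(\<lambda>n. G n x) \<longlonglongrightarrow> 0" if "x \<in> {0..L}" for x
    proof (cases "x \<in> N")
      case False
      then have "(\<lambda>n. (cmod (F n x))\<^sup>2) \<longlonglongrightarrow> (cmod 0)\<^sup>2"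
        using assms(5)[of x] that by (intro tendsto_intros) auto
      then show ?thesis using False by (simp add: G_def)
    qed (simp add: G_def)
  qed (rule assms(2))
  then show ?thesis unfolding l2ip_self eq by simp
qed

lemma tendsto_0_ex_less: "(X :: nat \<Rightarrow> real) \<longlonglongrightarrow> 0 \<Longrightarrow> 0 < e \<Longrightarrow> \<exists>n. X n < e"
  using order_tendstoD(2)[of X 0 sequentially e] by (auto simp: eventually_sequentially)

lemma l2ip_triangle:
  assumes "L2 L f" "L2 L g"
  shows "l2ip L (\<lambda>x. f x + g x) (\<lambda>x. f x + g x) \<le> 2 * l2ip L f f + 2 * l2ip L g g"
proof -
  have "0 \<le> l2ip L (\<lambda>x. f x - g x) (\<lambda>x. f x - g x)" by (intro l2ip_nonneg L2_intros assms)
  then show ?thesis using assms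
    by (simp add: l2ip_add_left l2ip_add_right l2ip_diff_left l2ip_diff_right L2_intros l2ip_sym[of L g f])
qed

lemma l2ip_triangle3:
  assumes "L2 L f" "L2 L g" "L2 L h"
  shows "l2ip L (\<lambda>x. f x - h x) (\<lambda>x. f x - h x) \<le>
    2 * l2ip L (\<lambda>x. f x - g x) (\<lambda>x. f x - g x) + 2 * l2ip L (\<lambda>x. g x - h x) (\<lambda>x. g x - h x)"
  using l2ip_triangle[of L "\<lambda>x. f x - g x" "\<lambda>x. g x - h x"] assms by (simp add: L2_intros)

lemma l2ip_le_sup:
  assumes "L2 L f" "\<And>x. x \<in> {0..L} \<Longrightarrow> cmod (f x) \<le> C" "0 \<le> L"
  shows "l2ip L f f \<le> L * C\<^sup>2"
proof -
  have "l2ip L f f \<le> integral {0..L} (\<lambda>x. C\<^sup>2)"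
    unfolding l2ip_self by (intro integral_le L2_sq assms) (auto intro!: power_mono assms(2))
  then show ?thesis using assms(3) by simp
qed

text \<open>Three approximations in turn: truncation at height M, truncated continuous functions
  converging almost everywhere, and multiplication by cut-offs that vanish at both ends.\<close>

lemma L2_dense_continuous:
  assumes f: "L2 L f" and "e > 0" "0 < L"
  shows "\<exists>h. continuous_on {0..L} h \<and> h 0 = 0 \<and> h L = 0 \<and> l2ip L (\<lambda>x. f x - h x) (\<lambda>x. f x - h x) < e"
proof -
  have mclip: "L2 L (\<lambda>x. clip M (f x))" if "M > 0" for M
  proof (rule L2I)
    have "clip M \<in> borel_measurable borel" by (intro borel_measurable_continuous_onI continuous_clip that)
    with L2_measurable[OF f] show "(\<lambda>x. clip M (f x)) \<in> borel_measurable (lebesgue_on {0..L})" by measurable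
    show "(\<lambda>x. M\<^sup>2) integrable_on {0..L}" by (rule integrable_const_ivl)
    show "(cmod (clip M (f x)))\<^sup>2 \<le> M\<^sup>2" for x using clip_le(1)[OF that] by (intro power_mono) auto
  qed
  have "(\<lambda>n. l2ip L (\<lambda>x. f x - clip (real (Suc n)) (f x)) (\<lambda>x. f x - clip (real (Suc n)) (f x))) \<longlonglongrightarrow> 0"
  proof (rule l2ip_tendsto_0[where N="{}", OF _ L2_sq[OF f]])
    show "(cmod (f x - clip (real (Suc n)) (f x)))\<^sup>2 \<le> (cmod (f x))\<^sup>2" for n x
      by (intro power_mono clip_le) auto
    fix x
    obtain n0 where n0: "cmod (f x) \<le> real n0" using real_arch_simple by blast
    have "f x - clip (real (Suc n)) (f x) = 0" if "n \<ge> n0" for n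
      using clip_eq[of "f x" "real (Suc n)"] n0 that by simp
    then show "(\<lambda>n. f x - clip (real (Suc n)) (f x)) \<longlonglongrightarrow> 0"
      by (intro tendsto_eventually) (auto simp: eventually_sequentially)
  qed (auto intro!: L2_intros f mclip)
  \<comment> \<open>Every use of \<open>l2ip_triangle3\<close> doubles the errors: e/16 and e/16
    give e/4, and then e/4 with e/8 gives 3e/4.\<close>
  from tendsto_0_ex_less[OF this, of "e/16"] \<open>e > 0\<close> obtain n where
    n: "l2ip L (\<lambda>x. f x - clip (real (Suc n)) (f x)) (\<lambda>x. f x - clip (real (Suc n)) (f x)) < e / 16"
    by auto
  define M where "M = real (Suc n)"
  have M: "M > 0" by (simp add: M_def)
  have 1: "l2ip L (\<lambda>x. f x - clip M (f x)) (\<lambda>x. f x - clip M (f x)) < e / 16" using n by (simp add: M_def)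
  obtain N g where g: "negligible N" "\<And>n. continuous_on UNIV (g n)"
    "\<And>x. x \<notin> N \<Longrightarrow> (\<lambda>n. g n x) \<longlonglongrightarrow> (if x \<in> {0..L} then f x else 0)"
    using f unfolding L2_def measurable_on_def by blast
  have cg: "continuous_on {0..L} (\<lambda>x. clip M (g n x))" for n
    by (rule continuous_on_subset[OF continuous_on_compose2[OF continuous_clip[OF M] g(2)[of n]]]) auto
  have "(\<lambda>n. l2ip L (\<lambda>x. clip M (f x) - clip M (g n x)) (\<lambda>x. clip M (f x) - clip M (g n x))) \<longlonglongrightarrow> 0"
  proof (rule l2ip_tendsto_0[where h="\<lambda>x. (2*M)\<^sup>2", OF _ _ _ g(1)])
    show "L2 L (\<lambda>x. clip M (f x) - clip M (g n x))" for n
      by (intro L2_intros mclip M L2_continuous cg)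
    show "(cmod (clip M (f x) - clip M (g n x)))\<^sup>2 \<le> (2*M)\<^sup>2" for n x
      using norm_triangle_ineq4[of "clip M (f x)" "clip M (g n x)"] clip_le(1)[OF M, of "f x"] clip_le(1)[OF M, of "g n x"]
      by (intro power_mono) auto
    fix x assume x: "x \<in> {0..L} - N"
    then have "(\<lambda>n. g n x) \<longlonglongrightarrow> f x" using g(3)[of x] by simp
    moreover have "isCont (clip M) (f x)"
      using continuous_clip[OF M] by (simp add: continuous_on_eq_continuous_at)
    ultimately have "(\<lambda>n. clip M (g n x)) \<longlonglongrightarrow> clip M (f x)"
      by (rule isCont_tendsto_compose[rotated])
    from tendsto_diff[OF tendsto_const this, of "clip M (f x)"]
    show "(\<lambda>n. clip M (f x) - clip M (g n x)) \<longlonglongrightarrow> 0" by simp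
  qed (rule integrable_const_ivl)
  from tendsto_0_ex_less[OF this, of "e/16"] \<open>e > 0\<close> obtain m where
    m: "l2ip L (\<lambda>x. clip M (f x) - clip M (g m x)) (\<lambda>x. clip M (f x) - clip M (g m x)) < e / 16"
    by auto
  define k where "k x = clip M (g m x)" for x
  have ck: "continuous_on {0..L} k" unfolding k_def by (rule cg)
  have 2: "l2ip L (\<lambda>x. f x - k x) (\<lambda>x. f x - k x) < e / 4"
    using l2ip_triangle3[OF f mclip[OF M] L2_continuous[OF ck]] 1 m by (simp add: k_def)
  \<comment> \<open>A product of two ramps: zero at both ends, and equal to 1 at each interior point
    from some n on.\<close>
  define c where "c n x = min 1 (real n * x) * min 1 (real n * (L - x))" for n :: nat and x :: real
  have c01: "0 \<le> c n x" "c n x \<le> 1" if "x \<in> {0..L}" for n x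
    using that unfolding c_def by (auto intro!: mult_le_one)
  have cc: "continuous_on {0..L} (\<lambda>x. of_real (c n x) * k x)" for n
    unfolding c_def by (intro continuous_intros ck)
  have kb: "cmod (k x) \<le> M" for x unfolding k_def by (rule clip_le[OF M])
  have "(\<lambda>n. l2ip L (\<lambda>x. k x - of_real (c n x) * k x) (\<lambda>x. k x - of_real (c n x) * k x)) \<longlonglongrightarrow> 0"
  proof (rule l2ip_tendsto_0[where h="\<lambda>x. M\<^sup>2" and N="{0, L}"])
    show "L2 L (\<lambda>x. k x - of_real (c n x) * k x)" for n
      by (intro L2_diff L2_continuous ck cc)
    fix n x assume x: "x \<in> {0..L}"
    have "k x - of_real (c n x) * k x = of_real (1 - c n x) * k x" by (simp add: algebra_simps)
    then have "cmod (k x - of_real (c n x) * k x) = \<bar>1 - c n x\<bar> * cmod (k x)" by (simp only: norm_mult norm_of_real)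
    also have "\<dots> \<le> 1 * M" using c01[OF x, of n] kb[of x] by (intro mult_mono) auto
    finally show "(cmod (k x - of_real (c n x) * k x))\<^sup>2 \<le> M\<^sup>2" by (intro power_mono) auto
  next
    fix x assume x: "x \<in> {0..L} - {0, L}"
    obtain n1 n2 where n1: "1 < real n1 * x" and n2: "1 < real n2 * (L - x)"
      using x reals_Archimedean3[of x] reals_Archimedean3[of "L - x"]
      by (metis Diff_iff atLeastAtMost_iff diff_gt_0_iff_gt insertCI order_le_less)
    have "k x - of_real (c n x) * k x = 0" if "n \<ge> max n1 n2" for n
    proof -
      have "real n1 * x \<le> real n * x" "real n2 * (L - x) \<le> real n * (L - x)"
        using that x by (auto intro!: mult_right_mono)
      then show ?thesis using n1 n2 by (simp add: c_def)
    qed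
    then show "(\<lambda>n. k x - of_real (c n x) * k x) \<longlonglongrightarrow> 0"
      by (intro tendsto_eventually eventually_sequentiallyI[of "max n1 n2"])
  qed (auto intro: integrable_const_ivl)
  from tendsto_0_ex_less[OF this, of "e/8"] \<open>e > 0\<close> obtain p where
    p: "l2ip L (\<lambda>x. k x - of_real (c p x) * k x) (\<lambda>x. k x - of_real (c p x) * k x) < e / 8"
    by auto
  show ?thesis
  proof (intro exI[of _ "\<lambda>x. of_real (c p x) * k x"] conjI cc)
    show "l2ip L (\<lambda>x. f x - of_real (c p x) * k x) (\<lambda>x. f x - of_real (c p x) * k x) < e"
      using l2ip_triangle3[OF f L2_continuous[OF ck] L2_continuous[OF cc[of p]]] 2 p 1 m \<open>e > 0\<close>
        l2ip_triangle3[OF f mclip[OF M] L2_continuous[OF ck]] by (simp add: k_def)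
  qed (auto simp: c_def)
qed

text \<open>Smooth functions vanishing at both ends are dense: subtract from a Weierstrass approximation of a
  continuous approximant the affine interpolation of its boundary values.\<close>

lemma L2_dense_C1:
  assumes f: "L2 L f" and e: "e > 0" and L: "0 < L"
  shows "\<exists>p p'. has_wderiv L p p' \<and> p 0 = 0 \<and> p L = 0 \<and> l2ip L (\<lambda>x. f x - p x) (\<lambda>x. f x - p x) < e"
proof -
  obtain h where h: "continuous_on {0..L} h" "h 0 = 0" "h L = 0" "l2ip L (\<lambda>x. f x - h x) (\<lambda>x. f x - h x) < e/4"
    using L2_dense_continuous[OF f, of "e/4"] e L by auto
  \<comment> \<open>Solved from L (3 d)^2 = e/4. The factor 3 counts the polynomial error and the
    two boundary values of q, each at most d.\<close>
  define d where "d = sqrt (e / (36 * L))"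
  have d: "d > 0" "L * (3 * d)\<^sup>2 = e / 4" using e L by (auto simp: d_def power_mult_distrib)
  obtain q where q: "polynomial_function q" "\<And>x. x \<in> {0..L} \<Longrightarrow> cmod (h x - q x) < d"
    using Stone_Weierstrass_polynomial_function[OF compact_Icc h(1) d(1)] by blast
  obtain q' where q': "polynomial_function q'" "\<And>x. (q has_vector_derivative (q' x)) (at x)"
    using has_vector_derivative_polynomial_function[OF q(1)] by blast
  define p where "p x = q x - (q 0 + of_real (x / L) * (q L - q 0))" for x
  have "has_wderiv L p (\<lambda>x. q' x - of_real (1 / L) * (q L - q 0))"
  proof (rule wderiv_C1)
    show "continuous_on {0..L} (\<lambda>x. q' x - of_real (1 / L) * (q L - q 0))"
      by (intro continuous_intros continuous_on_polymonial_function q')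
    show "(p has_vector_derivative q' x - of_real (1 / L) * (q L - q 0)) (at x within {0..L})" for x
    proof -
      have "((\<lambda>x. x / L) has_real_derivative 1 / L) (at x within {0..L})"
        using L by (auto intro!: derivative_eq_intros)
      from has_vector_derivative_of_real[OF this, where 'a=complex]
      have "((\<lambda>x. complex_of_real (x / L)) has_vector_derivative complex_of_real (1 / L)) (at x within {0..L})" .
      from has_vector_derivative_mult_left[OF this, of "q L - q 0"]
      have "((\<lambda>x. q x - (q 0 + of_real (x / L) * (q L - q 0))) has_vector_derivative q' x - (0 + of_real (1 / L) * (q L - q 0))) (at x within {0..L})"
        by (intro has_vector_derivative_diff has_vector_derivative_add has_vector_derivative_const
            has_vector_derivative_at_within[OF q'(2)])
      then show ?thesis unfolding p_def by simp
    qed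
  qed
  moreover have "p 0 = 0" "p L = 0" using L by (simp_all add: p_def)
  moreover have "l2ip L (\<lambda>x. f x - p x) (\<lambda>x. f x - p x) < e"
  proof -
    have cp: "L2 L p" using wderiv_continuous[OF calculation(1)] by (rule L2_continuous)
    have "l2ip L (\<lambda>x. h x - p x) (\<lambda>x. h x - p x) \<le> L * (3 * d)\<^sup>2"
    proof (rule l2ip_le_sup)
      show "L2 L (\<lambda>x. h x - p x)" by (intro L2_diff cp L2_continuous h)
      fix x assume x: "x \<in> {0..L}"
      have q0: "cmod (q 0) \<le> d" "cmod (q L) \<le> d" using q(2)[of 0] q(2)[of L] h L by auto
      define t where "t = complex_of_real (x / L)"
      have e1: "of_real (1 - x / L) = 1 - t" by (simp add: t_def)
      have "h x - p x = (h x - q x) + (of_real (1 - x / L) * q 0 + of_real (x / L) * q L)"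
        unfolding p_def e1 t_def[symmetric] by (simp add: algebra_simps)
      also have "cmod \<dots> \<le> cmod (h x - q x) + (cmod (of_real (1 - x / L) * q 0) + cmod (of_real (x / L) * q L))"
        by (intro order_trans[OF norm_triangle_ineq] add_left_mono norm_triangle_ineq)
      also have "\<dots> \<le> d + (1 * d + 1 * d)"
      proof (intro add_mono)
        show "cmod (h x - q x) \<le> d" using q(2)[OF x] by simp
        have ab: "\<bar>1 - x / L\<bar> \<le> 1" "\<bar>x / L\<bar> \<le> 1" using x L by (auto simp: abs_le_iff field_simps)
        show "cmod (of_real (1 - x / L) * q 0) \<le> 1 * d"
          unfolding norm_mult norm_of_real by (rule mult_mono[OF ab(1) q0(1)]) auto
        show "cmod (of_real (x / L) * q L) \<le> 1 * d"
          unfolding norm_mult norm_of_real by (rule mult_mono[OF ab(2) q0(2)]) auto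
      qed
      finally show "cmod (h x - p x) \<le> 3 * d" by simp
    qed (use L in simp)
    then have "l2ip L (\<lambda>x. h x - p x) (\<lambda>x. h x - p x) \<le> e / 4" using d by simp
    then show ?thesis using l2ip_triangle3[OF f L2_continuous[OF h(1)] cp] h(4) by simp
  qed
  ultimately show ?thesis by blast
qed

text \<open>The hypothesis makes f a weak derivative of the zero function. Integration by parts then
  makes f orthogonal to every p possessing a weak derivative, and such p approximate f
  itself.\<close>

lemma indefinite_integral_zero_imp_AE_zero:
  assumes f: "L2 L f" and L: "0 < L" and zero: "\<And>x. x \<in> {0..L} \<Longrightarrow> integral {0..x} f = 0"
  shows "AE x in lebesgue_on {0..L}. f x = 0"
proof (rule l2ip_eq_0[OF f])
  have w: "has_wderiv L (\<lambda>x. 0) f" by (rule wderivI[OF f]) (use zero in auto)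
  have "l2ip L f f \<le> 0"
  proof (rule field_le_epsilon)
    fix e :: real assume "e > 0"
    obtain p p' where p: "has_wderiv L p p'" "l2ip L (\<lambda>x. f x - p x) (\<lambda>x. f x - p x) < e"
      using L2_dense_C1[OF f \<open>e > 0\<close> L] by blast
    note Lp = L2_continuous[OF wderiv_continuous[OF p(1)]]
    have "l2ip L f p = 0" using l2ip_parts[OF w p(1)] L by (simp add: l2ip_def)
    then have "l2ip L (\<lambda>x. f x - p x) (\<lambda>x. f x - p x) = l2ip L f f + l2ip L p p"
      using f Lp by (simp add: l2ip_diff_left l2ip_diff_right L2_intros l2ip_sym[of L p f])
    then show "l2ip L f f \<le> 0 + e" using p(2) l2ip_nonneg[OF Lp] by simp
  qed
  then show "l2ip L f f = 0" using l2ip_nonneg[OF f] by simp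
qed

lemma wderiv_unique:
  assumes "has_wderiv L u g" "has_wderiv L u h" "0 < L"
  shows "AE x in lebesgue_on {0..L}. g x = h x"
proof -
  have "has_wderiv L (\<lambda>x. u x - u x) (\<lambda>x. g x - h x)" by (intro wderiv_diff assms)
  then have w: "has_wderiv L (\<lambda>x. 0) (\<lambda>x. g x - h x)" by simp
  have "AE x in lebesgue_on {0..L}. g x - h x = 0"
    by (rule indefinite_integral_zero_imp_AE_zero[OF wderiv_L2[OF w] assms(3)]) (use wderiv_eq[OF w] in simp)
  then show ?thesis by simp
qed

lemma wderiv_unique_continuous:
  assumes "has_wderiv L u g" "has_wderiv L u h" "continuous_on {0..L} g" "continuous_on {0..L} h" "0 < L" "x \<in> {0..L}"
  shows "g x = h x"
  by (rule AE_interval_continuous_eq[where a=0 and c=L and b=L and f=g and g=h])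
    (use wderiv_unique[OF assms(1,2,5)] assms in auto)

lemma wderiv_wd: "has_wderiv L u g \<Longrightarrow> has_wderiv L u (wd L u)"
  unfolding wd_def by (rule someI[where P="has_wderiv L u"])

lemma wd_AE: "has_wderiv L u g \<Longrightarrow> 0 < L \<Longrightarrow> AE x in lebesgue_on {0..L}. wd L u x = g x"
  by (rule wderiv_unique[OF wderiv_wd])

text \<open>\<open>wd2\<close> comes with a hidden first derivative of its own. Both first
  derivatives are continuous, so they agree at every point of the interval, and only then can the
  second derivatives be compared.\<close>

lemma wd2_AE:
  assumes "has_wderiv L u g" "has_wderiv L g h" "0 < L"
  shows "AE x in lebesgue_on {0..L}. wd2 L u x = h x"
proof -
  have "\<exists>g. has_wderiv L u g \<and> has_wderiv L g (wd2 L u)"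
    unfolding wd2_def by (rule someI[of "\<lambda>h. \<exists>g. has_wderiv L u g \<and> has_wderiv L g h"]) (use assms in blast)
  then obtain g' where g': "has_wderiv L u g'" "has_wderiv L g' (wd2 L u)" by blast
  have "g' x = g x" if "x \<in> {0..L}" for x
    by (rule wderiv_unique_continuous[OF g'(1) assms(1) wderiv_continuous[OF g'(2)] wderiv_continuous[OF assms(2)] assms(3) that])
  then have "has_wderiv L g (wd2 L u)"
    by (intro wderiv_cong_AE[OF g'(2)]) (use assms(3) in auto)
  then show ?thesis by (rule wderiv_unique[OF _ assms(2,3)])
qed

lemma gronwall:
  fixes u :: "real \<Rightarrow> real"
  assumes cont: "continuous_on {0..L} u" and k: "0 \<le> k"
    and le: "\<And>x. x \<in> {0..L} \<Longrightarrow> u x \<le> c + k * integral {0..x} u" and x: "x \<in> {0..L}"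
  shows "u x \<le> c * exp (k * x)"
proof -
  define V where "V x = integral {0..x} u" for x
  \<comment> \<open>The integrating factor: the derivative of W is exp (-k y) k times u - (c + k V),
    which the hypothesis makes nonpositive.\<close>
  define W where "W x = exp (- k * x) * (c + k * V x)" for x
  have contV: "continuous_on {0..L} V"
    unfolding V_def by (intro indefinite_integral_continuous_1 integrable_continuous_real cont)
  have "W 0 \<ge> W x"
  proof (rule DERIV_nonpos_imp_decreasing_open[where f=W and a=0 and b=x])
    show "continuous_on {0..x} W"
      unfolding W_def using x by (intro continuous_intros continuous_on_subset[OF contV]) auto
    fix y assume y: "0 < y" "y < x"
    have "(V has_real_derivative u y) (at y within {0..L})"
      unfolding V_def by (rule integral_has_real_derivative[OF cont]) (use y x in auto)
    then have V': "(V has_real_derivative u y) (at y)"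
      by (subst (asm) at_within_Icc_at) (use y x in auto)
    have "(W has_real_derivative exp (- k * y) * k * (u y - (c + k * V y))) (at y)"
      unfolding W_def by (rule derivative_eq_intros V' refl)+ (simp add: algebra_simps)
    moreover have "exp (- k * y) * k * (u y - (c + k * V y)) \<le> 0"
      using k le[of y] y x by (intro mult_nonneg_nonpos) (auto simp: V_def)
    ultimately show "\<exists>z. (W has_real_derivative z) (at y) \<and> z \<le> 0" by blast
  qed (use x in auto)
  then have "exp (- k * x) * (c + k * V x) \<le> c" by (simp add: W_def V_def)
  then have "c + k * V x \<le> c * exp (k * x)"
    by (simp add: exp_minus field_simps)
  then show ?thesis using le[OF x] by (simp add: V_def)
qed

section \<open>Linear Volterra equations\<close>

text \<open>The system y' = (A0 + a(x) A1) y + f in integral form. The coefficient a is merely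
  bounded and measurable, as a jumping damping coefficient requires; separating it from the constant
  maps keeps measurability a matter of a scalar function.\<close>

locale volterra =
  fixes A0 A1 :: "'a::euclidean_space \<Rightarrow> 'a" and a :: "real \<Rightarrow> real" and L K0 K1 Ka :: real
  assumes lin: "linear A0" "linear A1"
    and A_bound: "\<And>v. norm (A0 v) \<le> K0 * norm v" "\<And>v. norm (A1 v) \<le> K1 * norm v" "0 \<le> K0" "0 \<le> K1"
    and a_measurable: "a \<in> borel_measurable (lebesgue_on {0..L})"
    and a_bound: "\<And>x. x \<in> {0..L} \<Longrightarrow> \<bar>a x\<bar> \<le> Ka" "0 \<le> Ka"
    and L_pos: "0 < L"
begin

definition rhs :: "real \<Rightarrow> 'a \<Rightarrow> 'a" where "rhs t v = A0 v + a t *\<^sub>R A1 v"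

definition K :: real where "K = K0 + Ka * K1 + 1"

definition solves :: "'a \<Rightarrow> (real \<Rightarrow> 'a) \<Rightarrow> (real \<Rightarrow> 'a) \<Rightarrow> bool" where
  "solves y0 f y \<longleftrightarrow> continuous_on {0..L} y \<and> (\<forall>x\<in>{0..L}. y x = y0 + integral {0..x} (\<lambda>t. rhs t (y t) + f t))"

lemma K_pos: "0 < K"
  unfolding K_def using A_bound(3,4) a_bound(2) by (intro add_nonneg_pos add_nonneg_nonneg mult_nonneg_nonneg) auto

lemma rhs_linear: "rhs t (v + w) = rhs t v + rhs t w" "rhs t (c *\<^sub>R v) = c *\<^sub>R rhs t v" "rhs t (v - w) = rhs t v - rhs t w"
  using lin by (auto simp: rhs_def linear_add linear_diff linear_scale algebra_simps)

lemma rhs_bound: assumes "t \<in> {0..L}" shows "norm (rhs t v) \<le> K * norm v"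
proof -
  have "norm (rhs t v) \<le> norm (A0 v) + \<bar>a t\<bar> * norm (A1 v)"
    unfolding rhs_def by (rule order_trans[OF norm_triangle_ineq]) simp
  also have "\<dots> \<le> K0 * norm v + Ka * (K1 * norm v)"
    using A_bound a_bound assms by (intro add_mono mult_mono) auto
  also have "\<dots> \<le> K * norm v" by (simp add: K_def algebra_simps)
  finally show ?thesis .
qed

lemma rhs_integrable:
  assumes y: "continuous_on {0..L} y" and "0 \<le> c" "d \<le> L"
  shows "(\<lambda>t. rhs t (y t)) integrable_on {c..d}"
proof -
  have c: "continuous_on {0..L} (\<lambda>t. A0 (y t))" "continuous_on {0..L} (\<lambda>t. A1 (y t))"
    by (rule linear_continuous_on_compose[OF y lin(1)], rule linear_continuous_on_compose[OF y lin(2)])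
  have "(\<lambda>t. a t *\<^sub>R A1 (y t)) absolutely_integrable_on {0..L}"
  proof (rule absolutely_integrable_bounded_measurable_product[where h="\<lambda>a v. a *\<^sub>R v"])
    show "bounded (a ` {0..L})" by (rule boundedI[of _ Ka]) (use a_bound in auto)
  qed (auto intro!: a_measurable absolutely_integrable_continuous_real c bilinear_conv_bounded_bilinear[THEN iffD2] bounded_bilinear_scaleR)
  then have "(\<lambda>t. rhs t (y t)) integrable_on {0..L}"
    unfolding rhs_def by (intro integrable_add[OF integrable_continuous_real[OF c(1)]]) (simp add: absolutely_integrable_on_def)
  then show ?thesis by (rule integrable_on_subinterval) (use assms in auto)
qed

lemma solves_unique:
  assumes "solves y0 f y" "solves y0 f w" "x \<in> {0..L}" "f integrable_on {0..L}" shows "y x = w x"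
proof -
  have c: "continuous_on {0..L} y" "continuous_on {0..L} w" using assms by (auto simp: solves_def)
  have fi: "f integrable_on {0..x}" if "x \<in> {0..L}" for x
    using integrable_on_subinterval[OF assms(4), of 0 x] that by auto
  have "norm (y x - w x) \<le> 0 * exp (K * x)"
  proof (rule gronwall[OF _ _ _ assms(3)])
    show "continuous_on {0..L} (\<lambda>x. norm (y x - w x))" by (intro continuous_intros c)
    fix x assume x: "x \<in> {0..L}"
    have i: "(\<lambda>t. rhs t (y t)) integrable_on {0..x}" "(\<lambda>t. rhs t (w t)) integrable_on {0..x}"
      "(\<lambda>t. rhs t (y t - w t)) integrable_on {0..x}"
      using x by (auto intro!: rhs_integrable c continuous_intros)
    have "y x = y0 + (integral {0..x} (\<lambda>t. rhs t (y t)) + integral {0..x} f)"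
      "w x = y0 + (integral {0..x} (\<lambda>t. rhs t (w t)) + integral {0..x} f)"
      using assms(1,2) x unfolding solves_def integral_add[OF i(1) fi[OF x], symmetric] integral_add[OF i(2) fi[OF x], symmetric]
      by blast+
    then have "y x - w x = integral {0..x} (\<lambda>t. rhs t (y t)) - integral {0..x} (\<lambda>t. rhs t (w t))" by simp
    also have "\<dots> = integral {0..x} (\<lambda>t. rhs t (y t - w t))"
      unfolding rhs_linear by (rule integral_diff[symmetric, OF i(1,2)])
    also have "norm \<dots> \<le> integral {0..x} (\<lambda>t. K * norm (y t - w t))"
    proof (rule integral_norm_bound_integral[OF i(3)])
      show "(\<lambda>t. K * norm (y t - w t)) integrable_on {0..x}"
        using x by (intro integrable_continuous_real continuous_intros continuous_on_subset[OF c(1)] continuous_on_subset[OF c(2)]) auto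
    qed (use x rhs_bound in auto)
    finally show "norm (y x - w x) \<le> 0 + K * integral {0..x} (\<lambda>t. norm (y t - w t))" by simp
  qed (use K_pos in simp)
  then show ?thesis by simp
qed

text \<open>The exponential weight turns the Volterra operator into a contraction on the whole interval.\<close>

lemma solves_exists:
  assumes f: "f integrable_on {0..L}"
  shows "\<exists>y. solves y0 f y"
proof -
  \<comment> \<open>Twice the Lipschitz constant: integrating K exp (k t) costs a factor K / k, so
    the weighted map contracts with constant 1/2.\<close>
  define k where "k = 2 * K"
  have k: "0 < k" "K / k = 1 / 2" using K_pos by (simp_all add: k_def)
  define J where "J w x = exp (- k * x) *\<^sub>R (y0 + integral {0..x} (\<lambda>t. rhs t (exp (k * t) *\<^sub>R w t) + f t))"
    for w :: "real \<Rightarrow> 'a" and x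
  \<comment> \<open>Clamping to [0, L] extends functions on the interval to bounded continuous
    functions on the real line, where the complete space of the fixed point theorem lives.\<close>
  define cl where "cl x = max 0 (min L x)" for x
  have cl: "cl x \<in> {0..L}" "continuous_on UNIV cl" for x
    using L_pos unfolding cl_def by (auto intro!: continuous_intros)
  have cl_id: "cl x = x" if "x \<in> {0..L}" for x using that by (auto simp: cl_def)
  have ei: "(\<lambda>t. rhs t (exp (k * t) *\<^sub>R w t)) integrable_on {0..x}"
    if "continuous_on {0..L} w" "x \<in> {0..L}" for w x
    by (rule rhs_integrable) (use that in \<open>auto intro!: continuous_intros\<close>)
  have fi: "f integrable_on {0..x}" if "x \<in> {0..L}" for x
    using integrable_on_subinterval[OF f, of 0 x] that by auto
  have contJ: "continuous_on {0..L} (J w)" if "continuous_on {0..L} w" for w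
    unfolding J_def using ei[OF that, of L] f L_pos
    by (intro continuous_intros indefinite_integral_continuous_1 integrable_add) auto
  have J_bc: "(\<lambda>x. J w (cl x)) \<in> bcontfun" if "continuous_on {0..L} w" for w
  proof -
    have "continuous_on UNIV (\<lambda>x. J w (cl x))"
      by (rule continuous_on_compose2[OF contJ[OF that] cl(2)]) (use cl in auto)
    moreover have "bounded (range (\<lambda>x. J w (cl x)))"
      by (rule bounded_subset[OF compact_imp_bounded[OF compact_continuous_image[OF contJ[OF that] compact_Icc]]])
        (use cl in auto)
    ultimately show ?thesis by (simp add: bcontfun_def)
  qed
  define \<Phi> where "\<Phi> w = Bcontfun (\<lambda>x. J (apply_bcontfun w) (cl x))" for w :: "real \<Rightarrow>\<^sub>C 'a"
  have cw: "continuous_on {0..L} (apply_bcontfun w)" for w :: "real \<Rightarrow>\<^sub>C 'a"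
    by (rule continuous_on_subset[OF continuous_on_apply_bcontfun[of UNIV]]) auto
  have \<Phi>: "apply_bcontfun (\<Phi> w) x = J (apply_bcontfun w) (cl x)" for w x
    unfolding \<Phi>_def using J_bc[OF cw] by (simp add: Bcontfun_inverse)
  have "\<exists>!w. \<Phi> w = w"
  proof (rule banach_fix_type[where c="1/2"], simp, simp, intro allI)
    fix w w' :: "real \<Rightarrow>\<^sub>C 'a"
    show "dist (\<Phi> w) (\<Phi> w') \<le> 1/2 * dist w w'"
    proof (rule dist_bound)
      fix x
      let ?x = "cl x" and ?d = "dist w w'"
      define r where "r = (\<lambda>t. rhs t (exp (k * t) *\<^sub>R (w t - w' t)))"
      have x: "?x \<in> {0..L}" by (rule cl)
      have ri: "r integrable_on {0..?x}" unfolding r_def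
        by (rule ei[OF _ x]) (intro continuous_intros cw)
      have "J w ?x - J w' ?x = exp (- k * ?x) *\<^sub>R (integral {0..?x} (\<lambda>t. rhs t (exp (k * t) *\<^sub>R w t) + f t)
          - integral {0..?x} (\<lambda>t. rhs t (exp (k * t) *\<^sub>R w' t) + f t))"
        by (simp add: J_def algebra_simps)
      also have "\<dots> = exp (- k * ?x) *\<^sub>R integral {0..?x} r"
        unfolding integral_diff[OF integrable_add[OF ei[OF cw x] fi[OF x]] integrable_add[OF ei[OF cw x] fi[OF x]], symmetric]
        by (simp add: r_def rhs_linear algebra_simps)
      finally have e: "J w ?x - J w' ?x = exp (- k * ?x) *\<^sub>R integral {0..?x} r" .
      have int: "((\<lambda>t. K * ?d * exp (k * t)) has_integral (K * ?d / k * exp (k * ?x) - K * ?d / k * exp (k * 0))) {0..?x}"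
        using x k by (intro fundamental_theorem_of_calculus)
          (auto intro!: derivative_eq_intros simp: has_real_derivative_iff_has_vector_derivative[symmetric])
      have "norm (integral {0..?x} r) \<le> integral {0..?x} (\<lambda>t. K * ?d * exp (k * t))"
      proof (rule integral_norm_bound_integral[OF ri has_integral_integrable[OF int]])
        fix t assume t: "t \<in> {0..?x}"
        have "norm (r t) \<le> K * norm (exp (k * t) *\<^sub>R (w t - w' t))"
          unfolding r_def by (rule rhs_bound) (use t x in auto)
        also have "\<dots> = K * exp (k * t) * dist (w t) (w' t)" by (simp add: dist_norm)
        also have "\<dots> \<le> K * exp (k * t) * ?d"
          using K_pos by (intro mult_left_mono dist_bounded) auto
        finally show "norm (r t) \<le> K * ?d * exp (k * t)" by (simp add: mult_ac)
      qed
      also have "\<dots> \<le> K * ?d / k * exp (k * ?x)"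
        unfolding integral_unique[OF int] using K_pos k by simp
      also have "K * ?d / k = ?d / 2" using k by (simp add: field_simps)
      finally have "norm (integral {0..?x} r) \<le> ?d / 2 * exp (k * ?x)" .
      then have "exp (- k * ?x) * norm (integral {0..?x} r) \<le> exp (- k * ?x) * (?d / 2 * exp (k * ?x))"
        by (intro mult_left_mono) auto
      also have "\<dots> = ?d / 2" by (simp add: exp_minus field_simps)
      finally show "dist (apply_bcontfun (\<Phi> w) x) (apply_bcontfun (\<Phi> w') x) \<le> 1/2 * ?d"
        unfolding \<Phi> dist_norm e by simp
    qed
  qed
  then obtain w where w: "\<Phi> w = w" by blast
  define y where "y x = exp (k * x) *\<^sub>R apply_bcontfun w x" for x
  have "solves y0 f y"
    unfolding solves_def
  proof (intro conjI ballI)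
    show "continuous_on {0..L} y" unfolding y_def by (intro continuous_intros cw)
    fix x assume x: "x \<in> {0..L}"
    have "apply_bcontfun w x = J w x" using \<Phi>[of w x] w cl_id[OF x] by simp
    then show "y x = y0 + integral {0..x} (\<lambda>t. rhs t (y t) + f t)"
      by (simp add: y_def J_def exp_minus)
  qed
  then show ?thesis by blast
qed

lemma solves_add:
  assumes "solves y0 f y" "solves z0 g z" "f integrable_on {0..L}" "g integrable_on {0..L}"
  shows "solves (y0 + z0) (\<lambda>t. f t + g t) (\<lambda>x. y x + z x)"
  unfolding solves_def
proof (intro conjI ballI)
  have c: "continuous_on {0..L} y" "continuous_on {0..L} z" using assms by (auto simp: solves_def)
  then show "continuous_on {0..L} (\<lambda>x. y x + z x)" by (intro continuous_intros)
  fix x assume x: "x \<in> {0..L}"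
  have i: "(\<lambda>t. rhs t (y t) + f t) integrable_on {0..x}" "(\<lambda>t. rhs t (z t) + g t) integrable_on {0..x}"
    using x integrable_on_subinterval[OF assms(3), of 0 x] integrable_on_subinterval[OF assms(4), of 0 x]
    by (auto intro!: integrable_add rhs_integrable c)
  have "y x = y0 + integral {0..x} (\<lambda>t. rhs t (y t) + f t)" "z x = z0 + integral {0..x} (\<lambda>t. rhs t (z t) + g t)"
    using assms(1,2) x unfolding solves_def by blast+
  then have "y x + z x = (y0 + z0) + (integral {0..x} (\<lambda>t. rhs t (y t) + f t) + integral {0..x} (\<lambda>t. rhs t (z t) + g t))"
    by (metis (no_types, lifting) ab_semigroup_add_class.add_ac(1) add.left_commute)
  then show "y x + z x = (y0 + z0) + integral {0..x} (\<lambda>t. rhs t (y t + z t) + (f t + g t))"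
    unfolding integral_add[OF i, symmetric] by (simp add: rhs_linear algebra_simps)
qed

lemma solves_scale:
  assumes "solves y0 f y"
  shows "solves (c *\<^sub>R y0) (\<lambda>t. c *\<^sub>R f t) (\<lambda>x. c *\<^sub>R y x)"
  unfolding solves_def
proof (intro conjI ballI)
  show "continuous_on {0..L} (\<lambda>x. c *\<^sub>R y x)" using assms by (auto simp: solves_def intro!: continuous_intros)
  fix x assume x: "x \<in> {0..L}"
  have "c *\<^sub>R y x = c *\<^sub>R (y0 + integral {0..x} (\<lambda>t. rhs t (y t) + f t))"
    using assms x unfolding solves_def by (metis (no_types, lifting))
  also have "\<dots> = c *\<^sub>R y0 + integral {0..x} (\<lambda>t. c *\<^sub>R (rhs t (y t) + f t))"
    by (simp only: scaleR_add_right[of c y0] integral_cmul)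
  finally show "c *\<^sub>R y x = c *\<^sub>R y0 + integral {0..x} (\<lambda>t. rhs t (c *\<^sub>R y t) + c *\<^sub>R f t)"
    by (simp only: rhs_linear scaleR_add_right)
qed

end

section \<open>The energy space\<close>

lemma state_ops: "sadd U V = U + V" "sdiff U V = U - V"
  by (simp_all add: sadd_def sdiff_def fun_eq_iff)

text \<open>The damping is prescribed on open intervals only and may take any value at 0, \<beta>
  and the right end. Hence its sign is known almost everywhere, and \<open>Ka\<close> has to cover
  those point values as well.\<close>

locale bresse =
  fixes P :: bresse_params and \<beta> a0 Ka :: real
  assumes pos: "0 < rho1 P" "0 < rho2 P" "0 < kk1 P" "0 < kk2 P" "0 < kk3 P" "0 < ll P" "0 < len P"
    and \<beta>: "0 < \<beta>" "\<beta> < len P" and a0: "0 < a0"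
    and damp_left: "\<And>x. 0 < x \<Longrightarrow> x < \<beta> \<Longrightarrow> damp P x = a0"
    and damp_nonneg: "AE x in lebesgue_on {0..len P}. 0 \<le> damp P x"
    and damp_measurable: "damp P \<in> borel_measurable (lebesgue_on {0..len P})"
    and damp_bound: "\<And>x. x \<in> {0..len P} \<Longrightarrow> \<bar>damp P x\<bar> \<le> Ka" "0 \<le> Ka"
begin

abbreviation "L \<equiv> len P"
abbreviation "l \<equiv> complex_of_real (ll P)"
abbreviation "ae Q \<equiv> (AE x in lebesgue_on {0..L}. Q x)"

lemma L0: "0 \<le> L" using pos by simp

definition H :: "state set" where "H = {U. inH P U}"

definition wt :: "nat \<Rightarrow> real" where
  "wt i = (if i = 1 then kk1 P else if i = 2 then rho1 P else if i = 3 then kk2 P else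
           if i = 4 then rho2 P else if i = 5 then kk3 P else rho1 P)"

text \<open>The six quantities squared in the energy: strains (shear, bending, axial) in the odd
  positions, velocities in the even ones. \<open>ip\<close> is the sum of their real L2 products
  with weights \<open>wt\<close>.\<close>

definition eg :: "state \<Rightarrow> nat \<Rightarrow> real \<Rightarrow> complex" where
  "eg U i = (if i = 1 then (\<lambda>x. wd L (U 1) x + U 3 x + l * U 5 x) else if i = 2 then U 2
     else if i = 3 then wd L (U 3) else if i = 4 then U 4
     else if i = 5 then (\<lambda>x. wd L (U 5) x - l * U 1 x) else U 6)"

definition ip :: "state \<Rightarrow> state \<Rightarrow> real" where
  "ip U V = (\<Sum>i\<in>{1..6}. wt i * l2ip L (eg U i) (eg V i))"

lemma wt_pos: "0 < wt i"
  using pos by (simp add: wt_def)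

lemma six: "{1..6::nat} = {1,2,3,4,5,6}" by auto

lemma H_wd:
  assumes "U \<in> H" "i \<in> {1,3,5}"
  shows "has_wderiv L (U i) (wd L (U i))" "U i 0 = 0" "U i L = 0"
  using assms by (auto simp: H_def inH_def H10_def H1_def intro: wderiv_wd)

lemma H_L2_even: "U \<in> H \<Longrightarrow> i \<in> {2,4,6} \<Longrightarrow> L2 L (U i)"
  by (auto simp: H_def inH_def)

lemma H_L2: assumes "U \<in> H" "i \<in> {1,3,5}" shows "L2 L (U i)" "L2 L (wd L (U i))"
  using L2_continuous[OF wderiv_continuous[OF H_wd(1)[OF assms]]] wderiv_L2[OF H_wd(1)[OF assms]] by auto

lemma eg_L2: "U \<in> H \<Longrightarrow> L2 L (eg U i)"
  using H_L2[of U 1] H_L2[of U 3] H_L2[of U 5] H_L2_even[of U 2] H_L2_even[of U 4] H_L2_even[of U 6]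
  unfolding eg_def by (auto intro!: L2_intros)

lemma HI:
  assumes "\<And>i. i \<in> {1,3,5} \<Longrightarrow> has_wderiv L (U i) (p i) \<and> U i 0 = 0 \<and> U i L = 0"
    and "\<And>i. i \<in> {2,4,6} \<Longrightarrow> L2 L (U i)"
  shows "U \<in> H"
  using assms(1)[of 1] assms(1)[of 3] assms(1)[of 5] assms(2)[of 2] assms(2)[of 4] assms(2)[of 6]
  unfolding H_def inH_def H10_def H1_def by auto

lemma eg_AE:
  assumes "\<And>i. i \<in> {1,3,5} \<Longrightarrow> has_wderiv L (U i) (p i)"
  shows "ae (\<lambda>x. eg U 1 x = p 1 x + U 3 x + l * U 5 x)" "ae (\<lambda>x. eg U 3 x = p 3 x)"
    "ae (\<lambda>x. eg U 5 x = p 5 x - l * U 1 x)"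
  using wd_AE[OF assms pos(7), of 1] wd_AE[OF assms pos(7), of 3] wd_AE[OF assms pos(7), of 5]
  by (auto simp: eg_def elim: eventually_mono)

lemma eg_even: "eg U 2 = U 2" "eg U 4 = U 4" "eg U 6 = U 6"
  by (auto simp: eg_def)

lemma H_zero: "0 \<in> H"
  by (rule HI[where p="\<lambda>i x. 0"]) (auto intro!: wderivI L2_continuous simp: func_zero)

lemma H_add: assumes "U \<in> H" "V \<in> H" shows "U + V \<in> H"
proof (rule HI[where p="\<lambda>i x. wd L (U i) x + wd L (V i) x"])
  fix i :: nat assume i: "i \<in> {1,3,5}"
  show "has_wderiv L ((U + V) i) (\<lambda>x. wd L (U i) x + wd L (V i) x) \<and> (U + V) i 0 = 0 \<and> (U + V) i L = 0"
    using wderiv_add[OF H_wd(1)[OF assms(1) i] H_wd(1)[OF assms(2) i]] H_wd(2,3)[OF assms(1) i] H_wd(2,3)[OF assms(2) i]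
    by (simp add: func_plus)
next
  fix i :: nat assume i: "i \<in> {2,4,6}"
  show "L2 L ((U + V) i)" using L2_add[OF H_L2_even[OF assms(1) i] H_L2_even[OF assms(2) i]] by (simp add: func_plus)
qed

lemma H_scale: assumes "U \<in> H" shows "sscale c U \<in> H"
proof (rule HI[where p="\<lambda>i x. c * wd L (U i) x"])
  fix i :: nat assume i: "i \<in> {1,3,5}"
  show "has_wderiv L (sscale c U i) (\<lambda>x. c * wd L (U i) x) \<and> sscale c U i 0 = 0 \<and> sscale c U i L = 0"
    using wderiv_cmult[OF H_wd(1)[OF assms i]] H_wd(2,3)[OF assms i] by (simp add: sscale_def)
next
  fix i :: nat assume i: "i \<in> {2,4,6}"
  show "L2 L (sscale c U i)" using L2_cmult[OF H_L2_even[OF assms i]] by (simp add: sscale_def)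
qed

lemma eg_add: assumes "U \<in> H" "V \<in> H" shows "ae (\<lambda>x. eg (U + V) i x = eg U i x + eg V i x)"
proof -
  have *: "ae (\<lambda>x. wd L ((U + V) j) x = wd L (U j) x + wd L (V j) x)" if j: "j \<in> {1,3,5}" for j
    using wd_AE[OF wderiv_add[OF H_wd(1)[OF assms(1) j] H_wd(1)[OF assms(2) j]] pos(7)] by (simp add: func_plus)
  show ?thesis
    using *[of 1] *[of 3] *[of 5] unfolding eg_def by (auto elim!: eventually_mono simp: algebra_simps)
qed

lemma eg_scale: assumes "U \<in> H" shows "ae (\<lambda>x. eg (sscale c U) i x = c * eg U i x)"
proof -
  have *: "ae (\<lambda>x. wd L (sscale c U j) x = c * wd L (U j) x)" if j: "j \<in> {1,3,5}" for j
    using wd_AE[OF wderiv_cmult[OF H_wd(1)[OF assms j]] pos(7)] by (simp add: sscale_def)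
  show ?thesis
    using *[of 1] *[of 3] *[of 5] unfolding eg_def by (auto elim!: eventually_mono simp: algebra_simps sscale_def)
qed

lemma ip_sym: "ip U V = ip V U"
  unfolding ip_def by (subst l2ip_sym) simp

lemma ip_nonneg: "U \<in> H \<Longrightarrow> 0 \<le> ip U U"
  unfolding ip_def using wt_pos by (intro sum_nonneg mult_nonneg_nonneg l2ip_nonneg eg_L2) (auto intro: less_imp_le)

sublocale seminorm_space H sscale ip
proof
  show "0 \<in> H" by (rule H_zero)
  fix U V W :: state and c d :: complex and r :: real
  show "sscale (c + d) U = sscale c U + sscale d U" "sscale c (U + V) = sscale c U + sscale c V"
    "sscale c (sscale d U) = sscale (c * d) U" "sscale 1 U = U"
    by (auto simp: sscale_def fun_eq_iff algebra_simps)
  assume U: "U \<in> H"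
  show "sscale c U \<in> H" by (rule H_scale[OF U])
  show "0 \<le> ip U U" by (rule ip_nonneg[OF U])
  assume V: "V \<in> H"
  show "U + V \<in> H" by (rule H_add[OF U V])
  show "ip U V = ip V U" by (rule ip_sym)
  have "l2ip L (eg (sscale (of_real r) U) i) (eg V i) = r * l2ip L (eg U i) (eg V i)" for i
    using l2ip_cong_AE[OF eg_scale[OF U], of "eg V i" "eg V i" "of_real r" i] by (simp add: l2ip_scale_left)
  then show "ip (sscale (of_real r) U) V = r * ip U V"
    by (simp add: ip_def sum_distrib_left mult.left_commute)
  have "l2ip L (eg (sscale \<i> U) i) (eg (sscale \<i> V) i) = l2ip L (eg U i) (eg V i)" for i
    using l2ip_cong_AE[OF eg_scale[OF U] eg_scale[OF V], of \<i> i \<i> i] by (simp add: l2ip_i)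
  then show "ip (sscale \<i> U) (sscale \<i> V) = ip U V" by (simp add: ip_def)
  assume W: "W \<in> H"
  have "l2ip L (eg (U + V) i) (eg W i) = l2ip L (eg U i) (eg W i) + l2ip L (eg V i) (eg W i)" for i
    using l2ip_cong_AE[OF eg_add[OF U V], of "eg W i" "eg W i" i] by (simp add: l2ip_add_left eg_L2 U V W)
  then show "ip (U + V) W = ip U W + ip V W"
    by (simp add: ip_def sum.distrib distrib_left)
qed

lemma normH_eq: assumes "U \<in> H" shows "normH P U = nrm U"
proof -
  have i: "(\<lambda>x. wt i * (cmod (eg U i x))\<^sup>2) integrable_on {0..L}" for i
    using integrable_on_cmult_left[OF L2_sq[OF eg_L2[OF assms]], of "wt i"] by simp
  have "ip U U = (\<Sum>i\<in>{1..6}. integral {0..L} (\<lambda>x. wt i * (cmod (eg U i x))\<^sup>2))"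
    by (simp add: ip_def l2ip_self)
  also have "\<dots> = integral {0..L} (\<lambda>x. \<Sum>i\<in>{1..6}. wt i * (cmod (eg U i x))\<^sup>2)"
    by (rule integral_sum[symmetric]) (auto intro: i)
  also have "(\<lambda>x. \<Sum>i\<in>{1..6}. wt i * (cmod (eg U i x))\<^sup>2) = (\<lambda>x.
      kk1 P * (cmod (wd L (U 1) x + U 3 x + l * U 5 x))\<^sup>2
    + rho1 P * (cmod (U 2 x))\<^sup>2
    + kk2 P * (cmod (wd L (U 3) x))\<^sup>2
    + rho2 P * (cmod (U 4 x))\<^sup>2
    + kk3 P * (cmod (wd L (U 5) x - l * U 1 x))\<^sup>2
    + rho1 P * (cmod (U 6 x))\<^sup>2)"
    unfolding six by (simp add: fun_eq_iff eg_def wt_def)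
  finally show ?thesis by (simp add: normH_def nrm_def)
qed

section \<open>Comparison of the energy norm with the components and their derivatives\<close>

definition wmin :: real where "wmin = Min (wt ` {1..6})"

lemma wmin: "0 < wmin" "i \<in> {1..6} \<Longrightarrow> wmin \<le> wt i"
  unfolding wmin_def using wt_pos by (auto intro!: Min_le)

lemma l2_eg_le: assumes "U \<in> H" "i \<in> {1..6}" shows "l2ip L (eg U i) (eg U i) \<le> (nrm U)\<^sup>2 / wmin"
proof -
  have nn: "0 \<le> l2ip L (eg U j) (eg U j)" for j by (intro l2ip_nonneg eg_L2 assms)
  have "wmin * l2ip L (eg U i) (eg U i) \<le> wt i * l2ip L (eg U i) (eg U i)"
    by (intro mult_right_mono wmin nn assms)
  also have "\<dots> \<le> ip U U" unfolding ip_def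
    using assms(2) by (intro member_le_sum[of i]) (auto intro!: mult_nonneg_nonneg nn less_imp_le[OF wt_pos])
  finally show ?thesis using wmin(1) by (simp add: nrm_sq[OF assms(1)] field_simps)
qed

lemma integral_cmod_le:
  assumes "L2 L f" "l2ip L f f \<le> m\<^sup>2" "0 \<le> m" "x \<in> {0..L}"
  shows "integral {0..x} (\<lambda>s. cmod (f s)) \<le> sqrt L * m"
proof -
  have "integral {0..x} (\<lambda>s. cmod (f s)) \<le> integral {0..L} (\<lambda>s. cmod (f s))"
    using assms(4) by (intro integral_subset_le L2_norm_integrable[OF assms(1)]) auto
  also have "\<dots> \<le> sqrt L * m"
  proof (rule power2_le_imp_le)
    have "(integral {0..L} (\<lambda>s. cmod (f s)))\<^sup>2 \<le> (L - 0) * l2ip L f f"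
      unfolding l2ip_self using L0 by (intro L2_cauchy_schwarz[OF assms(1)]) auto
    also have "\<dots> \<le> L * m\<^sup>2" using assms(2) L0 by (simp add: mult_left_mono)
    finally show "(integral {0..L} (\<lambda>s. cmod (f s)))\<^sup>2 \<le> (sqrt L * m)\<^sup>2" using L0 by (simp add: power_mult_distrib)
  qed (use assms L0 in auto)
  finally show ?thesis .
qed

text \<open>The constant of \<open>coercive\<close>: the first summand is the Gronwall bound for |U
  1| + |U 5|, in which 2 counts the two strains and L comes from integrating the bound for U 3; the
  second bounds U 3 itself.\<close>

definition CC :: real where "CC = (2 + L) * sqrt L / sqrt wmin * exp (ll P * L) + sqrt L / sqrt wmin"

text \<open>The strains couple components 1 and 5 by a rotation at rate l, so Gronwall is applied to the sum of
  their moduli.\<close>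

lemma coercive:
  assumes U: "U \<in> H" and x: "x \<in> {0..L}"
  shows "cmod (U 3 x) \<le> CC * nrm U" "cmod (U 1 x) \<le> CC * nrm U" "cmod (U 5 x) \<le> CC * nrm U"
proof -
  define m where "m = nrm U / sqrt wmin"
  have m0: "0 \<le> m" using nrm_nonneg[OF U] wmin(1) by (simp add: m_def)
  have eg_le: "l2ip L (eg U i) (eg U i) \<le> m\<^sup>2" if "i \<in> {1..6}" for i
    using l2_eg_le[OF U that] wmin(1) by (simp add: m_def power_divide)
  have int: "integral {0..x} (\<lambda>s. cmod (eg U i s)) \<le> sqrt L * m" if "i \<in> {1..6}" "x \<in> {0..L}" for i x
    by (rule integral_cmod_le[OF eg_L2[OF U] eg_le[OF that(1)] m0 that(2)])
  \<comment> \<open>The third component is controlled by its own strain alone, so it enters the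
    coupled pair as given data.\<close>
  have U3: "cmod (U 3 x) \<le> sqrt L * m" if x: "x \<in> {0..L}" for x
  proof -
    have "cmod (U 3 x - U 3 0) \<le> integral {0..x} (\<lambda>s. cmod (wd L (U 3) s))"
      by (rule wderiv_dist_le[OF H_wd(1)[OF U]]) (use x in auto)
    then show ?thesis using int[of 3 x] H_wd(2)[OF U, of 3] x by (simp add: eg_def)
  qed
  define u where "u x = cmod (U 1 x) + cmod (U 5 x)" for x
  have cont: "continuous_on {0..L} (U i)" if "i \<in> {1,3,5}" for i
    by (rule wderiv_continuous[OF H_wd(1)[OF U that]])
  have cu: "continuous_on {0..L} u" unfolding u_def by (intro continuous_intros cont) auto
  have "u x \<le> ((2 + L) * (sqrt L * m)) * exp (ll P * x)" if "x \<in> {0..L}" for x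
  proof (rule gronwall[OF cu _ _ that])
    fix x assume x: "x \<in> {0..L}"
    have i: "(\<lambda>s. cmod (eg U j s)) integrable_on {0..x}" for j
      using x by (intro L2_norm_integrable[OF eg_L2[OF U]]) auto
    have iw: "(\<lambda>s. cmod (wd L (U j) s)) integrable_on {0..x}" if "j \<in> {1,3,5}" for j
      using x by (intro L2_norm_integrable[OF H_L2(2)[OF U that]]) auto
    have iu: "(\<lambda>s. ll P * u s) integrable_on {0..x}"
      by (intro integrable_continuous_real continuous_intros continuous_on_subset[OF cu]) (use x in auto)
    have e: "wd L (U 1) s = eg U 1 s - U 3 s - l * U 5 s" "wd L (U 5) s = eg U 5 s + l * U 1 s" for s
      by (simp_all add: eg_def)
    have "u x \<le> integral {0..x} (\<lambda>s. cmod (wd L (U 1) s)) + integral {0..x} (\<lambda>s. cmod (wd L (U 5) s))"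
      using wderiv_dist_le[OF H_wd(1)[OF U, of 1], of 0 x] wderiv_dist_le[OF H_wd(1)[OF U, of 5], of 0 x]
        H_wd(2)[OF U, of 1] H_wd(2)[OF U, of 5] x by (simp add: u_def)
    also have "\<dots> = integral {0..x} (\<lambda>s. cmod (wd L (U 1) s) + cmod (wd L (U 5) s))"
      by (rule integral_add[symmetric]) (auto intro: iw)
    also have "\<dots> \<le> integral {0..x} (\<lambda>s. (cmod (eg U 1 s) + cmod (eg U 5 s) + sqrt L * m) + ll P * u s)"
    proof (rule integral_le)
      fix s assume s: "s \<in> {0..x}"
      have "cmod (wd L (U 1) s) \<le> cmod (eg U 1 s) + cmod (U 3 s) + cmod (l * U 5 s)"
        unfolding e by (intro order_trans[OF norm_triangle_ineq4] add_right_mono norm_triangle_ineq4)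
      moreover have "cmod (wd L (U 5) s) \<le> cmod (eg U 5 s) + cmod (l * U 1 s)"
        unfolding e by (rule norm_triangle_ineq)
      moreover have "cmod (l * U 5 s) + cmod (l * U 1 s) = ll P * u s"
        using pos by (simp add: norm_mult u_def algebra_simps)
      ultimately show "cmod (wd L (U 1) s) + cmod (wd L (U 5) s) \<le> (cmod (eg U 1 s) + cmod (eg U 5 s) + sqrt L * m) + ll P * u s"
        using U3[of s] s x by auto
    qed (auto intro!: integrable_add iw i iu)
    also have "\<dots> = integral {0..x} (\<lambda>s. cmod (eg U 1 s)) + integral {0..x} (\<lambda>s. cmod (eg U 5 s)) + x * (sqrt L * m) + ll P * integral {0..x} u"
    proof -
      have "integral {0..x} (\<lambda>s. (cmod (eg U 1 s) + cmod (eg U 5 s) + sqrt L * m) + ll P * u s)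
        = integral {0..x} (\<lambda>s. cmod (eg U 1 s) + cmod (eg U 5 s) + sqrt L * m) + integral {0..x} (\<lambda>s. ll P * u s)"
        by (intro integral_add integrable_add i iu) auto
      also have "integral {0..x} (\<lambda>s. cmod (eg U 1 s) + cmod (eg U 5 s) + sqrt L * m)
        = integral {0..x} (\<lambda>s. cmod (eg U 1 s) + cmod (eg U 5 s)) + integral {0..x} (\<lambda>s. sqrt L * m)"
        by (intro integral_add integrable_add i) auto
      also have "integral {0..x} (\<lambda>s. cmod (eg U 1 s) + cmod (eg U 5 s))
        = integral {0..x} (\<lambda>s. cmod (eg U 1 s)) + integral {0..x} (\<lambda>s. cmod (eg U 5 s))"
        by (intro integral_add i)
      finally show ?thesis using x by simp
    qed
    also have "\<dots> \<le> sqrt L * m + sqrt L * m + L * (sqrt L * m) + ll P * integral {0..x} u"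
    proof -
      have "x * (sqrt L * m) \<le> L * (sqrt L * m)" using x m0 by (intro mult_right_mono) auto
      moreover have "integral {0..x} (\<lambda>s. cmod (eg U 1 s)) \<le> sqrt L * m" by (rule int) (use x in auto)
      moreover have "integral {0..x} (\<lambda>s. cmod (eg U 5 s)) \<le> sqrt L * m" by (rule int) (use x in auto)
      ultimately show ?thesis by linarith
    qed
    finally show "u x \<le> (2 + L) * (sqrt L * m) + ll P * integral {0..x} u" by (simp add: algebra_simps)
  qed (use pos in auto)
  then have "u x \<le> ((2 + L) * (sqrt L * m)) * exp (ll P * x)" using x by blast
  also have "\<dots> \<le> ((2 + L) * (sqrt L * m)) * exp (ll P * L)"
    using x m0 L0 pos by (intro mult_left_mono) auto
  finally have u: "u x \<le> ((2 + L) * (sqrt L * m)) * exp (ll P * L)" .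
  have CC: "CC * nrm U = ((2 + L) * (sqrt L * m)) * exp (ll P * L) + sqrt L * m"
    by (simp add: CC_def m_def algebra_simps)
  have "0 \<le> sqrt L * m" "0 \<le> ((2 + L) * (sqrt L * m)) * exp (ll P * L)" using m0 L0 by auto
  then show "cmod (U 3 x) \<le> CC * nrm U" "cmod (U 1 x) \<le> CC * nrm U" "cmod (U 5 x) \<le> CC * nrm U"
    using u U3[OF x] norm_ge_zero[of "U 1 x"] norm_ge_zero[of "U 5 x"] unfolding CC u_def by linarith+
qed

lemma null_imp_zero:
  assumes "U \<in> H" "nrm U = 0"
  shows "i \<in> {1,3,5} \<Longrightarrow> x \<in> {0..L} \<Longrightarrow> U i x = 0" "i \<in> {2,4,6} \<Longrightarrow> ae (\<lambda>x. U i x = 0)"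
proof -
  assume "i \<in> {1,3,5}" "x \<in> {0..L}"
  then show "U i x = 0" using coercive[OF assms(1), of x] assms(2) by auto
next
  assume i: "i \<in> {2,4,6}"
  then have "l2ip L (eg U i) (eg U i) \<le> 0" using l2_eg_le[OF assms(1), of i] assms(2) by auto
  then have "ae (\<lambda>x. eg U i x = 0)" using l2ip_eq_0[OF eg_L2] l2ip_nonneg[OF eg_L2] assms(1) by (meson antisym)
  then show "ae (\<lambda>x. U i x = 0)" using i by (auto simp: eg_def)
qed

lemma poincare:
  assumes "has_wderiv L u p" "u 0 = 0" shows "l2ip L u u \<le> L\<^sup>2 * l2ip L p p"
proof -
  have nn: "0 \<le> l2ip L p p" by (intro l2ip_nonneg wderiv_L2[OF assms(1)])
  have "l2ip L u u \<le> L * (sqrt (L * l2ip L p p))\<^sup>2"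
  proof (rule l2ip_le_sup[OF L2_continuous[OF wderiv_continuous[OF assms(1)]] _ L0])
    fix x assume x: "x \<in> {0..L}"
    have "(cmod (u x - u 0))\<^sup>2 \<le> \<bar>x - 0\<bar> * l2ip L p p" by (rule wderiv_holder[OF assms(1)]) (use x L0 in auto)
    also have "\<dots> \<le> L * l2ip L p p" using x nn by (intro mult_right_mono) auto
    finally show "cmod (u x) \<le> sqrt (L * l2ip L p p)" using assms(2) by (simp add: real_le_rsqrt)
  qed
  then show ?thesis using nn L0 by (simp add: power2_eq_square mult.assoc)
qed

definition wsum :: real where "wsum = (\<Sum>i\<in>{1..6}. wt i)"

text \<open>Two applications of the squared triangle inequality and the Poincare bound cost 2 + 4
  L^2 + 4 l^2 L^2 for the first strain, rounded up here; the other quantities need less.\<close>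

definition CU :: real where "CU = wsum * (4 + 4 * L\<^sup>2 + 4 * (ll P)\<^sup>2 * L\<^sup>2)"

lemma wsum: "0 < wsum" "i \<in> {1..6} \<Longrightarrow> wt i \<le> wsum"
proof -
  show "0 < wsum" unfolding wsum_def using wt_pos by (intro sum_pos) auto
  show "i \<in> {1..6} \<Longrightarrow> wt i \<le> wsum"
    unfolding wsum_def by (rule member_le_sum) (auto intro: less_imp_le[OF wt_pos])
qed

lemma CU_pos: "0 < CU"
  unfolding CU_def using wsum(1) by (intro mult_pos_pos add_pos_nonneg) auto

text \<open>The direction opposite to \<open>coercive\<close>: bounds in L2 on slopes and velocities
  return to the energy norm. Density and compactness are transferred to \<open>nrm\<close> in this
  way.\<close>

lemma energy_le:
  assumes U: "U \<in> H" and p: "\<And>i. i \<in> {1,3,5} \<Longrightarrow> has_wderiv L (U i) (p i)"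
    and M: "\<And>i. i \<in> {1,3,5} \<Longrightarrow> l2ip L (p i) (p i) \<le> M" "\<And>i. i \<in> {2,4,6} \<Longrightarrow> l2ip L (U i) (U i) \<le> M"
  shows "(nrm U)\<^sup>2 \<le> 6 * CU * M"
proof -
  have p2: "L2 L (p i)" if "i \<in> {1,3,5}" for i by (rule wderiv_L2[OF p[OF that]])
  have M0: "0 \<le> M" using l2ip_nonneg[OF p2[of 1]] M(1)[of 1] by simp
  have Ui: "l2ip L (U i) (U i) \<le> L\<^sup>2 * M" if "i \<in> {1,3,5}" for i
    using poincare[OF p[OF that] H_wd(2)[OF U that]] mult_left_mono[OF M(1)[OF that], of "L\<^sup>2"] by simp
  have sc: "l2ip L (\<lambda>x. l * f x) (\<lambda>x. l * f x) = (ll P)\<^sup>2 * l2ip L f f" for f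
    by (simp add: l2ip_scale_left l2ip_scale_right power2_eq_square)
  let ?c = "4 + 4 * L\<^sup>2 + 4 * (ll P)\<^sup>2 * L\<^sup>2"
  have lL: "l2ip L (\<lambda>x. l * U i x) (\<lambda>x. l * U i x) \<le> (ll P)\<^sup>2 * (L\<^sup>2 * M)" if "i \<in> {1,3,5}" for i
    unfolding sc using Ui[OF that] by (intro mult_left_mono) auto
  have "l2ip L (eg U i) (eg U i) \<le> ?c * M" if "i \<in> {1..6}" for i
  proof -
    have c: "1 \<le> ?c" by simp
    have cM: "M \<le> ?c * M" using mult_right_mono[OF c M0] by simp
    have "l2ip L (eg U 1) (eg U 1) = l2ip L (\<lambda>x. p 1 x + (U 3 x + l * U 5 x)) (\<lambda>x. p 1 x + (U 3 x + l * U 5 x))"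
      by (rule l2ip_cong_AE; use eg_AE(1)[of U p, OF p] in \<open>auto simp: add.assoc elim: eventually_mono\<close>)
    also have "\<dots> \<le> 2 * l2ip L (p 1) (p 1) + 2 * l2ip L (\<lambda>x. U 3 x + l * U 5 x) (\<lambda>x. U 3 x + l * U 5 x)"
      by (rule l2ip_triangle) (auto intro!: L2_intros p2 H_L2[OF U])
    also have "\<dots> \<le> 2 * M + 2 * (2 * (L\<^sup>2 * M) + 2 * ((ll P)\<^sup>2 * (L\<^sup>2 * M)))"
      using M(1)[of 1] l2ip_triangle[of L "U 3" "\<lambda>x. l * U 5 x"] H_L2(1)[OF U, of 3] H_L2(1)[OF U, of 5] Ui[of 3] lL[of 5]
      by (simp add: L2_intros)
    also have "\<dots> \<le> ?c * M" using M0 by (simp add: algebra_simps)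
    finally have e1: "l2ip L (eg U 1) (eg U 1) \<le> ?c * M" .
    have "l2ip L (eg U 5) (eg U 5) = l2ip L (\<lambda>x. p 5 x + (- l) * U 1 x) (\<lambda>x. p 5 x + (- l) * U 1 x)"
      by (rule l2ip_cong_AE; use eg_AE(3)[of U p, OF p] in \<open>auto elim: eventually_mono\<close>)
    also have "\<dots> \<le> 2 * l2ip L (p 5) (p 5) + 2 * l2ip L (\<lambda>x. (- l) * U 1 x) (\<lambda>x. (- l) * U 1 x)"
      by (rule l2ip_triangle) (auto intro!: L2_intros p2 H_L2[OF U])
    also have "l2ip L (\<lambda>x. (- l) * U 1 x) (\<lambda>x. (- l) * U 1 x) = l2ip L (\<lambda>x. l * U 1 x) (\<lambda>x. l * U 1 x)"
      unfolding l2ip_def by simp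
    also have "2 * l2ip L (p 5) (p 5) + 2 * \<dots> \<le> 2 * M + 2 * ((ll P)\<^sup>2 * (L\<^sup>2 * M))"
      using M(1)[of 5] lL[of 1] by simp
    also have "\<dots> \<le> ?c * M" using M0 by (simp add: algebra_simps)
    finally have e5: "l2ip L (eg U 5) (eg U 5) \<le> ?c * M" .
    have "l2ip L (eg U 3) (eg U 3) = l2ip L (p 3) (p 3)"
      by (rule l2ip_cong_AE; rule eg_AE(2)[of U p, OF p])
    then have e3: "l2ip L (eg U 3) (eg U 3) \<le> ?c * M" using M(1)[of 3] cM by simp
    have e246: "l2ip L (eg U i) (eg U i) \<le> ?c * M" if "i \<in> {2,4,6}" for i
      using M(2)[OF that] cM that by (auto simp: eg_even)
    have "i = 1 \<or> i = 3 \<or> i = 5 \<or> i \<in> {2,4,6}" using that by auto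
    with e1 e3 e5 e246 show ?thesis by auto
  qed
  then have "(nrm U)\<^sup>2 \<le> (\<Sum>i\<in>{1..6::nat}. wsum * (?c * M))"
    unfolding nrm_sq[OF U] ip_def using M0 wsum wt_pos by (intro sum_mono mult_mono l2ip_nonneg eg_L2 U) (auto intro: less_imp_le)
  also have "\<dots> = 6 * CU * M" by (simp add: CU_def)
  finally show ?thesis .
qed

end

section \<open>The operator\<close>

context bresse
begin

abbreviation "r1 \<equiv> complex_of_real (rho1 P)"
abbreviation "r2 \<equiv> complex_of_real (rho2 P)"
abbreviation "c1 \<equiv> complex_of_real (kk1 P)"
abbreviation "c2 \<equiv> complex_of_real (kk2 P)"
abbreviation "c3 \<equiv> complex_of_real (kk3 P)"
abbreviation "a x \<equiv> complex_of_real (damp P x)"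

text \<open>The domain together with witnesses p and q for first and second derivatives. Unlike the
  chosen \<open>wd\<close>, the witness p is continuous at odd indices, so slopes such as
  \<open>p 1 0\<close> have a meaning.\<close>

definition DA :: "state \<Rightarrow> (nat \<Rightarrow> real \<Rightarrow> complex) \<Rightarrow> (nat \<Rightarrow> real \<Rightarrow> complex) \<Rightarrow> bool" where
  "DA W p q \<longleftrightarrow> (\<forall>i\<in>{1..6}. has_wderiv L (W i) (p i) \<and> W i 0 = 0 \<and> W i L = 0) \<and>
     (\<forall>i\<in>{1,3,5}. has_wderiv L (p i) (q i))"

lemma inDA_iff: "inDA P W \<longleftrightarrow> (\<exists>p q. DA W p q)"
proof
  assume D: "inDA P W"
  have odd: "\<exists>g h. has_wderiv L (W i) g \<and> has_wderiv L g h \<and> W i 0 = 0 \<and> W i L = 0" if "i \<in> {1,3,5}" for i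
    using D that by (auto simp: inDA_def H2_def H10_def)
  have even: "\<exists>g. has_wderiv L (W i) g \<and> W i 0 = 0 \<and> W i L = 0" if "i \<in> {2,4,6}" for i
    using D that by (auto simp: inDA_def H1_def H10_def)
  have "\<exists>g h. has_wderiv L (W i) g \<and> (i \<in> {1,3,5} \<longrightarrow> has_wderiv L g h) \<and> W i 0 = 0 \<and> W i L = 0" if "i \<in> {1..6}" for i
  proof -
    from that have "i \<in> {1,3,5} \<or> i \<in> {2,4,6}" by (simp, arith)
    then show ?thesis
    proof
      assume "i \<in> {2,4,6}"
      then show ?thesis using even[of i] by auto
    qed (use odd[of i] in blast)
  qed
  then obtain p q where pq: "\<And>i. i \<in> {1..6} \<Longrightarrow> has_wderiv L (W i) (p i) \<and> (i \<in> {1,3,5} \<longrightarrow> has_wderiv L (p i) (q i)) \<and> W i 0 = 0 \<and> W i L = 0"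
    by metis
  have "has_wderiv L (p i) (q i)" if i: "i \<in> {1,3,5}" for i
  proof -
    have "i \<in> {1..6}" using i by auto
    with pq i show ?thesis by blast
  qed
  with pq have "DA W p q" unfolding DA_def by blast
  then show "\<exists>p q. DA W p q" by blast
next
  assume "\<exists>p q. DA W p q"
  then obtain p q where D: "DA W p q" by blast
  have w: "has_wderiv L (W i) (p i)" "W i 0 = 0" "W i L = 0" if "i \<in> {1..6}" for i using D that by (auto simp: DA_def)
  have w2: "has_wderiv L (p i) (q i)" if "i \<in> {1,3,5}" for i using D that by (auto simp: DA_def)
  have "H2 L (W i) \<and> H10 L (W i)" if i: "i \<in> {1,3,5}" for i
  proof -
    have "i \<in> {1..6}" using i by auto
    from w[OF this] w2[OF i] show ?thesis unfolding H2_def H10_def H1_def by blast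
  qed
  moreover have "H10 L (W i)" if i: "i \<in> {2,4,6}" for i
  proof -
    have "i \<in> {1..6}" using i by auto
    from w[OF this] show ?thesis unfolding H10_def H1_def by blast
  qed
  ultimately show "inDA P W" unfolding inDA_def by simp
qed

lemma DA_wderiv:
  assumes "DA W p q"
  shows "i \<in> {1..6} \<Longrightarrow> has_wderiv L (W i) (p i)" "i \<in> {1..6} \<Longrightarrow> W i 0 = 0" "i \<in> {1..6} \<Longrightarrow> W i L = 0"
    "i \<in> {1,3,5} \<Longrightarrow> has_wderiv L (p i) (q i)"
  using assms by (auto simp: DA_def)

lemma DA_L2:
  assumes "DA W p q"
  shows "i \<in> {1..6} \<Longrightarrow> L2 L (W i)" "i \<in> {1..6} \<Longrightarrow> L2 L (p i)" "i \<in> {1,3,5} \<Longrightarrow> L2 L (q i)"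
  using L2_continuous[OF wderiv_continuous[OF DA_wderiv(1)[OF assms]]] wderiv_L2[OF DA_wderiv(1)[OF assms]]
    wderiv_L2[OF DA_wderiv(4)[OF assms]] by auto

lemma DA_H: "DA W p q \<Longrightarrow> W \<in> H"
  by (rule HI[where p=p]) (auto simp: DA_wderiv intro: DA_L2)

lemma opA_odd: "opA P W 1 = W 2" "opA P W 3 = W 4" "opA P W 5 = W 6"
  by (auto simp: opA_def fun_eq_iff)

lemma opA_AE:
  assumes "DA W p q"
  shows "ae (\<lambda>x. opA P W 2 x = c1 / r1 * (q 1 x + p 3 x + l * p 5 x) + l * c3 / r1 * (p 5 x - l * W 1 x))"
    "ae (\<lambda>x. opA P W 4 x = c2 / r2 * q 3 x - c1 / r2 * (p 1 x + W 3 x + l * W 5 x))"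
    "ae (\<lambda>x. opA P W 6 x = c3 / r1 * (q 5 x - l * p 1 x) - l * c1 / r1 * (p 1 x + W 3 x + l * W 5 x) - a x / r1 * W 6 x)"
proof -
  have w: "ae (\<lambda>x. wd L (W i) x = p i x)" "ae (\<lambda>x. wd2 L (W i) x = q i x)" if "i \<in> {1,3,5}" for i
  proof -
    have "i \<in> {1..6}" using that by auto
    note w = DA_wderiv(1)[OF assms this]
    show "ae (\<lambda>x. wd L (W i) x = p i x)" by (rule wd_AE[OF w pos(7)])
    show "ae (\<lambda>x. wd2 L (W i) x = q i x)" by (rule wd2_AE[OF w DA_wderiv(4)[OF assms that] pos(7)])
  qed
  have "ae (\<lambda>x. wd L (W 1) x = p 1 x \<and> wd L (W 3) x = p 3 x \<and> wd L (W 5) x = p 5 x \<and>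
      wd2 L (W 1) x = q 1 x \<and> wd2 L (W 3) x = q 3 x \<and> wd2 L (W 5) x = q 5 x)"
    using w(1)[of 1] w(1)[of 3] w(1)[of 5] w(2)[of 1] w(2)[of 3] w(2)[of 5] by (simp add: eventually_conj_iff)
  then show "ae (\<lambda>x. opA P W 2 x = c1 / r1 * (q 1 x + p 3 x + l * p 5 x) + l * c3 / r1 * (p 5 x - l * W 1 x))"
    "ae (\<lambda>x. opA P W 4 x = c2 / r2 * q 3 x - c1 / r2 * (p 1 x + W 3 x + l * W 5 x))"
    "ae (\<lambda>x. opA P W 6 x = c3 / r1 * (q 5 x - l * p 1 x) - l * c1 / r1 * (p 1 x + W 3 x + l * W 5 x) - a x / r1 * W 6 x)"
    by (rule eventually_mono, auto simp: opA_def Let_def)+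
qed

lemma damp_L2: "L2 L f \<Longrightarrow> L2 L (\<lambda>x. a x * f x)"
  by (rule L2_mult_bounded[where C=Ka])
    (auto intro!: damp_bound measurable_compose[OF damp_measurable])

lemma opA_wderiv:
  assumes "DA W p q" "i \<in> {1,3,5}"
  shows "has_wderiv L (opA P W i) (if i = 1 then p 2 else if i = 3 then p 4 else p 6)" "opA P W i 0 = 0" "opA P W i L = 0"
  using assms(2) DA_wderiv[OF assms(1), of 2] DA_wderiv[OF assms(1), of 4] DA_wderiv[OF assms(1), of 6] opA_odd[of W]
  by (auto simp del: One_nat_def)

lemma opA_H: assumes "DA W p q" shows "opA P W \<in> H"
proof (rule HI[where p="\<lambda>i. if i = 1 then p 2 else if i = 3 then p 4 else p 6"])
  fix i :: nat assume "i \<in> {1,3,5}"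
  then show "has_wderiv L (opA P W i) (if i = 1 then p 2 else if i = 3 then p 4 else p 6) \<and> opA P W i 0 = 0 \<and> opA P W i L = 0"
    using opA_wderiv[OF assms] by blast
next
  note L2s = DA_L2(1)[OF assms] DA_L2(2)[OF assms] DA_L2(3)[OF assms]
  have sw: "ae (\<lambda>x. g x = f x)" if "ae (\<lambda>x. f x = g x)" for f g :: "real \<Rightarrow> complex"
    using that by (auto elim: eventually_mono)
  have "L2 L (\<lambda>x. c1 / r1 * (q 1 x + p 3 x + l * p 5 x) + l * c3 / r1 * (p 5 x - l * W 1 x))"
    by (intro L2_add L2_diff L2_cmult L2s) auto
  from L2_cong_AE[OF this sw[OF opA_AE(1)[OF assms]]] have 2: "L2 L (opA P W 2)" .
  have "L2 L (\<lambda>x. c2 / r2 * q 3 x - c1 / r2 * (p 1 x + W 3 x + l * W 5 x))"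
    by (intro L2_add L2_diff L2_cmult L2s) auto
  from L2_cong_AE[OF this sw[OF opA_AE(2)[OF assms]]] have 4: "L2 L (opA P W 4)" .
  have "L2 L (\<lambda>x. inverse r1 * (a x * W 6 x))" by (intro L2_cmult damp_L2 L2s) auto
  moreover have "(\<lambda>x. inverse r1 * (a x * W 6 x)) = (\<lambda>x. a x / r1 * W 6 x)" by (simp add: field_simps)
  ultimately have "L2 L (\<lambda>x. a x / r1 * W 6 x)" by simp
  then have "L2 L (\<lambda>x. c3 / r1 * (q 5 x - l * p 1 x) - l * c1 / r1 * (p 1 x + W 3 x + l * W 5 x) - a x / r1 * W 6 x)"
    by (intro L2_add L2_diff L2_cmult L2s) auto
  from L2_cong_AE[OF this sw[OF opA_AE(3)[OF assms]]] have 6: "L2 L (opA P W 6)" .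
  fix i :: nat assume "i \<in> {2,4,6}"
  with 2 4 6 show "L2 L (opA P W i)" by auto
qed

lemma l2ip_real_combination:
  assumes "L2 L f" "L2 L g" "L2 L h"
  shows "l2ip L (\<lambda>x. of_real s * f x + of_real t * g x) h = s * l2ip L f h + t * l2ip L g h"
  using assms by (simp add: l2ip_add_left l2ip_scale_left L2_intros)

text \<open>V is tested in the velocity slots. Integration by parts, with no boundary terms since V
  vanishes at both ends, regroups everything into the strains of V. With V = W this yields the
  energy identity; with the displacements of W in place of V it settles the eigenvalue zero.\<close>

lemma weak_form:
  fixes V v :: "nat \<Rightarrow> real \<Rightarrow> complex"
  assumes D: "DA W p q" and V: "\<And>i. i \<in> {2,4,6} \<Longrightarrow> has_wderiv L (V i) (v i) \<and> V i 0 = 0 \<and> V i L = 0"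
  shows "rho1 P * l2ip L (opA P W 2) (V 2) + rho2 P * l2ip L (opA P W 4) (V 4) + rho1 P * l2ip L (opA P W 6) (V 6)
    = - (kk1 P * l2ip L (\<lambda>x. p 1 x + W 3 x + l * W 5 x) (\<lambda>x. v 2 x + V 4 x + l * V 6 x)
       + kk2 P * l2ip L (p 3) (v 4)
       + kk3 P * l2ip L (\<lambda>x. p 5 x - l * W 1 x) (\<lambda>x. v 6 x - l * V 2 x))
      - l2ip L (\<lambda>x. a x * W 6 x) (V 6)"
proof -
  note w = DA_wderiv[OF D] and L2s = DA_L2(1)[OF D] DA_L2(2)[OF D] DA_L2(3)[OF D]
  define S where "S x = p 1 x + W 3 x + l * W 5 x" for x
  define Sx where "Sx x = q 1 x + p 3 x + l * p 5 x" for x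
  define Y where "Y x = p 5 x - l * W 1 x" for x
  define Yx where "Yx x = q 5 x - l * p 1 x" for x
  have S: "has_wderiv L S Sx" unfolding S_def Sx_def by (intro wderiv_add wderiv_cmult w) auto
  have Y: "has_wderiv L Y Yx" unfolding Y_def Yx_def by (intro wderiv_diff wderiv_cmult w) auto
  have V2: "L2 L (V i)" "L2 L (v i)" if "i \<in> {2,4,6}" for i
    using V[OF that] L2_continuous[OF wderiv_continuous] wderiv_L2 by blast+
  have SS: "L2 L S" "L2 L Sx" "L2 L Y" "L2 L Yx"
    using S Y L2_continuous[OF wderiv_continuous] wderiv_L2 by blast+
  have parts: "l2ip L g' (V i) = - l2ip L g (v i)" if "has_wderiv L g g'" "i \<in> {2,4,6}" for g g' i
    using l2ip_parts[OF that(1), of "V i" "v i"] V[OF that(2)] L0 by simp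
  have "rho1 P * l2ip L (opA P W 2) (V 2) = l2ip L (\<lambda>x. of_real (rho1 P) * opA P W 2 x) (V 2)"
    by (simp add: l2ip_scale_left)
  also have "\<dots> = l2ip L (\<lambda>x. of_real (kk1 P) * Sx x + of_real (ll P * kk3 P) * Y x) (V 2)"
  proof (rule l2ip_cong_AE)
    show "ae (\<lambda>x. of_real (rho1 P) * opA P W 2 x = of_real (kk1 P) * Sx x + of_real (ll P * kk3 P) * Y x)"
      using opA_AE(1)[OF D]
    proof eventually_elim
      case (elim x)
      show ?case unfolding elim Sx_def Y_def using pos by (simp add: field_simps)
    qed
  qed simp
  also have "\<dots> = kk1 P * l2ip L Sx (V 2) + ll P * kk3 P * l2ip L Y (V 2)"
    by (rule l2ip_real_combination) (auto intro: SS V2)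
  finally have 2: "rho1 P * l2ip L (opA P W 2) (V 2) = - kk1 P * l2ip L S (v 2) + ll P * kk3 P * l2ip L Y (V 2)"
    using parts[OF S, of 2] by simp
  have "rho2 P * l2ip L (opA P W 4) (V 4) = l2ip L (\<lambda>x. of_real (rho2 P) * opA P W 4 x) (V 4)"
    by (simp add: l2ip_scale_left)
  also have "\<dots> = l2ip L (\<lambda>x. of_real (kk2 P) * q 3 x + of_real (- kk1 P) * S x) (V 4)"
  proof (rule l2ip_cong_AE)
    show "ae (\<lambda>x. of_real (rho2 P) * opA P W 4 x = of_real (kk2 P) * q 3 x + of_real (- kk1 P) * S x)"
      using opA_AE(2)[OF D]
    proof eventually_elim
      case (elim x)
      show ?case unfolding elim S_def using pos by (simp add: field_simps)
    qed
  qed simp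
  also have "\<dots> = kk2 P * l2ip L (q 3) (V 4) + - kk1 P * l2ip L S (V 4)"
    by (rule l2ip_real_combination) (auto intro: SS V2 L2s)
  finally have 4: "rho2 P * l2ip L (opA P W 4) (V 4) = - kk2 P * l2ip L (p 3) (v 4) - kk1 P * l2ip L S (V 4)"
    using parts[OF w(4)[of 3], of 4] by simp
  have "rho1 P * l2ip L (opA P W 6) (V 6) = l2ip L (\<lambda>x. of_real (rho1 P) * opA P W 6 x) (V 6)"
    by (simp add: l2ip_scale_left)
  also have "\<dots> = l2ip L (\<lambda>x. (of_real (kk3 P) * Yx x + of_real (- ll P * kk1 P) * S x) - a x * W 6 x) (V 6)"
  proof (rule l2ip_cong_AE)
    show "ae (\<lambda>x. of_real (rho1 P) * opA P W 6 x = (of_real (kk3 P) * Yx x + of_real (- ll P * kk1 P) * S x) - a x * W 6 x)"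
      using opA_AE(3)[OF D]
    proof eventually_elim
      case (elim x)
      show ?case unfolding elim S_def Yx_def using pos by (simp add: field_simps)
    qed
  qed simp
  also have "\<dots> = l2ip L (\<lambda>x. of_real (kk3 P) * Yx x + of_real (- ll P * kk1 P) * S x) (V 6) - l2ip L (\<lambda>x. a x * W 6 x) (V 6)"
    by (rule l2ip_diff_left) (auto intro!: L2_add L2_cmult SS V2 L2s damp_L2 simp del: of_real_mult of_real_minus)
  also have "l2ip L (\<lambda>x. of_real (kk3 P) * Yx x + of_real (- ll P * kk1 P) * S x) (V 6) = kk3 P * l2ip L Yx (V 6) + (- ll P * kk1 P) * l2ip L S (V 6)"
    by (rule l2ip_real_combination) (auto intro: SS V2 L2s)
  finally have 6: "rho1 P * l2ip L (opA P W 6) (V 6) = - kk3 P * l2ip L Y (v 6) - ll P * kk1 P * l2ip L S (V 6) - l2ip L (\<lambda>x. a x * W 6 x) (V 6)"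
    using parts[OF Y, of 6] by simp
  have eS: "l2ip L S (\<lambda>x. v 2 x + V 4 x + l * V 6 x) = l2ip L S (v 2) + l2ip L S (V 4) + ll P * l2ip L S (V 6)"
    using SS V2[of 2] V2[of 4] V2[of 6] by (simp add: l2ip_add_right l2ip_scale_right L2_intros)
  have eY: "l2ip L Y (\<lambda>x. v 6 x - l * V 2 x) = l2ip L Y (v 6) - ll P * l2ip L Y (V 2)"
    using SS V2[of 2] V2[of 6] by (simp add: l2ip_diff_right l2ip_scale_right L2_intros)
  show ?thesis
    unfolding 2 4 6 S_def[symmetric] Y_def[symmetric] eS eY by (simp add: algebra_simps)
qed

lemma ip_expand: "ip U V = kk1 P * l2ip L (eg U 1) (eg V 1) + rho1 P * l2ip L (U 2) (V 2) + kk2 P * l2ip L (eg U 3) (eg V 3)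
   + rho2 P * l2ip L (U 4) (V 4) + kk3 P * l2ip L (eg U 5) (eg V 5) + rho1 P * l2ip L (U 6) (V 6)"
  unfolding ip_def six by (simp add: wt_def eg_even)

lemma eg_DA:
  assumes "DA W p q"
  shows "ae (\<lambda>x. eg W 1 x = p 1 x + W 3 x + l * W 5 x)" "ae (\<lambda>x. eg W 3 x = p 3 x)" "ae (\<lambda>x. eg W 5 x = p 5 x - l * W 1 x)"
proof -
  have "i \<in> {1,3,5} \<Longrightarrow> has_wderiv L (W i) (p i)" for i using DA_wderiv(1)[OF assms, of i] by auto
  note e = eg_AE[of W p, OF this]
  show "ae (\<lambda>x. eg W 1 x = p 1 x + W 3 x + l * W 5 x)" by (rule e(1))
  show "ae (\<lambda>x. eg W 3 x = p 3 x)" by (rule e(2))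
  show "ae (\<lambda>x. eg W 5 x = p 5 x - l * W 1 x)" by (rule e(3))
qed

lemma eg_opA:
  assumes "DA W p q"
  shows "ae (\<lambda>x. eg (opA P W) 1 x = p 2 x + W 4 x + l * W 6 x)" "ae (\<lambda>x. eg (opA P W) 3 x = p 4 x)"
    "ae (\<lambda>x. eg (opA P W) 5 x = p 6 x - l * W 2 x)"
proof -
  note e = eg_AE[of "opA P W" "\<lambda>i. if i = 1 then p 2 else if i = 3 then p 4 else p 6", OF opA_wderiv(1)[OF assms]]
  have ne: "(3::nat) \<noteq> 1" "(5::nat) \<noteq> 1" "(5::nat) \<noteq> 3" by auto
  show "ae (\<lambda>x. eg (opA P W) 1 x = p 2 x + W 4 x + l * W 6 x)"
    using e(1) unfolding opA_odd by (simp only: if_True simp_thms)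
  show "ae (\<lambda>x. eg (opA P W) 3 x = p 4 x)"
    using e(2) by (simp only: if_True if_False simp_thms ne)
  show "ae (\<lambda>x. eg (opA P W) 5 x = p 6 x - l * W 2 x)"
    using e(3) unfolding opA_odd by (simp only: if_True if_False simp_thms ne)
qed

text \<open>The strains of A W are those of the velocities of W, so the elastic terms cancel against
  the weak form tested with W, and the damping alone survives.\<close>

lemma energy_identity:
  assumes D: "DA W p q" shows "ip (opA P W) W = - l2ip L (\<lambda>x. a x * W 6 x) (W 6)"
proof -
  have V: "i \<in> {2,4,6} \<Longrightarrow> has_wderiv L (W i) (p i) \<and> W i 0 = 0 \<and> W i L = 0" for i
    using DA_wderiv(1-3)[OF D, of i] by auto
  have 1: "l2ip L (eg (opA P W) 1) (eg W 1) = l2ip L (\<lambda>x. p 1 x + W 3 x + l * W 5 x) (\<lambda>x. p 2 x + W 4 x + l * W 6 x)"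
    by (subst l2ip_sym, rule l2ip_cong_AE[OF eg_DA(1)[OF D] eg_opA(1)[OF D]])
  have 3: "l2ip L (eg (opA P W) 3) (eg W 3) = l2ip L (p 3) (p 4)"
    by (subst l2ip_sym, rule l2ip_cong_AE[OF eg_DA(2)[OF D] eg_opA(2)[OF D]])
  have 5: "l2ip L (eg (opA P W) 5) (eg W 5) = l2ip L (\<lambda>x. p 5 x - l * W 1 x) (\<lambda>x. p 6 x - l * W 2 x)"
    by (subst l2ip_sym, rule l2ip_cong_AE[OF eg_DA(3)[OF D] eg_opA(3)[OF D]])
  show ?thesis
    using weak_form[of W p q W p, OF D V] unfolding ip_expand 1 3 5 by (simp add: algebra_simps)
qed

text \<open>With the square root s of the damping the form becomes the square of a norm; if it
  vanishes, so does s f almost everywhere.\<close>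

lemma damp_form:
  assumes "L2 L f"
  shows "0 \<le> l2ip L (\<lambda>x. a x * f x) f"
    "l2ip L (\<lambda>x. a x * f x) f = 0 \<Longrightarrow> ae (\<lambda>x. damp P x \<noteq> 0 \<longrightarrow> f x = 0)"
proof -
  \<comment> \<open>The maximum guards the root on the null set where the damping may be
    negative.\<close>
  define s where "s x = complex_of_real (sqrt (max 0 (damp P x)))" for x
  have sm: "s \<in> borel_measurable (lebesgue_on {0..L})"
    unfolding s_def using damp_measurable by measurable
  have sL: "L2 L (\<lambda>x. s x * f x)"
  proof (rule L2_mult_bounded[OF assms sm, where C="sqrt Ka"])
    show "cmod (s x) \<le> sqrt Ka" if "x \<in> {0..L}" for x
      using damp_bound(1)[OF that] damp_bound(2) by (auto simp: s_def)
  qed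
  have eq: "l2ip L (\<lambda>x. a x * f x) f = l2ip L (\<lambda>x. s x * f x) (\<lambda>x. s x * f x)"
    unfolding l2ip_def
  proof (rule integral_cong_AE_interval[where a=0 and b=L])
    show "ae (\<lambda>x. Re (a x * f x * cnj (f x)) = Re (s x * f x * cnj (s x * f x)))"
      using damp_nonneg
    proof eventually_elim
      case (elim x)
      then have "a x = s x * cnj (s x)" by (simp add: s_def of_real_mult[symmetric] del: of_real_mult)
      then have "a x * f x * cnj (f x) = s x * f x * cnj (s x * f x)"
        by (simp only: complex_cnj_mult mult_ac)
      then show ?case by (simp only:)
    qed
  qed simp
  show "0 \<le> l2ip L (\<lambda>x. a x * f x) f" unfolding eq by (rule l2ip_nonneg[OF sL])
  assume "l2ip L (\<lambda>x. a x * f x) f = 0"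
  then have "ae (\<lambda>x. s x * f x = 0)" unfolding eq by (rule l2ip_eq_0[OF sL])
  with damp_nonneg show "ae (\<lambda>x. damp P x \<noteq> 0 \<longrightarrow> f x = 0)"
    by eventually_elim (auto simp: s_def)
qed

lemma opA_dissipative: "DA W p q \<Longrightarrow> ip (opA P W) W \<le> 0"
  using energy_identity[of W p q] damp_form(1)[OF DA_L2(1)[of W p q 6]] by simp

lemma zero_imp_null:
  assumes U: "U \<in> H" and odd: "\<And>i x. i \<in> {1,3,5} \<Longrightarrow> x \<in> {0..L} \<Longrightarrow> U i x = 0"
    and even: "\<And>i. i \<in> {2,4,6} \<Longrightarrow> ae (\<lambda>x. U i x = 0)"
  shows "nrm U = 0"
proof -
  have z: "l2ip L f f = 0" if "ae (\<lambda>x. f x = 0)" for f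
    using l2ip_cong_AE[OF that that] by (simp add: l2ip_def)
  have "has_wderiv L (U i) (\<lambda>x. 0)" if "i \<in> {1,3,5}" for i
    by (rule wderivI) (use odd[OF that] L0 in \<open>auto intro: L2_continuous\<close>)
  then have "(nrm U)\<^sup>2 \<le> 6 * CU * 0"
    by (intro energy_le[OF U, where p="\<lambda>i x. 0"]) (auto simp: z even)
  then show ?thesis by simp
qed

text \<open>The second derivatives of components 1, 3 and 5, solved from the eigenvalue equation
  after the velocities have been replaced by z times the displacements. The damping term is left out
  of \<open>N5\<close>, since it alone has a variable coefficient.\<close>

definition N1 where "N1 z w1 p3 p5 = (r1 * z\<^sup>2 * w1 - l * c3 * (p5 - l * w1)) / c1 - p3 - l * p5"
definition N3 where "N3 z w3 w5 p1 = (r2 * z\<^sup>2 * w3 + c1 * (p1 + w3 + l * w5)) / c2"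
definition N5 where "N5 z w3 w5 p1 = (r1 * z\<^sup>2 * w5 + l * c1 * (p1 + w3 + l * w5)) / c3 + l * p1"

lemma eigen_equations:
  assumes D: "DA W p q" and n: "nrm (sscale z W - opA P W) = 0"
  shows "x \<in> {0..L} \<Longrightarrow> W 2 x = z * W 1 x" "x \<in> {0..L} \<Longrightarrow> W 4 x = z * W 3 x" "x \<in> {0..L} \<Longrightarrow> W 6 x = z * W 5 x"
    "ae (\<lambda>x. q 1 x = N1 z (W 1 x) (p 3 x) (p 5 x))"
    "ae (\<lambda>x. q 3 x = N3 z (W 3 x) (W 5 x) (p 1 x))"
    "ae (\<lambda>x. q 5 x = N5 z (W 3 x) (W 5 x) (p 1 x) + a x * (z * W 5 x / c3))"
proof -
  have Z: "sscale z W - opA P W \<in> H" by (intro mem DA_H[OF D] opA_H[OF D])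
  note n1 = null_imp_zero(1)[OF Z n] and n2 = null_imp_zero(2)[OF Z n]
  have o: "x \<in> {0..L} \<Longrightarrow> W 2 x = z * W 1 x" "x \<in> {0..L} \<Longrightarrow> W 4 x = z * W 3 x" "x \<in> {0..L} \<Longrightarrow> W 6 x = z * W 5 x" for x
    using n1[of 1 x] n1[of 3 x] n1[of 5 x] opA_odd[of W] by (auto simp: sscale_def fun_diff_def)
  then show "x \<in> {0..L} \<Longrightarrow> W 2 x = z * W 1 x" "x \<in> {0..L} \<Longrightarrow> W 4 x = z * W 3 x" "x \<in> {0..L} \<Longrightarrow> W 6 x = z * W 5 x"
    by blast+
  have nz: "r1 \<noteq> 0" "r2 \<noteq> 0" "c1 \<noteq> 0" "c2 \<noteq> 0" "c3 \<noteq> 0" using pos by auto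
  have e: "ae (\<lambda>x. z * W 2 x = opA P W 2 x)" "ae (\<lambda>x. z * W 4 x = opA P W 4 x)" "ae (\<lambda>x. z * W 6 x = opA P W 6 x)"
    using n2[of 2] n2[of 4] n2[of 6] by (auto simp: sscale_def fun_diff_def elim: eventually_mono)
  have inL: "ae (\<lambda>x. x \<in> {0..L})" by (simp add: AE_negligible) (rule exI[of _ "{}"], simp)
  show "ae (\<lambda>x. q 1 x = N1 z (W 1 x) (p 3 x) (p 5 x))"
    using e(1) opA_AE(1)[OF D] inL
  proof eventually_elim
    case (elim x)
    have o': "W 2 x = z * W 1 x" using o(1)[of x] elim(3) .
    have "r1 * (z * (z * W 1 x)) = r1 * (c1 / r1 * (q 1 x + p 3 x + l * p 5 x) + l * c3 / r1 * (p 5 x - l * W 1 x))"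
      using elim(1,2) unfolding o' by (simp only:)
    also have "\<dots> = c1 * (q 1 x + p 3 x + l * p 5 x) + l * c3 * (p 5 x - l * W 1 x)" using nz by (simp add: field_simps)
    finally show ?case using nz by (simp add: N1_def field_simps power2_eq_square)
  qed
  show "ae (\<lambda>x. q 3 x = N3 z (W 3 x) (W 5 x) (p 1 x))"
    using e(2) opA_AE(2)[OF D] inL
  proof eventually_elim
    case (elim x)
    have o': "W 4 x = z * W 3 x" using o(2)[of x] elim(3) .
    have "r2 * (z * (z * W 3 x)) = r2 * (c2 / r2 * q 3 x - c1 / r2 * (p 1 x + W 3 x + l * W 5 x))"
      using elim(1,2) unfolding o' by (simp only:)
    also have "\<dots> = c2 * q 3 x - c1 * (p 1 x + W 3 x + l * W 5 x)" using nz by (simp add: field_simps)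
    finally show ?case using nz by (simp add: N3_def field_simps power2_eq_square)
  qed
  show "ae (\<lambda>x. q 5 x = N5 z (W 3 x) (W 5 x) (p 1 x) + a x * (z * W 5 x / c3))"
    using e(3) opA_AE(3)[OF D] inL
  proof eventually_elim
    case (elim x)
    have o': "W 6 x = z * W 5 x" using o(3)[of x] elim(3) .
    have "r1 * (z * (z * W 5 x)) = r1 * (c3 / r1 * (q 5 x - l * p 1 x) - l * c1 / r1 * (p 1 x + W 3 x + l * W 5 x) - a x / r1 * (z * W 5 x))"
      using elim(1,2) unfolding o' by (simp only:)
    also have "\<dots> = c3 * (q 5 x - l * p 1 x) - l * c1 * (p 1 x + W 3 x + l * W 5 x) - a x * (z * W 5 x)" using nz by (simp add: field_simps)
    finally show ?case using nz by (simp add: N5_def field_simps power2_eq_square)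
  qed
qed

end

section \<open>Eigenvalues and solvability\<close>

lemma wderiv_zero_local:
  assumes w: "has_wderiv L u g" and b: "0 < b" "b \<le> L" and z: "\<And>x. x \<in> {0..b} \<Longrightarrow> u x = 0"
  shows "AE x in lebesgue_on {0..L}. 0 \<le> x \<longrightarrow> x \<le> b \<longrightarrow> g x = 0"
proof -
  have "g \<in> borel_measurable (lebesgue_on {0..b})"
    by (rule measurable_restrict_mono[OF L2_measurable[OF wderiv_L2[OF w]]]) (use b in auto)
  then have L2: "L2 b g"
    by (rule L2I[OF _ L2_sq_integrable[OF wderiv_L2[OF w]]]) (use b in auto)
  have "integral {0..x} g = 0" if x: "x \<in> {0..b}" for x
    using wderiv_eq[OF w, of x] z[of x] z[of 0] x b by auto
  then have "AE x in lebesgue_on {0..b}. g x = 0"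
    by (rule indefinite_integral_zero_imp_AE_zero[OF L2 b(1)])
  then obtain N where "negligible N" "\<forall>x\<in>{0..b} - N. g x = 0" unfolding AE_negligible by blast
  then show ?thesis unfolding AE_negligible by (intro exI[of _ N]) auto
qed

context bresse
begin

lemma ae_ball: "ae (\<lambda>x. x \<in> {0..L})"
  unfolding AE_negligible by (rule exI[of _ "{}"]) simp

lemma l2ip_ae_zero: "ae (\<lambda>x. f x = 0) \<Longrightarrow> l2ip L f g = 0"
  using l2ip_cong_AE[where L=L and f=f and f'="\<lambda>x. 0" and g=g and g'=g] by (simp add: l2ip_def)

text \<open>The second order system as a first order one: displacements in the first vector, slopes
  in the second, with state indices 1, 3, 5 numbered 1, 2, 3. \<open>A1\<close> isolates the term
  multiplied by the damping.\<close>

definition A0 :: "complex \<Rightarrow> (complex^3) \<times> (complex^3) \<Rightarrow> (complex^3) \<times> (complex^3)" where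
  "A0 z v = (snd v, vector [N1 z (fst v $ 1) (snd v $ 2) (snd v $ 3),
     N3 z (fst v $ 2) (fst v $ 3) (snd v $ 1), N5 z (fst v $ 2) (fst v $ 3) (snd v $ 1)])"

definition A1 :: "complex \<Rightarrow> (complex^3) \<times> (complex^3) \<Rightarrow> (complex^3) \<times> (complex^3)" where
  "A1 z v = (0, vector [0, 0, z * fst v $ 3 / c3])"

abbreviation "ode_rhs z \<equiv> volterra.rhs (A0 z) (A1 z) (damp P)"
abbreviation "ode_solves z \<equiv> volterra.solves (A0 z) (A1 z) (damp P) L"

lemma linear_A0: "linear (A0 z)"
proof (rule linearI)
  show "A0 z (x + y) = A0 z x + A0 z y" for x y
    by (simp add: A0_def prod_eq_iff vec_eq_iff forall_3 N1_def N3_def N5_def algebra_simps add_divide_distrib diff_divide_distrib)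
  show "A0 z (c *\<^sub>R x) = c *\<^sub>R A0 z x" for c x
    by (simp add: A0_def prod_eq_iff vec_eq_iff forall_3 N1_def N3_def N5_def scaleR_conv_of_real[where 'a=complex] algebra_simps add_divide_distrib diff_divide_distrib)
qed

lemma linear_A1: "linear (A1 z)"
  by (rule linearI) (simp_all add: A1_def prod_eq_iff vec_eq_iff forall_3 scaleR_conv_of_real[where 'a=complex] algebra_simps add_divide_distrib)

lemma volterra_instance: "\<exists>K0 K1. volterra (A0 z) (A1 z) (damp P) L K0 K1 Ka"
proof -
  obtain K0 where K0: "K0 > 0" "\<And>v. norm (A0 z v) \<le> K0 * norm v" using linear_bounded_pos[OF linear_A0] by blast
  obtain K1 where K1: "K1 > 0" "\<And>v. norm (A1 z v) \<le> K1 * norm v" using linear_bounded_pos[OF linear_A1] by blast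
  have "volterra (A0 z) (A1 z) (damp P) L K0 K1 Ka"
    by (rule volterra.intro[OF linear_A0 linear_A1 K0(2) K1(2) _ _ damp_measurable damp_bound(1) damp_bound(2) pos(7)])
      (use K0(1) K1(1) in auto)
  then show ?thesis by blast
qed

lemma ode_rhs_components:
  "fst (ode_rhs z t v) = snd v"
  "snd (ode_rhs z t v) $ 1 = N1 z (fst v $ 1) (snd v $ 2) (snd v $ 3)"
  "snd (ode_rhs z t v) $ 2 = N3 z (fst v $ 2) (fst v $ 3) (snd v $ 1)"
  "snd (ode_rhs z t v) $ 3 = N5 z (fst v $ 2) (fst v $ 3) (snd v $ 1) + a t * (z * fst v $ 3 / c3)"
proof -
  obtain K0 K1 where "volterra (A0 z) (A1 z) (damp P) L K0 K1 Ka" using volterra_instance by blast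
  then interpret V: volterra "A0 z" "A1 z" "damp P" L K0 K1 Ka .
  show "fst (V.rhs t v) = snd v"
  "snd (V.rhs t v) $ 1 = N1 z (fst v $ 1) (snd v $ 2) (snd v $ 3)"
  "snd (V.rhs t v) $ 2 = N3 z (fst v $ 2) (fst v $ 3) (snd v $ 1)"
  "snd (V.rhs t v) $ 3 = N5 z (fst v $ 2) (fst v $ 3) (snd v $ 1) + a t * (z * fst v $ 3 / c3)"
    by (simp_all add: V.rhs_def A0_def A1_def scaleR_conv_of_real[where 'a=complex])
qed

lemma integral_components:
  fixes g :: "real \<Rightarrow> (complex^3) \<times> (complex^3)"
  assumes "g integrable_on S"
  shows "fst (integral S g) $ i = integral S (\<lambda>t. fst (g t) $ i)" "snd (integral S g) $ i = integral S (\<lambda>t. snd (g t) $ i)"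
  using integral_linear[OF assms bounded_linear_compose[OF bounded_linear_vec_nth bounded_linear_fst], of i]
    integral_linear[OF assms bounded_linear_compose[OF bounded_linear_vec_nth bounded_linear_snd], of i]
  by (simp_all add: o_def)

text \<open>The Dirichlet condition supplies the displacements at 0, so vanishing slopes complete
  zero Cauchy data for the homogeneous Volterra system, whose only solution is zero.\<close>

lemma cauchy_unique:
  assumes D: "DA W p q" and n: "nrm (sscale z W - opA P W) = 0"
    and p0: "p 1 0 = 0" "p 3 0 = 0" "p 5 0 = 0"
  shows "nrm W = 0"
proof -
  obtain K0 K1 where "volterra (A0 z) (A1 z) (damp P) L K0 K1 Ka" using volterra_instance by blast
  then interpret V: volterra "A0 z" "A1 z" "damp P" L K0 K1 Ka .
  note w = DA_wderiv[OF D] and e = eigen_equations[OF D n]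
  define Y where "Y x = ((vector [W 1 x, W 3 x, W 5 x], vector [p 1 x, p 3 x, p 5 x]) :: (complex^3) \<times> (complex^3))" for x
  have cY: "continuous_on {0..L} Y"
  proof -
    have c: "continuous_on {0..L} (\<lambda>x. vector [f x, g x, h x] :: complex^3)"
      if "continuous_on {0..L} f" "continuous_on {0..L} g" "continuous_on {0..L} h" for f g h :: "real \<Rightarrow> complex"
    proof -
      have "continuous_on {0..L} (\<lambda>x. \<chi> i. (vector [f x, g x, h x] :: complex^3) $ i)"
      proof (rule continuous_on_vec_lambda)
        fix i :: 3
        show "continuous_on {0..L} (\<lambda>x. (vector [f x, g x, h x] :: complex^3) $ i)"
          using exhaust_3[of i] that by auto
      qed
      then show ?thesis by simp
    qed
    show ?thesis unfolding Y_def
      by (intro continuous_on_Pair c wderiv_continuous[OF w(1)] wderiv_continuous[OF w(4)]) auto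
  qed
  have sol: "V.solves 0 (\<lambda>t. 0) Y"
    unfolding V.solves_def
  proof (intro conjI ballI cY)
    fix x assume x: "x \<in> {0..L}"
    have i: "(\<lambda>t. V.rhs t (Y t) + 0) integrable_on {0..x}"
      using V.rhs_integrable[OF cY, of 0 x] x by simp
    have iW: "W i x = integral {0..x} (p i)" if "i \<in> {1..6}" for i
      using wderiv_eq[OF w(1)[OF that] x] w(2)[OF that] by simp
    have ip: "p i x = integral {0..x} (q i)" if "i \<in> {1,3,5}" "p i 0 = 0" for i
      using wderiv_eq[OF w(4)[OF that(1)] x] that(2) by simp
    have cong: "integral {0..x} f = integral {0..x} g" if "ae (\<lambda>x. f x = g x)" for f g :: "real \<Rightarrow> complex"
      by (rule integral_cong_AE_interval[OF that]) (use x in auto)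
    have "fst (Y x) $ j = fst (integral {0..x} (\<lambda>t. V.rhs t (Y t) + 0)) $ j" for j
      unfolding integral_components(1)[OF i] using exhaust_3[of j] iW[of 1] iW[of 3] iW[of 5]
      by (auto simp: Y_def ode_rhs_components)
    moreover have "snd (Y x) $ j = snd (integral {0..x} (\<lambda>t. V.rhs t (Y t) + 0)) $ j" for j
      unfolding integral_components(2)[OF i] using exhaust_3[of j] ip[OF _ p0(1)] ip[OF _ p0(2)] ip[OF _ p0(3)]
        cong[OF e(4)] cong[OF e(5)] cong[OF e(6)]
      by (auto simp: Y_def ode_rhs_components)
    ultimately show "Y x = 0 + integral {0..x} (\<lambda>t. V.rhs t (Y t) + 0)"
      by (simp add: prod_eq_iff vec_eq_iff)
  qed
  have sol0: "V.solves 0 (\<lambda>t. 0) (\<lambda>x. 0)"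
    using V.rhs_linear(3)[of _ 0 0] by (simp add: V.solves_def)
  have Y0: "Y x = 0" if "x \<in> {0..L}" for x
    by (rule V.solves_unique[OF sol sol0 that integrable_0])
  have W0: "W i x = 0" if x: "x \<in> {0..L}" and i: "i \<in> {1,3,5}" for i x
  proof -
    have "fst (Y x) $ 1 = 0" "fst (Y x) $ 2 = 0" "fst (Y x) $ 3 = 0" using Y0[OF x] by simp_all
    then show ?thesis using i by (auto simp: Y_def)
  qed
  show ?thesis
  proof (rule zero_imp_null[OF DA_H[OF D] W0])
    fix i :: nat assume i: "i \<in> {2,4,6}"
    show "ae (\<lambda>x. W i x = 0)" using ae_ball
    proof eventually_elim
      case (elim x)
      then show ?case using i e(1)[of x] e(2)[of x] e(3)[of x] W0[of x 1] W0[of x 3] W0[of x 5] by auto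
    qed
  qed
qed

text \<open>At eigenvalue zero the velocities vanish and the dissipation carries no information. The
  weak form, tested with the displacements themselves, then says that the weighted sum of the
  squared strains is zero.\<close>

lemma no_zero_eigenvalue:
  assumes D: "DA W p q" and n: "nrm (sscale 0 W - opA P W) = 0"
  shows "nrm W = 0"
proof -
  note w = DA_wderiv[OF D] and L2s = DA_L2(1)[OF D] DA_L2(2)[OF D] DA_L2(3)[OF D]
  have nA: "nrm (opA P W) = 0" using n opA_H[OF D] by (simp add: sc_zero nrm_minus)
  have W0: "ae (\<lambda>x. W 2 x = 0)" "ae (\<lambda>x. W 4 x = 0)" "ae (\<lambda>x. W 6 x = 0)"
    using eigen_equations(1-3)[OF D n] by (rule_tac eventually_mono[OF ae_ball]; simp)+
  \<comment> \<open>The displacements of W are moved into the velocity slots, where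
    \<open>weak_form\<close> expects its test functions.\<close>
  define V where "V i = (if i = 2 then W 1 else if i = 4 then W 3 else W 5)" for i :: nat
  define v where "v i = (if i = 2 then p 1 else if i = 4 then p 3 else p 5)" for i :: nat
  have V: "has_wderiv L (V i) (v i) \<and> V i 0 = 0 \<and> V i L = 0" if "i \<in> {2,4,6}" for i
    using w(1-3)[of 1] w(1-3)[of 3] w(1-3)[of 5] by (auto simp: V_def v_def)
  define S where "S x = p 1 x + W 3 x + l * W 5 x" for x
  define Y where "Y x = p 5 x - l * W 1 x" for x
  have Vv: "V 2 = W 1" "V 4 = W 3" "V 6 = W 5" "v 2 = p 1" "v 4 = p 3" "v 6 = p 5"
    by (simp_all add: V_def v_def)
  have L2S: "L2 L S" "L2 L Y" unfolding S_def Y_def by (auto intro!: L2_add L2_diff L2_cmult L2s)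
  have aW: "ae (\<lambda>x. a x * W 6 x = 0)" using W0(3) by (auto elim: eventually_mono)
  have A0: "ae (\<lambda>x. opA P W i x = 0)" if "i \<in> {2,4,6}" for i
    by (rule null_imp_zero(2)[OF opA_H[OF D] nA that])
  have "kk1 P * l2ip L S S + kk2 P * l2ip L (p 3) (p 3) + kk3 P * l2ip L Y Y = 0"
    using weak_form[of W p q V v, OF D V] l2ip_ae_zero[OF A0, of 2] l2ip_ae_zero[OF A0, of 4] l2ip_ae_zero[OF A0, of 6]
      l2ip_ae_zero[OF aW]
    unfolding Vv S_def[symmetric] Y_def[symmetric] by simp
  moreover have "l2ip L (eg W 1) (eg W 1) = l2ip L S S"
    unfolding S_def by (rule l2ip_cong_AE[OF eg_DA(1)[OF D] eg_DA(1)[OF D]])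
  moreover have "l2ip L (eg W 3) (eg W 3) = l2ip L (p 3) (p 3)"
    by (rule l2ip_cong_AE[OF eg_DA(2)[OF D] eg_DA(2)[OF D]])
  moreover have "l2ip L (eg W 5) (eg W 5) = l2ip L Y Y"
    unfolding Y_def by (rule l2ip_cong_AE[OF eg_DA(3)[OF D] eg_DA(3)[OF D]])
  ultimately have "ip W W = 0"
    unfolding ip_expand using l2ip_ae_zero[OF W0(1)] l2ip_ae_zero[OF W0(2)] l2ip_ae_zero[OF W0(3)] by simp
  then show ?thesis by (simp add: nrm_def)
qed

lemma ip_imaginary: assumes "x \<in> H" shows "ip (sscale (\<i> * of_real w) x) x = 0"
proof -
  have "ip (sscale \<i> x) x = ip (sscale \<i> (sscale \<i> x)) (sscale \<i> x)" using assms by (simp add: ip_i mem)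
  also have "\<dots> = - ip (sscale \<i> x) x"
    using assms by (simp add: sc_sc sc_minus_one ip_simps mem ip_sym[of x])
  finally have "ip (sscale \<i> x) x = 0" by simp
  moreover have "sscale (\<i> * of_real w) x = sscale (of_real w) (sscale \<i> x)" by (simp add: sc_sc mult.commute)
  ultimately show ?thesis using assms by (simp add: ip_real_left mem)
qed

text \<open>On the damped interval an eigenfunction has vanishing longitudinal part; the remaining equations then
  force all Cauchy data at the left end to vanish.\<close>

lemma opA_no_imaginary_eigenvalue:
  assumes D: "DA W p q" and n: "nrm (sscale (\<i> * of_real w) W - opA P W) = 0"
  shows "nrm W = 0"
proof (cases "w = 0")
  case True
  with no_zero_eigenvalue[OF D] n show ?thesis by simp
next
  case False
  define z where "z = \<i> * complex_of_real w"
  have z0: "z \<noteq> 0" using False by (simp add: z_def)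
  have n': "nrm (sscale z W - opA P W) = 0" using n by (simp add: z_def)
  note wd = DA_wderiv[OF D] and e = eigen_equations[OF D n']
  have b: "0 < \<beta>" "\<beta> \<le> L" using \<beta> by auto
  have cont: "continuous_on {0..\<beta>} (W i)" if "i \<in> {1..6}" for i
    by (rule continuous_on_subset[OF wderiv_continuous[OF wd(1)[OF that]]]) (use b in auto)
  have contp: "continuous_on {0..\<beta>} (p i)" if "i \<in> {1,3,5}" for i
    by (rule continuous_on_subset[OF wderiv_continuous[OF wd(4)[OF that]]]) (use b in auto)
  have ext: "f x = g x" if "ae (\<lambda>x. 0 \<le> x \<longrightarrow> x \<le> \<beta> \<longrightarrow> f x = g x)" "continuous_on {0..\<beta>} f" "continuous_on {0..\<beta>} g" "x \<in> {0..\<beta>}"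
    for f g :: "real \<Rightarrow> complex" and x
    by (rule AE_interval_continuous_eq[OF that(1-3) _ b(1,2) that(4)]) simp
  have "ip (opA P W) W = ip (sscale z W) W"
    by (rule eqv_ip) (use DA_H[OF D] opA_H[OF D] n' nrm_diff_sym[of "sscale z W" "opA P W"] in \<open>auto simp: mem nrm_zero\<close>)
  \<comment> \<open>An imaginary multiple of W is orthogonal to W for the real form, so the energy
    identity leaves zero dissipation.\<close>
  then have "l2ip L (\<lambda>x. a x * W 6 x) (W 6) = 0"
    using energy_identity[OF D] ip_imaginary[OF DA_H[OF D], of w] by (simp add: z_def)
  then have d: "ae (\<lambda>x. damp P x \<noteq> 0 \<longrightarrow> W 6 x = 0)"
    by (rule damp_form(2)[OF DA_L2(1)[OF D], rotated]) simp
  have ne: "ae (\<lambda>x. x \<noteq> 0 \<and> x \<noteq> \<beta>)"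
    unfolding AE_negligible by (rule exI[of _ "{0, \<beta>}"]) auto
  have "ae (\<lambda>x. 0 \<le> x \<longrightarrow> x \<le> \<beta> \<longrightarrow> W 6 x = 0)"
    using d ne by eventually_elim (use damp_left a0 in force)
  then have W6: "W 6 x = 0" if "x \<in> {0..\<beta>}" for x
    by (rule ext[where g="\<lambda>x. 0"]) (use cont[of 6] that in auto)
  have W5: "W 5 x = 0" if "x \<in> {0..\<beta>}" for x
    using W6[OF that] e(3)[of x] z0 that b by auto
  have "ae (\<lambda>x. 0 \<le> x \<longrightarrow> x \<le> \<beta> \<longrightarrow> p 5 x = 0)"
    by (rule wderiv_zero_local[OF wd(1)[of 5] b W5]) auto
  then have p5: "p 5 x = 0" if "x \<in> {0..\<beta>}" for x
    by (rule ext[where g="\<lambda>x. 0"]) (use contp[of 5] that in auto)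
  have q5: "ae (\<lambda>x. 0 \<le> x \<longrightarrow> x \<le> \<beta> \<longrightarrow> q 5 x = 0)"
    by (rule wderiv_zero_local[OF wd(4)[of 5] b p5]) auto
  have nz: "c1 \<noteq> 0" "c3 \<noteq> 0" "l \<noteq> 0" using pos by auto
  have c13: "c1 + c3 \<noteq> 0" using pos by (simp add: of_real_add[symmetric] del: of_real_add)
  \<comment> \<open>With component 5 and its derivatives gone, the fifth equation reduces to the
    first order relation F = 0. At 0, where component 3 vanishes, it gives the slope of component
    1.\<close>
  define F where "F x = (c1 + c3) * p 1 x + c1 * W 3 x" for x
  have "ae (\<lambda>x. 0 \<le> x \<longrightarrow> x \<le> \<beta> \<longrightarrow> F x = 0)"
    using q5 e(6)
  proof eventually_elim
    case (elim x)
    show ?case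
    proof (intro impI)
      assume x: "0 \<le> x" "x \<le> \<beta>"
      then have "0 = (l * c1 * (p 1 x + W 3 x)) / c3 + l * p 1 x"
        using elim W5[of x] by (simp add: N5_def)
      also have "\<dots> = l / c3 * F x" using nz by (simp add: F_def field_simps)
      finally show "F x = 0" using nz by simp
    qed
  qed
  then have F0: "F x = 0" if "x \<in> {0..\<beta>}" for x
    by (rule ext[where g="\<lambda>x. 0"]) (use contp[of 1] cont[of 3] that in \<open>auto simp: F_def intro!: continuous_intros\<close>)
  have p1: "p 1 0 = 0" using F0[of 0] wd(2)[of 3] b c13 by (simp add: F_def)
  have "has_wderiv L F (\<lambda>x. (c1 + c3) * q 1 x + c1 * p 3 x)"
    unfolding F_def by (intro wderiv_add wderiv_cmult wd) auto
  then have F': "ae (\<lambda>x. 0 \<le> x \<longrightarrow> x \<le> \<beta> \<longrightarrow> (c1 + c3) * q 1 x + c1 * p 3 x = 0)"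
    by (rule wderiv_zero_local[OF _ b F0])
  \<comment> \<open>Differentiate F = 0 and eliminate \<open>q 1\<close> by the first equation: the
    slope of component 3 is a constant multiple of component 1, which vanishes at 0.\<close>
  have "ae (\<lambda>x. 0 \<le> x \<longrightarrow> x \<le> \<beta> \<longrightarrow> p 3 x = (c1 + c3) * (r1 * z\<^sup>2 + l\<^sup>2 * c3) / (c1 * c3) * W 1 x)"
    using F' e(4)
  proof eventually_elim
    case (elim x)
    show ?case
    proof (intro impI)
      assume x: "0 \<le> x" "x \<le> \<beta>"
      then have F'': "(c1 + c3) * q 1 x = - (c1 * p 3 x)" using elim by (simp add: eq_neg_iff_add_eq_0)
      have "q 1 x = (r1 * z\<^sup>2 * W 1 x + l * c3 * l * W 1 x) / c1 - p 3 x"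
        using elim(2) W5[of x] p5[of x] x by (simp add: N1_def)
      then have h: "c1 * q 1 x + c1 * p 3 x = (r1 * z\<^sup>2 + l\<^sup>2 * c3) * W 1 x"
        using nz by (simp add: field_simps power2_eq_square)
      have "(c1 + c3) * (r1 * z\<^sup>2 + l\<^sup>2 * c3) * W 1 x = (c1 + c3) * (c1 * q 1 x + c1 * p 3 x)"
        unfolding h by (simp add: mult.assoc)
      also have "\<dots> = c1 * ((c1 + c3) * q 1 x) + (c1 + c3) * (c1 * p 3 x)"
        by (simp add: algebra_simps)
      also have "\<dots> = c1 * c3 * p 3 x" unfolding F'' by (simp add: algebra_simps)
      finally show "p 3 x = (c1 + c3) * (r1 * z\<^sup>2 + l\<^sup>2 * c3) / (c1 * c3) * W 1 x"
        using nz by (simp add: field_simps)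
    qed
  qed
  then have "p 3 0 = (c1 + c3) * (r1 * z\<^sup>2 + l\<^sup>2 * c3) / (c1 * c3) * W 1 0"
    by (rule ext) (use contp[of 3] cont[of 1] b nz in \<open>auto intro!: continuous_intros\<close>)
  then have p3: "p 3 0 = 0" using wd(2)[of 1] by simp
  show ?thesis by (rule cauchy_unique[OF D n' p1 p3 p5]) (use b in simp)
qed

text \<open>The data left over when the velocities, equal to z times the displacements minus F 1, F
  3, F 5, are eliminated from (z - A) U = F. The extra term in the last entry arises because the
  damping acts on the velocity.\<close>

definition forcing :: "complex \<Rightarrow> state \<Rightarrow> real \<Rightarrow> (complex^3) \<times> (complex^3)" where
  "forcing z F t = (0, vector [- (r1 * (z * F 1 t + F 2 t)) / c1, - (r2 * (z * F 3 t + F 4 t)) / c2,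
     - (r1 * (z * F 5 t + F 6 t) + a t * F 5 t) / c3])"

lemma forcing_zero: "forcing z 0 t = 0"
  by (simp add: forcing_def prod_eq_iff vec_eq_iff forall_3)

lemma forcing_components:
  assumes "F \<in> H" shows "L2 L (\<lambda>t. snd (forcing z F t) $ j)"
proof -
  have "L2 L (\<lambda>t. - (r1 * (z * F 1 t + F 2 t)) / c1)" "L2 L (\<lambda>t. - (r2 * (z * F 3 t + F 4 t)) / c2)"
    "L2 L (\<lambda>t. - (r1 * (z * F 5 t + F 6 t) + a t * F 5 t) / c3)"
    by (intro L2_divide L2_minus L2_add L2_cmult damp_L2 H_L2[OF assms] H_L2_even[OF assms]; simp)+
  then show ?thesis using exhaust_3[of j] by (auto simp: forcing_def)
qed

lemma forcing_integrable: assumes "F \<in> H" shows "forcing z F integrable_on {0..L}"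
proof -
  have comp: "(\<lambda>t. snd (forcing z F t) $ j) integrable_on {0..L}" for j
    by (rule L2_integrable[OF forcing_components[OF assms]]) auto
  have "(\<lambda>t. \<Sum>j\<in>UNIV. (0, axis j (snd (forcing z F t) $ j)) :: (complex^3) \<times> (complex^3)) integrable_on {0..L}"
  proof (rule integrable_sum)
    fix j :: 3
    have "bounded_linear (\<lambda>c::complex. (0, axis j c) :: (complex^3) \<times> (complex^3))"
      unfolding linear_conv_bounded_linear[symmetric]
      by (rule linearI) (auto simp: prod_eq_iff vec_eq_iff axis_def)
    from integrable_linear[OF comp this] show "(\<lambda>t. (0, axis j (snd (forcing z F t) $ j)) :: (complex^3) \<times> (complex^3)) integrable_on {0..L}"
      by (simp add: o_def)
  qed simp
  moreover have "(\<Sum>j\<in>UNIV. (0, axis j (snd (forcing z F t) $ j)) :: (complex^3) \<times> (complex^3)) = forcing z F t" for t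
    by (simp add: prod_eq_iff vec_eq_iff forall_3 sum_3 axis_def forcing_def)
  ultimately show ?thesis by simp
qed

text \<open>This reverses the elimination: velocities are rebuilt from the displacements and F. The
  remaining conjuncts record displacements and slopes so that the shooting argument can read off
  b.\<close>

lemma solution_state:
  assumes F: "F \<in> H" and sol: "ode_solves z (0, b) (forcing z F) Y" and end0: "fst (Y L) = 0"
  shows "\<exists>W p q. DA W p q \<and> nrm (sscale z W - opA P W - F) = 0 \<and>
    (\<forall>x. W 1 x = fst (Y x) $ 1 \<and> W 3 x = fst (Y x) $ 2 \<and> W 5 x = fst (Y x) $ 3 \<and>
         p 1 x = snd (Y x) $ 1 \<and> p 3 x = snd (Y x) $ 2 \<and> p 5 x = snd (Y x) $ 3) \<and> snd (Y 0) = b"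
proof -
  obtain K0 K1 where "volterra (A0 z) (A1 z) (damp P) L K0 K1 Ka" using volterra_instance by blast
  then interpret V: volterra "A0 z" "A1 z" "damp P" L K0 K1 Ka .
  have cY: "continuous_on {0..L} Y" using sol by (simp add: V.solves_def)
  have Yeq: "Y x = (0, b) + integral {0..x} (\<lambda>t. V.rhs t (Y t) + forcing z F t)" if "x \<in> {0..L}" for x
    using sol that unfolding V.solves_def by blast
  have int: "(\<lambda>t. V.rhs t (Y t) + forcing z F t) integrable_on {0..x}" if "x \<in> {0..L}" for x
    using that integrable_on_subinterval[OF forcing_integrable[OF F], of 0 x]
    by (auto intro!: integrable_add V.rhs_integrable cY)
  have Y0: "Y 0 = (0, b)" using Yeq[of 0] L0 by simp
  define w where "w j x = fst (Y x) $ j" for j x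
  define v where "v j x = snd (Y x) $ j" for j x
  define s where "s j x = snd (V.rhs x (Y x)) $ j + snd (forcing z F x) $ j" for j x
  have cw: "continuous_on {0..L} (w j)" "continuous_on {0..L} (v j)" for j
    unfolding w_def v_def by (intro continuous_intros cY)+
  have ww: "has_wderiv L (w j) (v j)" for j
  proof (rule wderivI[OF L2_continuous[OF cw(2)]])
    fix x assume "0 \<le> x" "x \<le> L"
    then have x: "x \<in> {0..L}" by simp
    have "fst (Y x) $ j = fst (integral {0..x} (\<lambda>t. V.rhs t (Y t) + forcing z F t)) $ j" using Yeq[OF x] by simp
    also have "\<dots> = integral {0..x} (v j)"
      unfolding integral_components(1)[OF int[OF x]] by (simp add: ode_rhs_components forcing_def v_def[abs_def])
    finally show "w j x = w j 0 + integral {0..x} (v j)" using Y0 by (simp add: w_def)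
  qed
  have s_eq: "s 1 = (\<lambda>x. N1 z (w 1 x) (v 2 x) (v 3 x) + snd (forcing z F x) $ 1)"
    "s 2 = (\<lambda>x. N3 z (w 2 x) (w 3 x) (v 1 x) + snd (forcing z F x) $ 2)"
    "s 3 = (\<lambda>x. (N5 z (w 2 x) (w 3 x) (v 1 x) + a x * (z / c3 * w 3 x)) + snd (forcing z F x) $ 3)"
    by (simp_all add: fun_eq_iff s_def w_def v_def ode_rhs_components)
  have "L2 L (s j)" for j
  proof -
    have "L2 L (s 1)" "L2 L (s 2)" "L2 L (s 3)"
      unfolding s_eq by (intro L2_add[OF _ forcing_components[OF F]] L2_add[OF _ damp_L2] L2_continuous;
        (unfold N1_def N3_def N5_def divide_inverse)?; intro continuous_intros cw)+
    then show ?thesis using exhaust_3[of j] by auto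
  qed
  then have vs: "has_wderiv L (v j) (s j)" for j
  proof (rule wderivI)
    fix x assume "0 \<le> x" "x \<le> L"
    then have x: "x \<in> {0..L}" by simp
    have "snd (Y x) $ j = b $ j + snd (integral {0..x} (\<lambda>t. V.rhs t (Y t) + forcing z F t)) $ j" using Yeq[OF x] by simp
    also have "\<dots> = b $ j + integral {0..x} (s j)"
      unfolding integral_components(2)[OF int[OF x]] by (simp add: s_def[abs_def])
    finally show "v j x = v j 0 + integral {0..x} (s j)" using Y0 by (simp add: v_def)
  qed
  have w0: "w j 0 = 0" "w j L = 0" for j using Y0 end0 by (simp_all add: w_def)
  define W :: state where "W i = (if i = 1 then w 1 else if i = 2 then (\<lambda>x. z * w 1 x - F 1 x)
     else if i = 3 then w 2 else if i = 4 then (\<lambda>x. z * w 2 x - F 3 x)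
     else if i = 5 then w 3 else (\<lambda>x. z * w 3 x - F 5 x))" for i
  define p where "p i = (if i = 1 then v 1 else if i = 2 then (\<lambda>x. z * v 1 x - wd L (F 1) x)
     else if i = 3 then v 2 else if i = 4 then (\<lambda>x. z * v 2 x - wd L (F 3) x)
     else if i = 5 then v 3 else (\<lambda>x. z * v 3 x - wd L (F 5) x))" for i :: nat
  define q where "q i = (if i = 1 then s 1 else if i = 3 then s 2 else s 3)" for i :: nat
  have W: "W 1 = w 1" "W 2 = (\<lambda>x. z * w 1 x - F 1 x)" "W 3 = w 2" "W 4 = (\<lambda>x. z * w 2 x - F 3 x)"
    "W 5 = w 3" "W 6 = (\<lambda>x. z * w 3 x - F 5 x)" "p 1 = v 1" "p 3 = v 2" "p 5 = v 3" "q 1 = s 1" "q 3 = s 2" "q 5 = s 3"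
    by (simp_all add: W_def p_def q_def)
  have DA: "DA W p q"
    unfolding DA_def
  proof (intro conjI ballI)
    fix i :: nat assume "i \<in> {1..6}"
    then have i: "i \<in> {1,2,3,4,5,6}" by (simp only: six)
    show "has_wderiv L (W i) (p i)"
      using i wderiv_diff[OF wderiv_cmult[OF ww[of 1], of z] H_wd(1)[OF F, of 1]]
        wderiv_diff[OF wderiv_cmult[OF ww[of 2], of z] H_wd(1)[OF F, of 3]]
        wderiv_diff[OF wderiv_cmult[OF ww[of 3], of z] H_wd(1)[OF F, of 5]] ww[of 1] ww[of 2] ww[of 3]
      by (auto simp: W_def p_def)
    show "W i 0 = 0" "W i L = 0"
      using i w0 H_wd(2,3)[OF F, of 1] H_wd(2,3)[OF F, of 3] H_wd(2,3)[OF F, of 5] by (auto simp: W_def)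
  next
    fix i :: nat assume "i \<in> {1,3,5}"
    then show "has_wderiv L (p i) (q i)" using vs[of 1] vs[of 2] vs[of 3] by (auto simp: p_def q_def)
  qed
  have nz: "r1 \<noteq> 0" "r2 \<noteq> 0" "c1 \<noteq> 0" "c2 \<noteq> 0" "c3 \<noteq> 0" using pos by auto
  have "nrm (sscale z W - opA P W - F) = 0"
  proof (rule zero_imp_null)
    show "sscale z W - opA P W - F \<in> H" by (intro mem DA_H[OF DA] opA_H[OF DA] F)
  next
    fix i :: nat and x assume "i \<in> {1,3,5}"
    then show "(sscale z W - opA P W - F) i x = 0"
      using opA_odd[of W] by (auto simp: sscale_def fun_diff_def W_def)
  next
    have 2: "ae (\<lambda>x. z * W 2 x - opA P W 2 x - F 2 x = 0)"
      using opA_AE(1)[OF DA]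
    proof eventually_elim
      case (elim x)
      have h: "c1 * (q 1 x + p 3 x + l * p 5 x) = r1 * (z * (z * w 1 x - F 1 x) - F 2 x) - l * c3 * (p 5 x - l * W 1 x)"
        unfolding W s_eq using nz by (simp add: N1_def forcing_def field_simps power2_eq_square)
      have "opA P W 2 x = (c1 * (q 1 x + p 3 x + l * p 5 x) + l * c3 * (p 5 x - l * W 1 x)) / r1"
        unfolding elim by (simp add: add_divide_distrib)
      also have "\<dots> = z * (z * w 1 x - F 1 x) - F 2 x" unfolding h using nz by simp
      finally show ?case unfolding W by simp
    qed
    have 4: "ae (\<lambda>x. z * W 4 x - opA P W 4 x - F 4 x = 0)"
      using opA_AE(2)[OF DA]
    proof eventually_elim
      case (elim x)
      have h: "c2 * q 3 x = r2 * (z * (z * w 2 x - F 3 x) - F 4 x) + c1 * (p 1 x + W 3 x + l * W 5 x)"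
        unfolding W s_eq using nz by (simp add: N3_def forcing_def field_simps power2_eq_square)
      have "opA P W 4 x = (c2 * q 3 x - c1 * (p 1 x + W 3 x + l * W 5 x)) / r2"
        unfolding elim by (simp add: diff_divide_distrib)
      also have "\<dots> = z * (z * w 2 x - F 3 x) - F 4 x" unfolding h using nz by simp
      finally show ?case unfolding W by simp
    qed
    have 6: "ae (\<lambda>x. z * W 6 x - opA P W 6 x - F 6 x = 0)"
      using opA_AE(3)[OF DA]
    proof eventually_elim
      case (elim x)
      have h: "c3 * (q 5 x - l * p 1 x) = r1 * (z * (z * w 3 x - F 5 x) - F 6 x) + l * c1 * (p 1 x + W 3 x + l * W 5 x) + a x * W 6 x"
        unfolding W s_eq using nz by (simp add: N5_def forcing_def field_simps power2_eq_square)
      have "opA P W 6 x = (c3 * (q 5 x - l * p 1 x) - l * c1 * (p 1 x + W 3 x + l * W 5 x) - a x * W 6 x) / r1"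
        unfolding elim by (simp add: diff_divide_distrib)
      also have "\<dots> = z * (z * w 3 x - F 5 x) - F 6 x" unfolding h using nz by simp
      finally show ?case unfolding W by simp
    qed
    fix i :: nat assume "i \<in> {2,4,6}"
    with 2 4 6 show "ae (\<lambda>x. (sscale z W - opA P W - F) i x = 0)"
      by (auto simp: sscale_def fun_diff_def)
  qed
  moreover have "\<forall>x. W 1 x = fst (Y x) $ 1 \<and> W 3 x = fst (Y x) $ 2 \<and> W 5 x = fst (Y x) $ 3 \<and>
      p 1 x = snd (Y x) $ 1 \<and> p 3 x = snd (Y x) $ 2 \<and> p 5 x = snd (Y x) $ 3"
    unfolding W w_def v_def by simp
  moreover have "snd (Y 0) = b" using Y0 by simp
  ultimately show ?thesis using DA by blast
qed

text \<open>Shooting: the map from initial slopes to boundary values at the right end is linear on a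
  finite-dimensional space, so injectivity gives surjectivity.\<close>

lemma fredholm_alternative:
  assumes inj: "\<And>u p q. DA u p q \<Longrightarrow> nrm (sscale z u - opA P u) = 0 \<Longrightarrow> nrm u = 0" and F: "F \<in> H"
  shows "\<exists>u p q. DA u p q \<and> nrm (sscale z u - opA P u - F) = 0"
proof -
  obtain K0 K1 where "volterra (A0 z) (A1 z) (damp P) L K0 K1 Ka" using volterra_instance by blast
  then interpret V: volterra "A0 z" "A1 z" "damp P" L K0 K1 Ka .
  note fi = forcing_integrable[OF H_zero, of z]
  have f0: "forcing z 0 = (\<lambda>t. 0)" by (simp add: fun_eq_iff forcing_zero)
  \<comment> \<open>A chosen solution with initial slopes b; \<open>solves_unique\<close> makes its
    values on [0, L], in particular at L, linear in b.\<close>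
  define Yb where "Yb b = (SOME Y. V.solves (0, b) (forcing z 0) Y)" for b
  have Yb: "V.solves (0, b) (forcing z 0) (Yb b)" for b
    unfolding Yb_def using someI_ex[OF V.solves_exists[OF fi]] .
  define T where "T b = fst (Yb b L)" for b
  have LL: "L \<in> {0..L}" using L0 by simp
  have "linear T"
  proof (rule linearI)
    fix b c
    have "V.solves (0, b + c) (forcing z 0) (\<lambda>x. Yb b x + Yb c x)"
      using V.solves_add[OF Yb[of b] Yb[of c] fi fi] by (simp add: f0)
    from V.solves_unique[OF Yb[of "b + c"] this LL fi] show "T (b + c) = T b + T c" by (simp add: T_def)
  next
    fix r :: real and b
    have "V.solves (0, r *\<^sub>R b) (forcing z 0) (\<lambda>x. r *\<^sub>R Yb b x)"
      using V.solves_scale[OF Yb[of b], of r] by (simp add: f0)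
    from V.solves_unique[OF Yb[of "r *\<^sub>R b"] this LL fi] show "T (r *\<^sub>R b) = r *\<^sub>R T b" by (simp add: T_def)
  qed
  moreover have "inj T"
    unfolding linear_injective_0[OF \<open>linear T\<close>]
  proof (intro allI impI)
    fix b assume "T b = 0"
    then obtain W p q where W: "DA W p q" "nrm (sscale z W - opA P W - 0) = 0" "snd (Yb b 0) = b"
      "\<And>x. p 1 x = snd (Yb b x) $ 1" "\<And>x. p 3 x = snd (Yb b x) $ 2" "\<And>x. p 5 x = snd (Yb b x) $ 3"
      using solution_state[OF H_zero Yb[of b]] unfolding T_def by blast
    have nW: "nrm W = 0" using inj[OF W(1)] W(2) by simp
    \<comment> \<open>A null state has zero displacements, and its continuous slopes are weak
      derivatives of zero, hence zero at 0; these slopes are the entries of b.\<close>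
    have "p i 0 = 0" if i: "i \<in> {1,3,5}" for i
    proof -
      have i6: "i \<in> {1..6}" using i by auto
      have z: "has_wderiv L (W i) (\<lambda>x. 0)"
        by (rule wderivI) (use null_imp_zero(1)[OF DA_H[OF W(1)] nW i] L0 in \<open>auto intro: L2_continuous\<close>)
      show ?thesis
        by (rule wderiv_unique_continuous[OF DA_wderiv(1)[OF W(1) i6] z wderiv_continuous[OF DA_wderiv(4)[OF W(1) i]] _ pos(7)])
          (use L0 in auto)
    qed
    from this[of 1] this[of 3] this[of 5] show "b = 0"
      using W(3-6) by (simp add: vec_eq_iff forall_3 del: One_nat_def)
  qed
  ultimately have "surj T" by (rule linear_inj_imp_surj)
  obtain YF where YF: "V.solves (0, 0) (forcing z F) YF" using V.solves_exists[OF forcing_integrable[OF F]] by blast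
  \<comment> \<open>The particular solution starts with zero slopes; surjectivity picks the
    homogeneous solution that corrects its value at L.\<close>
  obtain b where b: "T b = - fst (YF L)" using \<open>surj T\<close> by (metis surjD)
  have "V.solves (0, b) (forcing z F) (\<lambda>x. YF x + Yb b x)"
    using V.solves_add[OF YF Yb[of b] forcing_integrable[OF F] fi] by (simp add: f0)
  from solution_state[OF F this] show ?thesis using b unfolding T_def by auto
qed

end

section \<open>Density and compactness\<close>

lemma norm_vector3_le: "norm (vector [x, y, z] :: complex^3) \<le> cmod x + cmod y + cmod z"
proof -
  have "norm (vector [x, y, z] :: complex^3) \<le> (\<Sum>i\<in>UNIV. norm ((vector [x, y, z] :: complex^3) $ i))"
    unfolding norm_vec_def by (rule L2_set_le_sum) simp
  then show ?thesis by (simp add: sum_3)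
qed

text \<open>Approximate the derivative g by h and subtract the mean of h, so that the primitive
  vanishes at L. Since g has mean zero, Cauchy-Schwarz bounds that mean by the error g - h; the two
  errors of e/4, both doubled, add up to e.\<close>

lemma H10_dense:
  assumes u: "has_wderiv L u g" "u 0 = 0" "u L = 0" and L: "0 < L" and e: "0 < e"
  shows "\<exists>w p q. has_wderiv L w p \<and> has_wderiv L p q \<and> w 0 = 0 \<and> w L = 0 \<and> l2ip L (\<lambda>x. g x - p x) (\<lambda>x. g x - p x) < e"
proof -
  note g = wderiv_L2[OF u(1)]
  obtain h h' where h: "has_wderiv L h h'" "l2ip L (\<lambda>x. g x - h x) (\<lambda>x. g x - h x) < e/4"
    using L2_dense_C1[OF g _ L, of "e/4"] e by auto
  have ch: "continuous_on {0..L} h" by (rule wderiv_continuous[OF h(1)])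
  define m where "m = integral {0..L} h / of_real L"
  define p where "p x = h x - m" for x
  have zero: "has_wderiv L (\<lambda>x. m) (\<lambda>x. 0)" by (rule wderivI) (auto intro: L2_continuous)
  have p: "has_wderiv L p (\<lambda>x. h' x - 0)" unfolding p_def by (rule wderiv_diff[OF h(1) zero])
  define w where "w x = integral {0..x} p" for x
  have w: "has_wderiv L w p" by (rule wderivI) (auto simp: w_def intro: L2_continuous wderiv_continuous[OF p])
  have "integral {0..L} p = integral {0..L} h - integral {0..L} (\<lambda>x. m)"
    unfolding p_def by (rule integral_diff) (auto intro: integrable_continuous_real ch)
  also have "\<dots> = 0" using L by (simp add: m_def scaleR_conv_of_real)
  finally have wL: "w L = 0" by (simp add: w_def)
  have "integral {0..L} g = 0" using wderiv_eq[OF u(1), of L] u L by simp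
  then have "of_real L * m = integral {0..L} (\<lambda>x. h x - g x)"
    using integral_diff[OF integrable_continuous_real[OF ch] L2_integrable[OF g, of 0 L]] L by (simp add: m_def)
  then have "L * cmod m = cmod (integral {0..L} (\<lambda>x. h x - g x))"
    using L by (metis abs_of_pos norm_mult norm_of_real)
  also have "\<dots> \<le> integral {0..L} (\<lambda>x. cmod (g x - h x))"
    using L2_integrable[OF L2_diff[OF L2_continuous[OF ch] g], of 0 L] L2_norm_integrable[OF L2_diff[OF g L2_continuous[OF ch]], of 0 L]
    by (intro integral_norm_bound_integral) (auto simp: norm_minus_commute)
  finally have "(L * cmod m)\<^sup>2 \<le> (integral {0..L} (\<lambda>x. cmod (g x - h x)))\<^sup>2"
    using L by (intro power_mono) auto
  also have "\<dots> \<le> (L - 0) * l2ip L (\<lambda>x. g x - h x) (\<lambda>x. g x - h x)"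
    unfolding l2ip_self using L by (intro L2_cauchy_schwarz[OF L2_diff[OF g L2_continuous[OF ch]]]) auto
  finally have "L * (L * (cmod m)\<^sup>2) \<le> L * l2ip L (\<lambda>x. g x - h x) (\<lambda>x. g x - h x)"
    by (simp add: power_mult_distrib power2_eq_square mult_ac)
  then have "L * (cmod m)\<^sup>2 \<le> l2ip L (\<lambda>x. g x - h x) (\<lambda>x. g x - h x)" using L by simp
  moreover have "l2ip L (\<lambda>x. m) (\<lambda>x. m) \<le> L * (cmod m)\<^sup>2" using L by (intro l2ip_le_sup L2_continuous) auto
  moreover have "l2ip L (\<lambda>x. (g x - h x) + m) (\<lambda>x. (g x - h x) + m) \<le> 2 * l2ip L (\<lambda>x. g x - h x) (\<lambda>x. g x - h x) + 2 * l2ip L (\<lambda>x. m) (\<lambda>x. m)"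
    by (rule l2ip_triangle[OF L2_diff[OF g L2_continuous[OF ch]]]) (auto intro: L2_continuous)
  moreover have "(\<lambda>x. (g x - h x) + m) = (\<lambda>x. g x - p x)" by (simp add: p_def fun_eq_iff)
  ultimately have "l2ip L (\<lambda>x. g x - p x) (\<lambda>x. g x - p x) < e" using h(2) by simp
  moreover have "w 0 = 0" by (simp add: w_def)
  ultimately show ?thesis using w p wL by blast
qed

text \<open>Average over y the inequality |u x|^2 \<le> 2 |u y|^2 + 2 |u x - u y|^2. It applies to
  slopes, whose boundary values are not prescribed.\<close>

lemma wderiv_sup_le:
  assumes u: "has_wderiv L u g" and L: "0 < L" and x: "x \<in> {0..L}"
  shows "(cmod (u x))\<^sup>2 \<le> 2 / L * l2ip L u u + 2 * L * l2ip L g g"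
proof -
  note Lu = L2_continuous[OF wderiv_continuous[OF u]]
  have nn: "0 \<le> l2ip L g g" by (rule l2ip_nonneg[OF wderiv_L2[OF u]])
  have "integral {0..L} (\<lambda>y. (cmod (u x))\<^sup>2) \<le> integral {0..L} (\<lambda>y. 2 * (cmod (u y))\<^sup>2 + 2 * L * l2ip L g g)"
  proof (rule integral_le)
    show "(\<lambda>y. 2 * (cmod (u y))\<^sup>2 + 2 * L * l2ip L g g) integrable_on {0..L}"
      using integrable_on_cmult_left[OF L2_sq[OF Lu], of 2] by (intro integrable_add) auto
    fix y assume y: "y \<in> {0..L}"
    have "(cmod (u x))\<^sup>2 \<le> (cmod (u y) + cmod (u x - u y))\<^sup>2"
      using norm_triangle_ineq[of "u y" "u x - u y"] by (intro power_mono) auto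
    also have "\<dots> \<le> 2 * (cmod (u y))\<^sup>2 + 2 * (cmod (u x - u y))\<^sup>2"
      using sum_squares_bound[of "cmod (u y)" "cmod (u x - u y)"] by (simp add: power2_sum)
    also have "(cmod (u x - u y))\<^sup>2 \<le> \<bar>x - y\<bar> * l2ip L g g" by (rule wderiv_holder[OF u y x])
    also have "\<dots> \<le> L * l2ip L g g" using x y nn by (intro mult_right_mono) auto
    finally show "(cmod (u x))\<^sup>2 \<le> 2 * (cmod (u y))\<^sup>2 + 2 * L * l2ip L g g" by simp
  qed auto
  also have "\<dots> = 2 * l2ip L u u + L * (2 * L * l2ip L g g)"
    using integrable_on_cmult_left[OF L2_sq[OF Lu], of 2] L by (subst integral_add) (auto simp: l2ip_self)
  finally have "L * (cmod (u x))\<^sup>2 \<le> L * (2 / L * l2ip L u u + 2 * L * l2ip L g g)"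
    using L by (simp add: algebra_simps)
  then show ?thesis using L by simp
qed

text \<open>Boundedness without naming the bound, so that it follows the shape of an expression when
  derivatives are recovered from strains and from the operator.\<close>

definition L2_bounded :: "real \<Rightarrow> (nat \<Rightarrow> real \<Rightarrow> complex) \<Rightarrow> bool" where
  "L2_bounded L f \<longleftrightarrow> (\<forall>n. L2 L (f n)) \<and> (\<exists>M. \<forall>n. l2ip L (f n) (f n) \<le> M)"

lemma L2_boundedI: "(\<And>n. L2 L (f n)) \<Longrightarrow> (\<And>n. l2ip L (f n) (f n) \<le> M) \<Longrightarrow> L2_bounded L f"
  unfolding L2_bounded_def by blast

lemma L2_bounded_add:
  assumes "L2_bounded L f" "L2_bounded L g" shows "L2_bounded L (\<lambda>n x. f n x + g n x)"
proof -
  obtain M N where M: "\<And>n. l2ip L (f n) (f n) \<le> M" and N: "\<And>n. l2ip L (g n) (g n) \<le> N"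
    using assms unfolding L2_bounded_def by blast
  have L2: "L2 L (f n)" "L2 L (g n)" for n using assms unfolding L2_bounded_def by blast+
  show ?thesis
  proof (rule L2_boundedI)
    show "L2 L (\<lambda>x. f n x + g n x)" for n by (intro L2_add L2)
    show "l2ip L (\<lambda>x. f n x + g n x) (\<lambda>x. f n x + g n x) \<le> 2 * M + 2 * N" for n
      using l2ip_triangle[OF L2, of n n] M[of n] N[of n] by linarith
  qed
qed

lemma l2ip_cmult: "l2ip L (\<lambda>x. c * f x) (\<lambda>x. c * f x) = (cmod c)\<^sup>2 * l2ip L f f"
  unfolding l2ip_self by (simp add: norm_mult power_mult_distrib)

lemma L2_bounded_cmult:
  assumes "L2_bounded L f" shows "L2_bounded L (\<lambda>n x. c * f n x)"
proof -
  obtain M where M: "\<And>n. l2ip L (f n) (f n) \<le> M" using assms unfolding L2_bounded_def by blast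
  show ?thesis
  proof (rule L2_boundedI)
    show "L2 L (\<lambda>x. c * f n x)" for n using assms unfolding L2_bounded_def by (intro L2_cmult) blast
    show "l2ip L (\<lambda>x. c * f n x) (\<lambda>x. c * f n x) \<le> (cmod c)\<^sup>2 * M" for n
      unfolding l2ip_cmult using M by (intro mult_left_mono) auto
  qed
qed

lemma L2_bounded_diff: "L2_bounded L f \<Longrightarrow> L2_bounded L g \<Longrightarrow> L2_bounded L (\<lambda>n x. f n x - g n x)"
  using L2_bounded_add[OF _ L2_bounded_cmult[of L g "-1"]] by simp

lemma L2_bounded_cong_AE:
  assumes "L2_bounded L f" "\<And>n. AE x in lebesgue_on {0..L}. g n x = f n x" shows "L2_bounded L g"
proof -
  have sw: "AE x in lebesgue_on {0..L}. f n x = g n x" for n using assms(2)[of n] by (auto elim: eventually_mono)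
  obtain M where M: "\<And>n. l2ip L (f n) (f n) \<le> M" using assms(1) unfolding L2_bounded_def by blast
  show ?thesis
  proof (rule L2_boundedI)
    show "L2 L (g n)" for n using assms(1) unfolding L2_bounded_def by (intro L2_cong_AE[OF _ sw]) blast
    show "l2ip L (g n) (g n) \<le> M" for n using l2ip_cong_AE[OF assms(2) assms(2), of n n] M by simp
  qed
qed

context bresse
begin

lemma inDA_dense:
  assumes U: "U \<in> H" and e: "0 < e"
  shows "\<exists>W. inDA P W \<and> nrm (U - W) < e"
proof -
  \<comment> \<open>\<open>energy_le\<close> costs a factor 6 CU, so seven in the denominator keeps
    the inequality strict.\<close>
  define M where "M = e\<^sup>2 / (7 * CU)"
  have M: "0 < M" using e CU_pos by (simp add: M_def)
  define R where "R i w p q \<longleftrightarrow> has_wderiv L w p \<and> w 0 = 0 \<and> w L = 0 \<and>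
      (i \<in> {1,3,5} \<longrightarrow> has_wderiv L p q \<and> l2ip L (\<lambda>x. wd L (U i) x - p x) (\<lambda>x. wd L (U i) x - p x) \<le> M) \<and>
      (i \<in> {2,4,6} \<longrightarrow> l2ip L (\<lambda>x. U i x - w x) (\<lambda>x. U i x - w x) \<le> M)" for i w p q
  have "\<exists>w p q. R i w p q" if i: "i \<in> {1..6}" for i
  proof (cases "i \<in> {1,3,5}")
    case True
    obtain w p q where "has_wderiv L w p" "has_wderiv L p q" "w 0 = 0" "w L = 0" "l2ip L (\<lambda>x. wd L (U i) x - p x) (\<lambda>x. wd L (U i) x - p x) < M"
      using H10_dense[OF H_wd[OF U True] pos(7) M] by blast
    then show ?thesis using True unfolding R_def by (intro exI[of _ w] exI[of _ p] exI[of _ q]) auto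
  next
    case False
    then have i2: "i \<in> {2,4,6}" using i by (simp, arith)
    obtain w p where "has_wderiv L w p" "w 0 = 0" "w L = 0" "l2ip L (\<lambda>x. U i x - w x) (\<lambda>x. U i x - w x) < M"
      using L2_dense_C1[OF H_L2_even[OF U i2] M pos(7)] by blast
    then show ?thesis using False i2 unfolding R_def by (intro exI[of _ w] exI[of _ p]) auto
  qed
  then obtain W p q where R: "\<And>i. i \<in> {1..6} \<Longrightarrow> R i (W i) (p i) (q i)" by metis
  have W: "has_wderiv L (W i) (p i) \<and> W i 0 = 0 \<and> W i L = 0" if "i \<in> {1..6}" for i
    using R[OF that] unfolding R_def by blast
  have W1: "has_wderiv L (p i) (q i) \<and> l2ip L (\<lambda>x. wd L (U i) x - p i x) (\<lambda>x. wd L (U i) x - p i x) \<le> M"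
    if "i \<in> {1..6}" "i \<in> {1,3,5}" for i
    using R[OF that(1)] that(2) unfolding R_def by blast
  have W2: "l2ip L (\<lambda>x. U i x - W i x) (\<lambda>x. U i x - W i x) \<le> M" if "i \<in> {1..6}" "i \<in> {2,4,6}" for i
    using R[OF that(1)] that(2) unfolding R_def by blast
  have i6: "i \<in> {1,3,5} \<Longrightarrow> i \<in> {1..6::nat}" "i \<in> {2,4,6} \<Longrightarrow> i \<in> {1..6::nat}" for i :: nat by auto
  have D: "DA W p q" unfolding DA_def using W W1 i6(1) by blast
  have "(nrm (U - W))\<^sup>2 \<le> 6 * CU * M"
  proof (rule energy_le[where p="\<lambda>i x. wd L (U i) x - p i x"])
    show "U - W \<in> H" by (intro mem U DA_H[OF D])
    show "has_wderiv L ((U - W) i) (\<lambda>x. wd L (U i) x - p i x)" if "i \<in> {1,3,5}" for i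
      using wderiv_diff[OF H_wd(1)[OF U that]] W[OF i6(1)[OF that]] by (simp add: fun_diff_def)
    show "l2ip L ((U - W) i) ((U - W) i) \<le> M" if "i \<in> {2,4,6}" for i
      using W2[OF i6(2)[OF that] that] by (simp add: fun_diff_def)
  qed (use W1 i6(1) in blast)
  also have "\<dots> < e\<^sup>2" using e CU_pos by (simp add: M_def field_simps)
  finally have "nrm (U - W) < e" by (rule power2_less_imp_less[OF _ less_imp_le[OF e]])
  then show ?thesis using D inDA_iff by blast
qed

text \<open>Strains of X and of A X bound all six first derivatives, and the operator equations
  bound the second derivatives of the displacements. Arzela-Ascoli is then applied to what the
  energy measures, slopes of displacements and velocities; the limiting displacements are obtained
  by integration.\<close>

lemma inDA_compact_embedding:
  assumes D: "\<And>n. inDA P (X n)" and C: "\<And>n. nrm (X n) \<le> C" "\<And>n. nrm (opA P (X n)) \<le> C"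
  shows "\<exists>r w. strict_mono (r :: nat \<Rightarrow> nat) \<and> w \<in> H \<and> (\<lambda>n. nrm (X (r n) - w)) \<longlonglongrightarrow> 0"
proof -
  obtain p q where DA: "\<And>n. DA (X n) (p n) (q n)" using D unfolding inDA_iff by metis
  note XH = DA_H[OF DA] and AH = opA_H[OF DA]
  note w = DA_wderiv[OF DA] and L2s = DA_L2[OF DA]
  have CC0: "0 \<le> CC" unfolding CC_def using L0 pos wmin(1) by (intro add_nonneg_nonneg mult_nonneg_nonneg divide_nonneg_nonneg) auto
  have egX: "L2_bounded L (\<lambda>n. eg (X n) i)" if "i \<in> {1..6}" for i
  proof (rule L2_boundedI[OF eg_L2[OF XH]])
    show "l2ip L (eg (X n) i) (eg (X n) i) \<le> C\<^sup>2 / wmin" for n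
      using l2_eg_le[OF XH that, of n] power_mono[OF C(1)[of n] nrm_nonneg[OF XH], of 2] wmin(1)
      by (meson divide_right_mono less_imp_le order_trans)
  qed
  have egA: "L2_bounded L (\<lambda>n. eg (opA P (X n)) i)" if "i \<in> {1..6}" for i
  proof (rule L2_boundedI[OF eg_L2[OF AH]])
    show "l2ip L (eg (opA P (X n)) i) (eg (opA P (X n)) i) \<le> C\<^sup>2 / wmin" for n
      using l2_eg_le[OF AH that, of n] power_mono[OF C(2)[of n] nrm_nonneg[OF AH], of 2] wmin(1)
      by (meson divide_right_mono less_imp_le order_trans)
  qed
  \<comment> \<open>The velocities of X are the displacement components of A X, so
    \<open>coercive\<close> applied to A X bounds them.\<close>
  have supX: "cmod (X n i x) \<le> CC * C" if i: "i \<in> {1..6}" and x: "x \<in> {0..L}" for n i x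
  proof -
    have "CC * nrm (X n) \<le> CC * C" "CC * nrm (opA P (X n)) \<le> CC * C" using C CC0 by (auto intro: mult_left_mono)
    moreover have "i = 1 \<or> i = 2 \<or> i = 3 \<or> i = 4 \<or> i = 5 \<or> i = 6" using i by (simp, arith)
    ultimately show ?thesis using coercive[OF XH x, of n] coercive[OF AH x, of n] unfolding opA_odd
      by (elim disjE) (simp_all del: One_nat_def)
  qed
  have bX: "L2_bounded L (\<lambda>n. X n i)" if "i \<in> {1..6}" for i
    by (rule L2_boundedI[OF L2s(1)[OF that]]) (rule l2ip_le_sup[OF L2s(1)[OF that] supX[OF that] L0])
  have 1: "L2_bounded L (\<lambda>n x. eg (X n) 1 x - X n 3 x - l * X n 5 x)"
    by (intro L2_bounded_diff L2_bounded_cmult egX bX) auto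
  have "ae (\<lambda>x. p n 1 x = eg (X n) 1 x - X n 3 x - l * X n 5 x)" for n
    using eg_DA(1)[OF DA, of n] by eventually_elim simp
  then have bp1: "L2_bounded L (\<lambda>n. p n 1)" by (rule L2_bounded_cong_AE[OF 1])
  have 1: "L2_bounded L (\<lambda>n. eg (X n) 3)" by (rule egX) auto
  have "ae (\<lambda>x. p n 3 x = eg (X n) 3 x)" for n
    using eg_DA(2)[OF DA, of n] by eventually_elim simp
  then have bp3: "L2_bounded L (\<lambda>n. p n 3)" by (rule L2_bounded_cong_AE[OF 1])
  have 1: "L2_bounded L (\<lambda>n x. eg (X n) 5 x + l * X n 1 x)"
    by (intro L2_bounded_add L2_bounded_cmult egX bX) auto
  have "ae (\<lambda>x. p n 5 x = eg (X n) 5 x + l * X n 1 x)" for n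
    using eg_DA(3)[OF DA, of n] by eventually_elim simp
  then have bp5: "L2_bounded L (\<lambda>n. p n 5)" by (rule L2_bounded_cong_AE[OF 1])
  have 1: "L2_bounded L (\<lambda>n x. eg (opA P (X n)) 1 x - X n 4 x - l * X n 6 x)"
    by (intro L2_bounded_diff L2_bounded_cmult egA bX) auto
  have "ae (\<lambda>x. p n 2 x = eg (opA P (X n)) 1 x - X n 4 x - l * X n 6 x)" for n
    using eg_opA(1)[OF DA, of n] by eventually_elim simp
  then have bp2: "L2_bounded L (\<lambda>n. p n 2)" by (rule L2_bounded_cong_AE[OF 1])
  have 1: "L2_bounded L (\<lambda>n. eg (opA P (X n)) 3)" by (rule egA) auto
  have "ae (\<lambda>x. p n 4 x = eg (opA P (X n)) 3 x)" for n
    using eg_opA(2)[OF DA, of n] by eventually_elim simp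
  then have bp4: "L2_bounded L (\<lambda>n. p n 4)" by (rule L2_bounded_cong_AE[OF 1])
  have 1: "L2_bounded L (\<lambda>n x. eg (opA P (X n)) 5 x + l * X n 2 x)"
    by (intro L2_bounded_add L2_bounded_cmult egA bX) auto
  have "ae (\<lambda>x. p n 6 x = eg (opA P (X n)) 5 x + l * X n 2 x)" for n
    using eg_opA(3)[OF DA, of n] by eventually_elim simp
  then have bp6: "L2_bounded L (\<lambda>n. p n 6)" by (rule L2_bounded_cong_AE[OF 1])
  have nz: "r1 \<noteq> 0" "r2 \<noteq> 0" "c1 \<noteq> 0" "c2 \<noteq> 0" "c3 \<noteq> 0" using pos by auto
  have egA': "L2_bounded L (\<lambda>n. opA P (X n) i)" if "i \<in> {2,4,6}" for i
    using egA[of i] that by (auto simp: eg_even)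
  have "L2_bounded L (\<lambda>n x. r1 / c1 * opA P (X n) 2 x - p n 3 x - l * p n 5 x - l * c3 / c1 * (p n 5 x - l * X n 1 x))"
    by (intro L2_bounded_diff L2_bounded_cmult egA' bX bp3 bp5) auto
  then have bq1: "L2_bounded L (\<lambda>n. q n 1)"
  proof (rule L2_bounded_cong_AE)
    show "ae (\<lambda>x. q n 1 x = r1 / c1 * opA P (X n) 2 x - p n 3 x - l * p n 5 x - l * c3 / c1 * (p n 5 x - l * X n 1 x))" for n
      using opA_AE(1)[OF DA, of n]
    proof eventually_elim
      case (elim x)
      show ?case unfolding elim using nz by (simp add: field_simps)
    qed
  qed
  have "L2_bounded L (\<lambda>n x. r2 / c2 * opA P (X n) 4 x + c1 / c2 * (p n 1 x + X n 3 x + l * X n 5 x))"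
    by (intro L2_bounded_add L2_bounded_cmult egA' bX bp1) auto
  then have bq3: "L2_bounded L (\<lambda>n. q n 3)"
  proof (rule L2_bounded_cong_AE)
    show "ae (\<lambda>x. q n 3 x = r2 / c2 * opA P (X n) 4 x + c1 / c2 * (p n 1 x + X n 3 x + l * X n 5 x))" for n
      using opA_AE(2)[OF DA, of n]
    proof eventually_elim
      case (elim x)
      show ?case unfolding elim using nz by (simp add: field_simps)
    qed
  qed
  have "L2_bounded L (\<lambda>n x. a x * X n 6 x)"
  proof (rule L2_boundedI)
    show "L2 L (\<lambda>x. a x * X n 6 x)" for n by (intro damp_L2 L2s) auto
    show "l2ip L (\<lambda>x. a x * X n 6 x) (\<lambda>x. a x * X n 6 x) \<le> L * (Ka * (CC * C))\<^sup>2" for n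
    proof (rule l2ip_le_sup[OF _ _ L0])
      show "L2 L (\<lambda>x. a x * X n 6 x)" by (intro damp_L2 L2s) auto
      show "cmod (a x * X n 6 x) \<le> Ka * (CC * C)" if "x \<in> {0..L}" for x
        unfolding norm_mult using damp_bound(1)[OF that] damp_bound(2) supX[of 6 x n] that by (intro mult_mono) auto
    qed
  qed
  then have "L2_bounded L (\<lambda>n x. r1 / c3 * opA P (X n) 6 x + l * p n 1 x + l * c1 / c3 * (p n 1 x + X n 3 x + l * X n 5 x) + 1 / c3 * (a x * X n 6 x))"
    by (intro L2_bounded_add L2_bounded_cmult egA' bX bp1) auto
  then have bq5: "L2_bounded L (\<lambda>n. q n 5)"
  proof (rule L2_bounded_cong_AE)
    show "ae (\<lambda>x. q n 5 x = r1 / c3 * opA P (X n) 6 x + l * p n 1 x + l * c1 / c3 * (p n 1 x + X n 3 x + l * X n 5 x) + 1 / c3 * (a x * X n 6 x))" for n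
      using opA_AE(3)[OF DA, of n]
    proof eventually_elim
      case (elim x)
      show ?case unfolding elim using nz by (simp add: field_simps)
    qed
  qed
  have pw: "\<exists>M. \<forall>n. l2ip L (f n) (f n) \<le> M" if "L2_bounded L f" for f
    using that unfolding L2_bounded_def by blast
  obtain m1 m2 m3 m4 m5 m6 n1 n3 n5 where mm:
    "\<And>n. l2ip L (p n 1) (p n 1) \<le> m1" "\<And>n. l2ip L (p n 2) (p n 2) \<le> m2" "\<And>n. l2ip L (p n 3) (p n 3) \<le> m3"
    "\<And>n. l2ip L (p n 4) (p n 4) \<le> m4" "\<And>n. l2ip L (p n 5) (p n 5) \<le> m5" "\<And>n. l2ip L (p n 6) (p n 6) \<le> m6"
    "\<And>n. l2ip L (q n 1) (q n 1) \<le> n1" "\<And>n. l2ip L (q n 3) (q n 3) \<le> n3" "\<And>n. l2ip L (q n 5) (q n 5) \<le> n5"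
    using pw[OF bp1] pw[OF bp2] pw[OF bp3] pw[OF bp4] pw[OF bp5] pw[OF bp6] pw[OF bq1] pw[OF bq3] pw[OF bq5] by metis
  define M where "M = Max {0, m1, m2, m3, m4, m5, m6, n1, n3, n5}"
  have leM: "0 \<le> M" "m1 \<le> M" "m2 \<le> M" "m3 \<le> M" "m4 \<le> M" "m5 \<le> M" "m6 \<le> M" "n1 \<le> M" "n3 \<le> M" "n5 \<le> M"
    unfolding M_def by (rule Max_ge; simp)+
  note M0 = leM(1)
  have Mp: "l2ip L (p n i) (p n i) \<le> M" if i: "i \<in> {1..6}" for n i
  proof -
    have "i = 1 \<or> i = 2 \<or> i = 3 \<or> i = 4 \<or> i = 5 \<or> i = 6" using i by (simp, arith)
    then show ?thesis using mm(1)[THEN order_trans, OF leM(2)]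
        mm(2)[THEN order_trans, OF leM(3)] mm(3)[THEN order_trans, OF leM(4)] mm(4)[THEN order_trans, OF leM(5)]
        mm(5)[THEN order_trans, OF leM(6)] mm(6)[THEN order_trans, OF leM(7)] by blast
  qed
  have Mq: "l2ip L (q n i) (q n i) \<le> M" if i: "i \<in> {1,3,5}" for n i
    using i mm(7)[THEN order_trans, OF leM(8)] mm(8)[THEN order_trans, OF leM(9)] mm(9)[THEN order_trans, OF leM(10)] by blast
  define B where "B = sqrt (2 / L * M + 2 * L * M) + CC * C"
  have supp: "cmod (p n i x) \<le> sqrt (2 / L * M + 2 * L * M)" if i: "i \<in> {1,3,5}" and x: "x \<in> {0..L}" for n i x
  proof (rule real_le_rsqrt)
    have i6: "i \<in> {1..6}" using i by auto
    have "(cmod (p n i x))\<^sup>2 \<le> 2 / L * l2ip L (p n i) (p n i) + 2 * L * l2ip L (q n i) (q n i)"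
      by (rule wderiv_sup_le[OF w(4)[OF i] pos(7) x])
    also have "\<dots> \<le> 2 / L * M + 2 * L * M"
      using Mp[OF i6, of n] Mq[OF i, of n] L0 by (intro add_mono mult_left_mono) auto
    finally show "(cmod (p n i x))\<^sup>2 \<le> 2 / L * M + 2 * L * M" .
  qed
  \<comment> \<open>All six functions go into a single vector, so one extraction of a subsequence
    serves them together.\<close>
  define \<Phi> where "\<Phi> n x = ((vector [p n 1 x, p n 3 x, p n 5 x], vector [X n 2 x, X n 4 x, X n 6 x]) :: (complex^3) \<times> (complex^3))" for n x
  have norm6: "norm ((vector [x1, x2, x3], vector [x4, x5, x6]) :: (complex^3) \<times> (complex^3))
      \<le> cmod x1 + cmod x2 + cmod x3 + (cmod x4 + cmod x5 + cmod x6)" for x1 x2 x3 x4 x5 x6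
    by (rule order_trans[OF norm_Pair_le add_mono[OF norm_vector3_le norm_vector3_le]])
  have holder: "cmod (f x - f y) \<le> sqrt (\<bar>x - y\<bar> * M)" if "has_wderiv L f g" "l2ip L g g \<le> M" "x \<in> {0..L}" "y \<in> {0..L}" for f g x y
  proof (rule real_le_rsqrt)
    have "(cmod (f x - f y))\<^sup>2 \<le> \<bar>x - y\<bar> * l2ip L g g" by (rule wderiv_holder[OF that(1,4,3)])
    also have "\<dots> \<le> \<bar>x - y\<bar> * M" using that(2) by (intro mult_left_mono) auto
    finally show "(cmod (f x - f y))\<^sup>2 \<le> \<bar>x - y\<bar> * M" .
  qed
  have diff6: "\<Phi> n x - \<Phi> n y = (vector [p n 1 x - p n 1 y, p n 3 x - p n 3 y, p n 5 x - p n 5 y],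
      vector [X n 2 x - X n 2 y, X n 4 x - X n 4 y, X n 6 x - X n 6 y])" for n x y
    by (simp add: \<Phi>_def prod_eq_iff vec_eq_iff forall_3)
  obtain g k where g: "continuous_on {0..L} g" "strict_mono (k :: nat \<Rightarrow> nat)"
    "\<And>e. 0 < e \<Longrightarrow> \<exists>N. \<forall>n x. N \<le> n \<and> x \<in> {0..L} \<longrightarrow> norm (\<Phi> (k n) x - g x) < e"
  proof (rule Arzela_Ascoli[of "{0..L}" \<Phi> "6 * B"])
    show "norm (\<Phi> n x) \<le> 6 * B" if x: "x \<in> {0..L}" for n x
    proof -
      have nn: "0 \<le> sqrt (2 / L * M + 2 * L * M)" using M0 L0 by simp
      have "0 \<le> C" using C(1)[of 0] nrm_nonneg[OF XH, of 0] by simp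
      then have nn': "0 \<le> CC * C" using CC0 by simp
      have pB: "cmod (p n i x) \<le> B" if "i \<in> {1,3,5}" for i using supp[OF that x, of n] nn nn' unfolding B_def by linarith
      have XB: "cmod (X n i x) \<le> B" if "i \<in> {1..6}" for i using supX[OF that x, of n] nn nn' unfolding B_def by linarith
      show ?thesis unfolding \<Phi>_def using norm6[of "p n 1 x" "p n 3 x" "p n 5 x" "X n 2 x" "X n 4 x" "X n 6 x"]
        pB[of 1] pB[of 3] pB[of 5] XB[of 2] XB[of 4] XB[of 6] by simp
    qed
    show "\<exists>d>0. \<forall>n y. y \<in> {0..L} \<and> norm (x - y) < d \<longrightarrow> norm (\<Phi> n x - \<Phi> n y) < e" if x: "x \<in> {0..L}" and e: "0 < e" for x e
    \<comment> \<open>This radius makes every component vary by less than e/6; M + 1 avoids division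
      by zero.\<close>
    proof (intro exI[of _ "e\<^sup>2 / (36 * (M + 1))"] conjI allI impI)
      show "0 < e\<^sup>2 / (36 * (M + 1))" using e M0 by simp
      fix n y assume y: "y \<in> {0..L} \<and> norm (x - y) < e\<^sup>2 / (36 * (M + 1))"
      then have "\<bar>x - y\<bar> * M \<le> e\<^sup>2 / (36 * (M + 1)) * M" using M0 by (intro mult_right_mono) auto
      also have "\<dots> < (e / 6)\<^sup>2" using e M0 by (simp add: field_simps power2_eq_square)
      finally have "sqrt (\<bar>x - y\<bar> * M) < sqrt ((e / 6)\<^sup>2)" by (rule real_sqrt_less_mono)
      then have s: "sqrt (\<bar>x - y\<bar> * M) < e / 6" using e by simp
      have hp: "cmod (p n i x - p n i y) < e / 6" if "i \<in> {1,3,5}" for i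
        using holder[OF w(4)[OF that, of n] Mq[OF that, of n] x, of y] y s by simp
      have hX: "cmod (X n i x - X n i y) < e / 6" if "i \<in> {1..6}" for i
        using holder[OF w(1)[OF that, of n] Mp[OF that, of n] x, of y] y s by simp
      show "norm (\<Phi> n x - \<Phi> n y) < e" unfolding diff6
        using norm6[of "p n 1 x - p n 1 y" "p n 3 x - p n 3 y" "p n 5 x - p n 5 y" "X n 2 x - X n 2 y" "X n 4 x - X n 4 y" "X n 6 x - X n 6 y"]
          hp[of 1] hp[of 3] hp[of 5] hX[of 2] hX[of 4] hX[of 6] by simp
    qed
  qed auto
  define h where "h i x = (if i = 1 then fst (g x) $ 1 else if i = 3 then fst (g x) $ 2 else fst (g x) $ 3)" for i :: nat and x
  define m where "m i x = (if i = 2 then snd (g x) $ 1 else if i = 4 then snd (g x) $ 2 else snd (g x) $ 3)" for i :: nat and x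
  have ch: "continuous_on {0..L} (h i)" "continuous_on {0..L} (m i)" for i
    unfolding h_def m_def by (cases "i = 1"; cases "i = 3"; auto intro!: continuous_intros g)
      (cases "i = 2"; cases "i = 4"; auto intro!: continuous_intros g)
  have comp_le: "cmod (fst v $ j) \<le> norm v" "cmod (snd v $ j) \<le> norm v" for v :: "(complex^3) \<times> (complex^3)" and j
    using order_trans[OF Finite_Cartesian_Product.norm_nth_le norm_fst_le[of "fst v" "snd v"]] order_trans[OF Finite_Cartesian_Product.norm_nth_le norm_snd_le[of "snd v" "fst v"]]
    by simp_all
  have near: "cmod (p n i x - h i x) \<le> norm (\<Phi> n x - g x)" if "i \<in> {1,3,5}" for i n x
    using comp_le(1)[of "\<Phi> n x - g x" 1] comp_le(1)[of "\<Phi> n x - g x" 2] comp_le(1)[of "\<Phi> n x - g x" 3] that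
    by (auto simp: \<Phi>_def h_def)
  have nearX: "cmod (X n i x - m i x) \<le> norm (\<Phi> n x - g x)" if "i \<in> {2,4,6}" for i n x
    using comp_le(2)[of "\<Phi> n x - g x" 1] comp_le(2)[of "\<Phi> n x - g x" 2] comp_le(2)[of "\<Phi> n x - g x" 3] that
    by (auto simp: \<Phi>_def m_def)
  \<comment> \<open>The limit state: displacements as primitives of the limiting slopes h,
    velocities as the limits m.\<close>
  define V :: state where "V i x = (if i \<in> {1,3,5} then integral {0..x} (h i) else m i x)" for i x
  have Vodd: "has_wderiv L (V i) (h i)" "V i 0 = 0" if "i \<in> {1,3,5}" for i
    using that by (auto simp: V_def intro!: wderivI L2_continuous ch)
  have VL: "V i L = 0" if i: "i \<in> {1,3,5}" for i
  proof -
    have i6: "i \<in> {1..6}" using i by auto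
    \<comment> \<open>Each displacement of X vanishes at L, and slopes that are uniformly e/L close
      change the integral over [0, L] by at most e.\<close>
    have "cmod (V i L) \<le> 0 + e" if e: "0 < e" for e
    proof -
      obtain n where n: "\<And>x. x \<in> {0..L} \<Longrightarrow> norm (\<Phi> (k n) x - g x) < e / L"
        using g(3)[of "e / L"] e pos(7) by auto
      have "V i L - X (k n) i L = (V i L - V i 0) - (X (k n) i L - X (k n) i 0)" using Vodd(2)[OF i] w(2)[OF i6] by simp
      also have "\<dots> = integral {0..L} (\<lambda>x. h i x - p (k n) i x)"
        using wderiv_diff_eq[OF Vodd(1)[OF i], of 0 L] wderiv_diff_eq[OF w(1)[OF i6], of 0 L] L0
          L2_integrable[OF wderiv_L2[OF Vodd(1)[OF i]], of 0 L] L2_integrable[OF L2s(2)[OF i6], of 0 L] by (simp add: integral_diff)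
      also have "cmod \<dots> \<le> integral {0..L} (\<lambda>x. e / L)"
      proof (rule integral_norm_bound_integral)
        show "(\<lambda>x. h i x - p (k n) i x) integrable_on {0..L}"
          using L2_integrable[OF wderiv_L2[OF Vodd(1)[OF i]], of 0 L] L2_integrable[OF L2s(2)[OF i6], of 0 L] by (intro integrable_diff) auto
        show "norm (h i x - p (k n) i x) \<le> e / L" if "x \<in> {0..L}" for x
          using near[OF i, of "k n" x] n[OF that] by (simp add: norm_minus_commute)
      qed auto
      also have "\<dots> = e" using pos(7) by simp
      finally show ?thesis using w(3)[OF i6] by simp
    qed
    then have "cmod (V i L) \<le> 0" by (rule field_le_epsilon)
    then show ?thesis by simp
  qed
  have VH: "V \<in> H"
  proof (rule HI[where p=h])
    show "has_wderiv L (V i) (h i) \<and> V i 0 = 0 \<and> V i L = 0" if "i \<in> {1,3,5}" for i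
      using Vodd[OF that] VL[OF that] by simp
    show "L2 L (V i)" if "i \<in> {2,4,6}" for i
    proof -
      have "V i = m i" using that by (auto simp: V_def fun_eq_iff)
      then show ?thesis using L2_continuous[OF ch(2)] by simp
    qed
  qed
  have "(\<lambda>n. nrm (X (k n) - V)) \<longlonglongrightarrow> 0"
  proof (rule LIMSEQ_I)
    fix e :: real assume e: "0 < e"
    define A where "A = 6 * CU * L"
    have A: "0 < A" using CU_pos pos(7) by (simp add: A_def)
    \<comment> \<open>Chosen with A d^2 < e^2, where A collects the factor from
      \<open>energy_le\<close> and the length of the interval.\<close>
    define d where "d = e / sqrt (A + 1)"
    have d: "0 < d" "A * d\<^sup>2 < e\<^sup>2" using e A by (simp_all add: d_def power_divide field_simps)
    obtain N where N: "\<And>n x. N \<le> n \<Longrightarrow> x \<in> {0..L} \<Longrightarrow> norm (\<Phi> (k n) x - g x) < d" using g(3)[OF d(1)] by blast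
    have "nrm (X (k n) - V) < e" if n: "N \<le> n" for n
    proof -
      have "(nrm (X (k n) - V))\<^sup>2 \<le> 6 * CU * (L * d\<^sup>2)"
      proof (rule energy_le[where p="\<lambda>i x. p (k n) i x - h i x"])
        show "X (k n) - V \<in> H" by (intro mem XH VH)
        show "has_wderiv L ((X (k n) - V) i) (\<lambda>x. p (k n) i x - h i x)" if i: "i \<in> {1,3,5}" for i
        proof -
          have "i \<in> {1..6}" using i by auto
          from wderiv_diff[OF w(1)[OF this, of "k n"] Vodd(1)[OF i]] show ?thesis by (simp add: fun_diff_def)
        qed
        show "l2ip L (\<lambda>x. p (k n) i x - h i x) (\<lambda>x. p (k n) i x - h i x) \<le> L * d\<^sup>2" if i: "i \<in> {1,3,5}" for i
        proof (rule l2ip_le_sup[OF _ _ L0])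
          have "i \<in> {1..6}" using i by auto
          then show "L2 L (\<lambda>x. p (k n) i x - h i x)" by (intro L2_diff L2s L2_continuous ch)
          show "cmod (p (k n) i x - h i x) \<le> d" if "x \<in> {0..L}" for x
            using near[OF i, of "k n" x] N[OF n that] by simp
        qed
        show "l2ip L ((X (k n) - V) i) ((X (k n) - V) i) \<le> L * d\<^sup>2" if i: "i \<in> {2,4,6}" for i
        proof (rule l2ip_le_sup[OF _ _ L0])
          have i6: "i \<in> {1..6}" using i by auto
          have Vm: "(X (k n) - V) i = (\<lambda>x. X (k n) i x - m i x)" using i by (auto simp: V_def fun_eq_iff)
          show "L2 L ((X (k n) - V) i)" unfolding Vm by (intro L2_diff L2s i6 L2_continuous ch)
          show "cmod ((X (k n) - V) i x) \<le> d" if "x \<in> {0..L}" for x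
            unfolding Vm using nearX[OF i, of "k n" x] N[OF n that] by simp
        qed
      qed
      also have "\<dots> = A * d\<^sup>2" by (simp add: A_def)
      finally have "(nrm (X (k n) - V))\<^sup>2 < e\<^sup>2" using d(2) by simp
      then show ?thesis by (rule power2_less_imp_less[OF _ less_imp_le[OF e]])
    qed
    then show "\<exists>N. \<forall>n\<ge>N. norm (nrm (X (k n) - V) - 0) < e"
      using nrm_nonneg[OF mem(5)[OF XH VH]] by auto
  qed
  with g(2) VH show ?thesis by blast
qed

section \<open>Linearity of the operator and the instance of the abstract setting\<close>

lemma DA_add: "DA W p q \<Longrightarrow> DA W' p' q' \<Longrightarrow> DA (W + W') (\<lambda>i x. p i x + p' i x) (\<lambda>i x. q i x + q' i x)"
  unfolding DA_def by (auto simp: func_plus intro!: wderiv_add)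

lemma DA_scale: "DA W p q \<Longrightarrow> DA (sscale c W) (\<lambda>i x. c * p i x) (\<lambda>i x. c * q i x)"
  unfolding DA_def by (auto simp: sscale_def intro!: wderiv_cmult)

lemma opA_add:
  assumes D: "DA W p q" and D': "DA W' p' q'"
  shows "nrm (opA P (W + W') - (opA P W + opA P W')) = 0"
proof (rule zero_imp_null)
  note D2 = DA_add[OF D D']
  show "opA P (W + W') - (opA P W + opA P W') \<in> H" by (intro mem opA_H[OF D] opA_H[OF D'] opA_H[OF D2])
  show "(opA P (W + W') - (opA P W + opA P W')) i x = 0" if "i \<in> {1,3,5}" for i x
    using that opA_odd[of W] opA_odd[of W'] opA_odd[of "W + W'"] by (auto simp del: One_nat_def)
  have "ae (\<lambda>x. opA P (W + W') 2 x = opA P W 2 x + opA P W' 2 x)"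
    using opA_AE(1)[OF D] opA_AE(1)[OF D'] opA_AE(1)[OF D2]
  proof eventually_elim
    case (elim x)
    show ?case unfolding elim by (simp add: algebra_simps add_divide_distrib diff_divide_distrib)
  qed
  moreover have "ae (\<lambda>x. opA P (W + W') 4 x = opA P W 4 x + opA P W' 4 x)"
    using opA_AE(2)[OF D] opA_AE(2)[OF D'] opA_AE(2)[OF D2]
  proof eventually_elim
    case (elim x)
    show ?case unfolding elim by (simp add: algebra_simps add_divide_distrib diff_divide_distrib)
  qed
  moreover have "ae (\<lambda>x. opA P (W + W') 6 x = opA P W 6 x + opA P W' 6 x)"
    using opA_AE(3)[OF D] opA_AE(3)[OF D'] opA_AE(3)[OF D2]
  proof eventually_elim
    case (elim x)
    show ?case unfolding elim by (simp add: algebra_simps add_divide_distrib diff_divide_distrib)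
  qed
  ultimately show "ae (\<lambda>x. (opA P (W + W') - (opA P W + opA P W')) i x = 0)" if "i \<in> {2,4,6}" for i
    using that by auto
qed

lemma opA_scale:
  assumes D: "DA W p q" shows "nrm (opA P (sscale c W) - sscale c (opA P W)) = 0"
proof (rule zero_imp_null)
  note D2 = DA_scale[OF D, of c]
  show "opA P (sscale c W) - sscale c (opA P W) \<in> H" by (intro mem opA_H[OF D] opA_H[OF D2])
  show "(opA P (sscale c W) - sscale c (opA P W)) i x = 0" if "i \<in> {1,3,5}" for i x
    using that opA_odd[of W] opA_odd[of "sscale c W"] by (auto simp: sscale_def simp del: One_nat_def)
  have "ae (\<lambda>x. opA P (sscale c W) 2 x = c * opA P W 2 x)"
    using opA_AE(1)[OF D] opA_AE(1)[OF D2]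
  proof eventually_elim
    case (elim x)
    show ?case unfolding elim by (simp add: sscale_def algebra_simps add_divide_distrib diff_divide_distrib)
  qed
  moreover have "ae (\<lambda>x. opA P (sscale c W) 4 x = c * opA P W 4 x)"
    using opA_AE(2)[OF D] opA_AE(2)[OF D2]
  proof eventually_elim
    case (elim x)
    show ?case unfolding elim by (simp add: sscale_def algebra_simps add_divide_distrib diff_divide_distrib)
  qed
  moreover have "ae (\<lambda>x. opA P (sscale c W) 6 x = c * opA P W 6 x)"
    using opA_AE(3)[OF D] opA_AE(3)[OF D2]
  proof eventually_elim
    case (elim x)
    show ?case unfolding elim by (simp add: sscale_def algebra_simps add_divide_distrib diff_divide_distrib)
  qed
  ultimately show "ae (\<lambda>x. (opA P (sscale c W) - sscale c (opA P W)) i x = 0)" if "i \<in> {2,4,6}" for i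
    using that by (auto simp: sscale_def)
qed

sublocale dissipative_operator H sscale ip "{U. inDA P U}" "opA P"
proof
  show "x \<in> {U. inDA P U} \<Longrightarrow> x \<in> H" for x using DA_H by (auto simp: inDA_iff)
  show "x \<in> {U. inDA P U} \<Longrightarrow> opA P x \<in> H" for x using opA_H by (auto simp: inDA_iff)
  show "x \<in> {U. inDA P U} \<Longrightarrow> y \<in> {U. inDA P U} \<Longrightarrow> x + y \<in> {U. inDA P U}" for x y
    using DA_add by (auto simp: inDA_iff) blast
  show "x \<in> {U. inDA P U} \<Longrightarrow> sscale c x \<in> {U. inDA P U}" for x c
    using DA_scale by (auto simp: inDA_iff) blast
  show "x \<in> {U. inDA P U} \<Longrightarrow> y \<in> {U. inDA P U} \<Longrightarrow> nrm (opA P (x + y) - (opA P x + opA P y)) = 0" for x y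
    using opA_add by (auto simp: inDA_iff)
  show "x \<in> {U. inDA P U} \<Longrightarrow> nrm (opA P (sscale c x) - sscale c (opA P x)) = 0" for x c
    using opA_scale by (auto simp: inDA_iff)
  show "x \<in> {U. inDA P U} \<Longrightarrow> ip (opA P x) x \<le> 0" for x using opA_dissipative by (auto simp: inDA_iff)
  show "\<exists>r w. strict_mono (r :: nat \<Rightarrow> nat) \<and> w \<in> H \<and> (\<lambda>n. nrm (X (r n) - w)) \<longlonglongrightarrow> 0"
    if "\<And>n. X n \<in> {U. inDA P U}" "\<And>n. nrm (X n) \<le> C" "\<And>n. nrm (opA P (X n)) \<le> C" for X C
    by (rule inDA_compact_embedding[of X C]) (use that in auto)
  show "\<exists>u\<in>{U. inDA P U}. nrm (x - u) < e" if "x \<in> H" "0 < e" for x e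
    using inDA_dense[OF that] by blast
  show "\<exists>u\<in>{U. inDA P U}. nrm (sscale z u - opA P u - f) = 0"
    if "\<And>u. u \<in> {U. inDA P U} \<Longrightarrow> nrm (sscale z u - opA P u) = 0 \<Longrightarrow> nrm u = 0" "f \<in> H" for z f
    using fredholm_alternative[OF _ that(2), of z] that(1) by (auto simp: inDA_iff)
  show "nrm u = 0" if "u \<in> {U. inDA P U}" "nrm (sscale (\<i> * of_real w) u - opA P u) = 0" for u w
    using that opA_no_imaginary_eigenvalue by (auto simp: inDA_iff)
qed

end

section \<open>Conclusion\<close>

context bresse
begin

lemma in_H_iff: "U \<in> H \<longleftrightarrow> inH P U"
  by (simp add: H_def)

lemma imaginary_resolvent: "in_resolvent P (\<i> * of_real w)"
proof -
  let ?z = "\<i> * complex_of_real w"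
  have D_H: "U \<in> H" "opA P U \<in> H" "sscale ?z U - opA P U \<in> H" if "inDA P U" for U
    using that D_mem A_mem by (auto intro!: mem)
  have inj': "nrm U = 0" if "inDA P U" "nrm (sscale ?z U - opA P U) = 0" for U
    using no_imaginary_eigenvalue[of U w] that by simp
  then have inj: "normH P U = 0" if "inDA P U" "normH P (sscale ?z U - opA P U) = 0" for U
    using that by (simp add: normH_eq D_H)
  have surj: "\<exists>U. inDA P U \<and> normH P (sscale ?z U - opA P U - F) = 0" if F: "inH P F" for F
  proof -
    have "\<exists>u\<in>{U. inDA P U}. nrm (sscale ?z u - opA P u - F) = 0"
      by (rule fredholm) (use F inj' in \<open>auto simp: in_H_iff\<close>)
    then obtain U where U: "inDA P U" "nrm (sscale ?z U - opA P U - F) = 0" by blast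
    moreover have "sscale ?z U - opA P U - F \<in> H" using D_H(3)[OF U(1)] F by (simp add: in_H_iff[symmetric] mem(5))
    ultimately show ?thesis using normH_eq by metis
  qed
  obtain C where C: "\<And>x y. graph x y \<Longrightarrow> nrm x \<le> C * nrm (sscale ?z x - y)"
    using bounded_inverse_imaginary[of w] by blast
  have "normH P U \<le> C * normH P (sscale ?z U - opA P U)" if "inDA P U" for U
    using C[OF graph_D, of U] that by (simp add: normH_eq D_H)
  with inj surj show ?thesis unfolding in_resolvent_def state_ops by blast
qed

text \<open>It remains to present the semigroup in the abstract form. \<open>normH\<close> is known
  to agree with \<open>nrm\<close> only on H, and \<open>T\<close> maps into H at nonnegative times,
  so memberships accompany every translation.\<close>

lemma semigroup_strongly_stable:
  assumes T: "C0_semigroup_generated_by_A P T" and U0: "inH P U0"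
  shows "((\<lambda>t. normH P (T t U0)) \<longlongrightarrow> 0) at_top"
proof -
  note T = T[unfolded C0_semigroup_generated_by_A_def state_ops]
  have T1: "T t U \<in> H" if "0 \<le> t" "U \<in> H" for t U using T that by (simp add: in_H_iff)
  have T2: "normH P (T t (sscale c U + V) - (sscale c (T t U) + T t V)) = 0" if "0 \<le> t" "U \<in> H" "V \<in> H" for t U V c
    using T that by (simp add: in_H_iff)
  have T3: "\<exists>C. \<forall>U. inH P U \<longrightarrow> normH P (T t U) \<le> C * normH P U" if "0 \<le> t" for t
    using T that by blast
  have T4: "normH P (T 0 U - U) = 0" if "U \<in> H" for U using T that by (simp add: in_H_iff)
  have T5: "normH P (T (t + s) U - T t (T s U)) = 0" if "0 \<le> t" "0 \<le> s" "U \<in> H" for t s U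
    using T that by (simp add: in_H_iff)
  have T6: "((\<lambda>t. normH P (T t U - U)) \<longlongrightarrow> 0) (at_right 0)" if "U \<in> H" for U using T that by (simp add: in_H_iff)
  define Q where "Q U V \<longleftrightarrow> ((\<lambda>h. normH P (sscale (of_real (1 / h)) (T h U - U) - V)) \<longlongrightarrow> 0) (at_right 0)" for U V
  have T7: "(\<exists>V. inH P V \<and> Q U V) \<longleftrightarrow> (\<exists>W. inDA P W \<and> normH P (U - W) = 0)" if "U \<in> H" for U
    unfolding Q_def using T that by (simp add: in_H_iff)
  have T8: "normH P (V - opA P W) = 0" if "U \<in> H" "V \<in> H" "inDA P W" "normH P (U - W) = 0" "Q U V" for U V W
    using T that unfolding Q_def in_H_iff by blast
  have D_H: "W \<in> H" "opA P W \<in> H" if "inDA P W" for W using that D_mem A_mem by auto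
  have ev: "\<forall>\<^sub>F h in at_right 0. (0::real) < h" by (simp add: eventually_at_right_less)
  have Q_iff: "Q U V \<longleftrightarrow> ((\<lambda>h. nrm (sscale (of_real (1 / h)) (T h U - U) - V)) \<longlongrightarrow> 0) (at_right 0)" if "U \<in> H" "V \<in> H" for U V
    unfolding Q_def
  proof (rule tendsto_cong)
    show "\<forall>\<^sub>F h in at_right 0. normH P (sscale (of_real (1 / h)) (T h U - U) - V) = nrm (sscale (of_real (1 / h)) (T h U - U) - V)"
      using ev by eventually_elim (use that in \<open>auto intro!: normH_eq mem T1\<close>)
  qed
  interpret S: generated_semigroup H sscale ip "{U. inDA P U}" "opA P" T
  proof
    show "0 \<le> t \<Longrightarrow> x \<in> H \<Longrightarrow> T t x \<in> H" for t x by (rule T1)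
    show "nrm (T t (sscale c x + y) - (sscale c (T t x) + T t y)) = 0" if "0 \<le> t" "x \<in> H" "y \<in> H" for t x y c
      using T2[OF that] that by (subst (asm) normH_eq) (auto intro!: mem T1)
    show "\<exists>C. \<forall>x\<in>H. nrm (T t x) \<le> C * nrm x" if t: "0 \<le> t" for t
      using T3[OF t] t by (auto simp: in_H_iff[symmetric] normH_eq T1)
    show "nrm (T 0 x - x) = 0" if "x \<in> H" for x
      using T4[OF that] that by (subst (asm) normH_eq) (auto intro!: mem T1)
    show "nrm (T (t + s) x - T t (T s x)) = 0" if "0 \<le> t" "0 \<le> s" "x \<in> H" for t s x
      using T5[OF that] that by (subst (asm) normH_eq) (auto intro!: mem T1)
    show "((\<lambda>h. nrm (T h x - x)) \<longlongrightarrow> 0) (at_right 0)" if x: "x \<in> H" for x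
    proof (rule Lim_transform_eventually[OF T6[OF x]])
      show "\<forall>\<^sub>F h in at_right 0. normH P (T h x - x) = nrm (T h x - x)"
        using ev by eventually_elim (use x in \<open>auto intro!: normH_eq mem T1\<close>)
    qed
    fix x y assume x: "x \<in> H" and y: "y \<in> H"
    \<comment> \<open>The definition describes the generator by two clauses, one for existence of
      the limit and one for its value. From left to right both apply directly; conversely some limit
      V exists, the value clause identifies it with y up to a null state, and the limit may be taken
      at y instead.\<close>
    have "Q x y \<longleftrightarrow> graph x y"
    proof
      assume q: "Q x y"
      with T7[OF x] y obtain W where W: "inDA P W" "normH P (x - W) = 0" by (auto simp: in_H_iff)
      with T8[OF x y W q] show "graph x y"
        using x y D_H[OF W(1)] unfolding graph_def by (auto simp: normH_eq mem)
    next
      assume "graph x y"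
      then obtain W where W: "inDA P W" "nrm (x - W) = 0" "nrm (y - opA P W) = 0" by (auto simp: graph_def)
      note DW = D_H[OF W(1)]
      have W': "normH P (x - W) = 0" using W(2) x DW by (simp add: normH_eq mem)
      with T7[OF x] W(1) obtain V where V: "V \<in> H" "Q x V" by (auto simp: in_H_iff)
      have "nrm (V - opA P W) = 0" using T8[OF x V(1) W(1) W' V(2)] V DW by (simp add: normH_eq mem)
      then have "nrm (V - y) = 0"
        by (rule eqv_trans[OF V(1) DW(2) y _ eqv_sym[OF y DW(2) W(3)]])
      then have same: "nrm (s - V) = nrm (s - y)" if "s \<in> H" for s
        using that V(1) y by (intro eqv_nrm eqv_diff mem) (auto simp: nrm_zero)
      have "((\<lambda>h. nrm (sscale (of_real (1 / h)) (T h x - x) - V)) \<longlongrightarrow> 0) (at_right 0)"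
        using V Q_iff[OF x V(1)] by simp
      then have "((\<lambda>h. nrm (sscale (of_real (1 / h)) (T h x - x) - y)) \<longlongrightarrow> 0) (at_right 0)"
      proof (rule Lim_transform_eventually)
        show "\<forall>\<^sub>F h in at_right 0. nrm (sscale (of_real (1 / h)) (T h x - x) - V) = nrm (sscale (of_real (1 / h)) (T h x - x) - y)"
          using ev by eventually_elim (use x in \<open>auto intro!: same mem T1\<close>)
      qed
      then show "Q x y" using Q_iff[OF x y] by simp
    qed
    then show "((\<lambda>h. nrm (sscale (of_real (1 / h)) (T h x - x) - y)) \<longlongrightarrow> 0) (at_right 0) \<longleftrightarrow> graph x y"
      using Q_iff[OF x y] by simp
  qed
  have U: "U0 \<in> H" using U0 by (simp add: in_H_iff)
  show ?thesis
  proof (rule Lim_transform_eventually[OF S.strongly_stable[OF U]])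
    show "\<forall>\<^sub>F t in at_top. nrm (T t U0) = normH P (T t U0)"
      using eventually_ge_at_top[of 0] by eventually_elim (use U in \<open>simp add: normH_eq T1\<close>)
  qed
qed

end

theorem theorem3p1:
  fixes r1 r2 c1 c2 c3 l L \<beta> a0 :: real and a :: "real \<Rightarrow> real"
    and T :: "real \<Rightarrow> state \<Rightarrow> state"
  defines "P \<equiv> \<lparr>rho1 = r1, rho2 = r2, kk1 = c1, kk2 = c2, kk3 = c3, ll = l, len = L, damp = a\<rparr>"
  assumes "r1 > 0" "r2 > 0" "c1 > 0" "c2 > 0" "c3 > 0" "l > 0" "L > 0"
    and "0 < \<beta>" "\<beta> < L" "a0 > 0"
    and "\<forall>x\<in>{0<..<\<beta>}. a x = a0" and "\<forall>x\<in>{\<beta><..<L}. a x = 0"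
    and "C0_semigroup_generated_by_A P T"
  shows "spectrum_A P \<inter> {\<i> * complex_of_real \<omega> | \<omega>. True} = {} \<and>
         (\<forall>U0. inH P U0 \<longrightarrow> ((\<lambda>t. normH P (T t U0)) \<longlongrightarrow> 0) at_top)"
proof -
  \<comment> \<open>a0 together with the three point values that the hypotheses leave free.\<close>
  define Ka where "Ka = a0 + \<bar>a 0\<bar> + \<bar>a \<beta>\<bar> + \<bar>a L\<bar>"
  \<comment> \<open>On [0, L] the coefficient is determined by finitely many constants; written as a
    case distinction it is visibly Borel measurable.\<close>
  define a' where "a' x = (if x = 0 then a 0 else if x = \<beta> then a \<beta> else if x = L then a L else if x < \<beta> then a0 else 0)" for x
  have aa: "a x = a' x" if x: "x \<in> {0..L}" for x
    using assms(12,13) x unfolding a'_def by (cases "x < \<beta>") auto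
  have "a' \<in> borel_measurable (lebesgue_on {0..L})"
  proof -
    have "a' \<in> borel_measurable borel" unfolding a'_def by measurable
    then have "a' \<in> borel_measurable lebesgue" by (intro measurable_completion) simp
    then show ?thesis by (rule measurable_restrict_space1)
  qed
  then have am: "a \<in> borel_measurable (lebesgue_on {0..L})"
    by (subst measurable_cong[where g=a']) (auto simp: aa)
  interpret bresse P \<beta> a0 Ka
  proof
    show "damp P x = a0" if "0 < x" "x < \<beta>" for x using assms(12) that by (simp add: P_def)
    show "AE x in lebesgue_on {0..len P}. 0 \<le> damp P x"
      unfolding AE_negligible P_def bresse_params.simps
    proof (intro exI[of _ "{0, \<beta>, L}"] conjI ballI)
      fix x assume "x \<in> {0..L} - {0, \<beta>, L}"
      then show "0 \<le> a x" using aa[of x] assms(11) by (auto simp: a'_def)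
    qed simp
    show "damp P \<in> borel_measurable (lebesgue_on {0..len P})" using am by (simp add: P_def)
    show "\<bar>damp P x\<bar> \<le> Ka" if "x \<in> {0..len P}" for x
      using aa[of x] that assms(11) by (auto simp: P_def a'_def Ka_def)
    show "0 \<le> Ka" using assms(11) by (simp add: Ka_def)
  qed (use assms(2-11) in \<open>simp_all add: P_def\<close>)
  have "spectrum_A P \<inter> {\<i> * complex_of_real \<omega> | \<omega>. True} = {}"
    using imaginary_resolvent by (auto simp: spectrum_A_def)
  with semigroup_strongly_stable[OF assms(14)] show ?thesis by blast
qed

end
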